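(* The module $\mathbf{F}_2\uparrow_{S_3\wr S_2}^{S_6}$ has a Specht filtration, but it does not have a Specht filtration with the Specht factors indicated by its ordinary character $1_{S_3\wr S_2}\uparrow^{S_6}=\chi^{(6)}+\chi^{(4,2)}$; that is, it has no Specht filtration whose factors are $S^{(6)}$ and $S^{(4,2)}$ (each once, in some order).
   Context: $S_3\wr S_2\le S_6$ is the stabilizer of a partition of $\{1,\dots,6\}$ into two blocks of size $3$. $\mathbf{F}_2\uparrow_G^{S_6}$ is the module induced from the trivial $\mathbf{F}_2G$-module. $\chi^\lambda$ is the ordinary irreducible character of the symmetric group canonically labelled by $\lambda$. $S^\lambda$ is the Specht module over $\mathbf{F}_2$ in the convention of James' lecture notes: the submodule of the permutation module on $\lambda$-tabloids spanned by the polytabloids. A module $U$ for $\mathbf{F}_2S_n$ has a Specht filtration if there is a chain of submodules $0\subset U_1\subset\cdots\subset U_r\subset U$ such that each successive quotient is isomorphic to a Specht module. *)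

theory Defs
  imports
    "HOL-Algebra.Algebra"
    "HOL-Algebra.Algebraic_Closure_Type"
    "HOL-Library.Z2"
    "HOL-Library.Multiset"
    "HOL-Library.Disjoint_Sets"
begin

section \<open>Modules over a group algebra\<close>

text \<open>
  A module for the group algebra \<open>K G\<close> is a \<open>K\<close>-module together with a \<open>K\<close>-linear left action
  of \<open>G\<close>. The inherited record fields \<open>mult\<close> and \<open>one\<close> carry no information, as usual for
  \<^typ>\<open>('a, 'b) module\<close>.
\<close>

record ('a, 'b, 'g) gmodule = "('a, 'b) module" +
  gact :: "'g \<Rightarrow> 'b \<Rightarrow> 'b"

locale group_module = module R M + group G
  for R :: "('a, 'r) ring_scheme" and G :: "('g, 'h) monoid_scheme"
    and M :: "('a, 'b, 'g, 'm) gmodule_scheme" +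
  assumes gact_closed:
      "\<lbrakk>g \<in> carrier G; v \<in> carrier M\<rbrakk> \<Longrightarrow> gact M g v \<in> carrier M"
    and gact_add:
      "\<lbrakk>g \<in> carrier G; v \<in> carrier M; w \<in> carrier M\<rbrakk> \<Longrightarrow>
       gact M g (v \<oplus>\<^bsub>M\<^esub> w) = gact M g v \<oplus>\<^bsub>M\<^esub> gact M g w"
    and gact_smult:
      "\<lbrakk>g \<in> carrier G; a \<in> carrier R; v \<in> carrier M\<rbrakk> \<Longrightarrow>
       gact M g (a \<odot>\<^bsub>M\<^esub> v) = a \<odot>\<^bsub>M\<^esub> gact M g v"
    and gact_one:
      "v \<in> carrier M \<Longrightarrow> gact M \<one>\<^bsub>G\<^esub> v = v"
    and gact_mult:
      "\<lbrakk>g \<in> carrier G; h \<in> carrier G; v \<in> carrier M\<rbrakk> \<Longrightarrow>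
       gact M (g \<otimes>\<^bsub>G\<^esub> h) v = gact M g (gact M h v)"

definition group_submodule ::
    "('a, 'r) ring_scheme \<Rightarrow> ('g, 'h) monoid_scheme \<Rightarrow> ('a, 'b, 'g, 'm) gmodule_scheme \<Rightarrow>
     'b set \<Rightarrow> bool" where
  "group_submodule R G M U \<longleftrightarrow>
     submodule U R M \<and> (\<forall>g\<in>carrier G. \<forall>u\<in>U. gact M g u \<in> U)"

definition quotient_gmodule ::
    "('a, 'b, 'g, 'm) gmodule_scheme \<Rightarrow> 'b set \<Rightarrow> ('a, 'b set, 'g) gmodule" where
  "quotient_gmodule M N =
     \<lparr>carrier = a_rcosets\<^bsub>M\<^esub> N, monoid.mult = undefined, one = undefined,
      ring.zero = N, ring.add = set_add M,
      module.smult = (\<lambda>a C. set_add M N ((\<lambda>v. a \<odot>\<^bsub>M\<^esub> v) ` C)),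
      gact = (\<lambda>g C. set_add M N (gact M g ` C))\<rparr>"

definition gmodule_isomorphic ::
    "('a, 'r) ring_scheme \<Rightarrow> ('g, 'h) monoid_scheme \<Rightarrow> ('a, 'b, 'g, 'm) gmodule_scheme \<Rightarrow>
     ('a, 'c, 'g, 'n) gmodule_scheme \<Rightarrow> bool" where
  "gmodule_isomorphic R G M N \<longleftrightarrow>
     (\<exists>\<phi> \<in> iso (add_monoid M) (add_monoid N).
        (\<forall>a\<in>carrier R. \<forall>v\<in>carrier M. \<phi> (a \<odot>\<^bsub>M\<^esub> v) = a \<odot>\<^bsub>N\<^esub> \<phi> v) \<and>
        (\<forall>g\<in>carrier G. \<forall>v\<in>carrier M. \<phi> (gact M g v) = gact N g (\<phi> v)))"

definition is_basis ::
    "('a, 'r) ring_scheme \<Rightarrow> ('a, 'b, 'm) module_scheme \<Rightarrow> nat \<Rightarrow> (nat \<Rightarrow> 'b) \<Rightarrow> bool" where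
  "is_basis R M n b \<longleftrightarrow>
     b \<in> {..<n} \<rightarrow> carrier M \<and>
     (\<forall>v\<in>carrier M. \<exists>!c. c \<in> {..<n} \<rightarrow>\<^sub>E carrier R \<and> v = (\<Oplus>\<^bsub>M\<^esub>i\<in>{..<n}. c i \<odot>\<^bsub>M\<^esub> b i))"

text \<open>
  The character is the trace of the matrix of \<open>g\<close> in a basis of \<open>M\<close>; the value does not depend
  on the basis, so the definite description is proper when \<open>R\<close> is a field and \<open>M\<close> is
  finite-dimensional.
\<close>

definition character ::
    "('a, 'r) ring_scheme \<Rightarrow> ('a, 'b, 'g, 'm) gmodule_scheme \<Rightarrow> 'g \<Rightarrow> 'a" where
  "character R M g =
     (THE \<tau>. \<exists>n b A. is_basis R M n b \<and>
        (\<forall>i<n. \<forall>j<n. A i j \<in> carrier R) \<and>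
        (\<forall>j<n. gact M g (b j) = (\<Oplus>\<^bsub>M\<^esub>i\<in>{..<n}. A i j \<odot>\<^bsub>M\<^esub> b i)) \<and>
        \<tau> = (\<Oplus>\<^bsub>R\<^esub>i\<in>{..<n}. A i i))"

definition trivial_gmodule :: "('a, 'r) ring_scheme \<Rightarrow> ('a, 'a, 'g) gmodule" where
  "trivial_gmodule R =
     \<lparr>carrier = carrier R, monoid.mult = undefined, one = undefined,
      ring.zero = \<zero>\<^bsub>R\<^esub>, ring.add = (\<lambda>v w. v \<oplus>\<^bsub>R\<^esub> w), module.smult = (\<lambda>a v. a \<otimes>\<^bsub>R\<^esub> v), gact = (\<lambda>g v. v)\<rparr>"

text \<open>
  The module induced from the \<open>K H\<close>-module \<open>W\<close> to the finite group \<open>G\<close>, realised as the space of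
  functions \<open>f : G \<rightarrow> W\<close> with \<open>f (x h) = h\<^sup>-\<^sup>1 f x\<close> for \<open>h \<in> H\<close>, on which \<open>G\<close> acts by
  \<open>(g f) x = f (g\<^sup>-\<^sup>1 x)\<close>. For finite \<open>G\<close> it is isomorphic to \<open>K G \<otimes> W\<close> (tensor product over \<open>K H\<close>).
\<close>

definition induced_gmodule ::
    "('g, 'h) monoid_scheme \<Rightarrow> 'g set \<Rightarrow> ('a, 'b, 'g, 'm) gmodule_scheme \<Rightarrow>
     ('a, 'g \<Rightarrow> 'b, 'g) gmodule" where
  "induced_gmodule G H W =
     \<lparr>carrier = {f \<in> carrier G \<rightarrow>\<^sub>E carrier W.
        \<forall>x\<in>carrier G. \<forall>h\<in>H. f (x \<otimes>\<^bsub>G\<^esub> h) = gact W (inv\<^bsub>G\<^esub> h) (f x)},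
      monoid.mult = undefined, one = undefined,
      ring.zero = (\<lambda>x\<in>carrier G. \<zero>\<^bsub>W\<^esub>),
      ring.add = (\<lambda>f f'. \<lambda>x\<in>carrier G. f x \<oplus>\<^bsub>W\<^esub> f' x),
      module.smult = (\<lambda>a f. \<lambda>x\<in>carrier G. a \<odot>\<^bsub>W\<^esub> f x),
      gact = (\<lambda>g f. \<lambda>x\<in>carrier G. f (inv\<^bsub>G\<^esub> g \<otimes>\<^bsub>G\<^esub> x))\<rparr>"

text \<open>
  The permutation module on a finite set \<open>\<Omega>\<close> with left action \<open>\<alpha>\<close> of \<open>G\<close>: formal linear combinations
  of elements of \<open>\<Omega>\<close> are coefficient functions, so \<open>g\<close> sends the basis element of \<open>x\<close> to that
  of \<open>\<alpha> g x\<close>.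
\<close>

definition permutation_gmodule ::
    "('a, 'r) ring_scheme \<Rightarrow> ('g, 'h) monoid_scheme \<Rightarrow> 'x set \<Rightarrow> ('g \<Rightarrow> 'x \<Rightarrow> 'x) \<Rightarrow>
     ('a, 'x \<Rightarrow> 'a, 'g) gmodule" where
  "permutation_gmodule R G \<Omega> \<alpha> =
     \<lparr>carrier = \<Omega> \<rightarrow>\<^sub>E carrier R, monoid.mult = undefined, one = undefined,
      ring.zero = (\<lambda>x\<in>\<Omega>. \<zero>\<^bsub>R\<^esub>),
      ring.add = (\<lambda>f f'. \<lambda>x\<in>\<Omega>. f x \<oplus>\<^bsub>R\<^esub> f' x),
      module.smult = (\<lambda>a f. \<lambda>x\<in>\<Omega>. a \<otimes>\<^bsub>R\<^esub> f x),
      gact = (\<lambda>g f. \<lambda>x\<in>\<Omega>. f (\<alpha> (inv\<^bsub>G\<^esub> g) x))\<rparr>"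

definition point_mass :: "('a, 'r) ring_scheme \<Rightarrow> 'x set \<Rightarrow> 'x \<Rightarrow> 'x \<Rightarrow> 'a" where
  "point_mass R \<Omega> x = (\<lambda>y\<in>\<Omega>. if y = x then \<one>\<^bsub>R\<^esub> else \<zero>\<^bsub>R\<^esub>)"


section \<open>Tableaux, tabloids and Specht modules\<close>

definition is_partition_of :: "nat list \<Rightarrow> nat \<Rightarrow> bool" where
  "is_partition_of l n \<longleftrightarrow> sorted_wrt (\<ge>) l \<and> 0 \<notin> set l \<and> sum_list l = n"

definition young_diagram :: "nat list \<Rightarrow> (nat \<times> nat) set" where
  "young_diagram l = {(i, j). i < length l \<and> j < l ! i}"

definition tableaux :: "nat list \<Rightarrow> (nat \<times> nat \<Rightarrow> nat) set" where
  "tableaux l = {t \<in> extensional (young_diagram l). bij_betw t (young_diagram l) {1..sum_list l}}"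

abbreviation tableau_act ::
    "nat list \<Rightarrow> (nat \<Rightarrow> nat) \<Rightarrow> (nat \<times> nat \<Rightarrow> nat) \<Rightarrow> nat \<times> nat \<Rightarrow> nat" where
  "tableau_act l \<sigma> t \<equiv> compose (young_diagram l) \<sigma> t"

definition row_stabilizer :: "nat list \<Rightarrow> (nat \<times> nat \<Rightarrow> nat) \<Rightarrow> (nat \<Rightarrow> nat) set" where
  "row_stabilizer l t =
     {\<sigma> \<in> carrier (sym_group (sum_list l)).
        \<forall>i. \<sigma> ` {t (i, j) |j. (i, j) \<in> young_diagram l} = {t (i, j) |j. (i, j) \<in> young_diagram l}}"

definition column_stabilizer :: "nat list \<Rightarrow> (nat \<times> nat \<Rightarrow> nat) \<Rightarrow> (nat \<Rightarrow> nat) set" where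
  "column_stabilizer l t =
     {\<sigma> \<in> carrier (sym_group (sum_list l)).
        \<forall>j. \<sigma> ` {t (i, j) |i. (i, j) \<in> young_diagram l} = {t (i, j) |i. (i, j) \<in> young_diagram l}}"

definition tabloid :: "nat list \<Rightarrow> (nat \<times> nat \<Rightarrow> nat) \<Rightarrow> (nat \<times> nat \<Rightarrow> nat) set" where
  "tabloid l t = {tableau_act l \<sigma> t |\<sigma>. \<sigma> \<in> row_stabilizer l t}"

definition tabloids :: "nat list \<Rightarrow> (nat \<times> nat \<Rightarrow> nat) set set" where
  "tabloids l = tabloid l ` tableaux l"

definition tabloid_gmodule ::
    "('a, 'r) ring_scheme \<Rightarrow> nat list \<Rightarrow>
     ('a, (nat \<times> nat \<Rightarrow> nat) set \<Rightarrow> 'a, nat \<Rightarrow> nat) gmodule" where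
  "tabloid_gmodule R l =
     permutation_gmodule R (sym_group (sum_list l)) (tabloids l) (\<lambda>\<sigma> T. tableau_act l \<sigma> ` T)"

definition polytabloid ::
    "('a, 'r) ring_scheme \<Rightarrow> nat list \<Rightarrow> (nat \<times> nat \<Rightarrow> nat) \<Rightarrow>
     (nat \<times> nat \<Rightarrow> nat) set \<Rightarrow> 'a" where
  "polytabloid R l t =
     (\<Oplus>\<^bsub>tabloid_gmodule R l\<^esub>\<sigma>\<in>column_stabilizer l t.
        (if evenperm \<sigma> then \<one>\<^bsub>R\<^esub> else \<ominus>\<^bsub>R\<^esub> \<one>\<^bsub>R\<^esub>) \<odot>\<^bsub>tabloid_gmodule R l\<^esub>
          point_mass R (tabloids l) (tabloid l (tableau_act l \<sigma> t)))"

definition specht_gmodule ::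
    "('a, 'r) ring_scheme \<Rightarrow> nat list \<Rightarrow>
     ('a, (nat \<times> nat \<Rightarrow> nat) set \<Rightarrow> 'a, nat \<Rightarrow> nat) gmodule" where
  "specht_gmodule R l =
     (tabloid_gmodule R l)\<lparr>carrier :=
        \<Inter>{U. submodule U R (tabloid_gmodule R l) \<and> polytabloid R l ` tableaux l \<subseteq> U}\<rparr>"

text \<open>
  \<open>Us = [U\<^sub>0, \<dots>, U\<^sub>r]\<close> is the chain, with \<open>U\<^sub>0 = 0\<close> and \<open>U\<^sub>r = M\<close>, and the quotient of
  \<open>Us ! Suc i\<close> by \<open>Us ! i\<close> is the Specht module labelled by \<open>ls ! i\<close>.
\<close>

definition specht_filtration ::
    "('a, 'r) ring_scheme \<Rightarrow> nat \<Rightarrow> ('a, 'b, nat \<Rightarrow> nat, 'm) gmodule_scheme \<Rightarrow>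
     'b set list \<Rightarrow> nat list list \<Rightarrow> bool" where
  "specht_filtration R n M Us ls \<longleftrightarrow>
     group_module R (sym_group n) M \<and>
     length Us = Suc (length ls) \<and> hd Us = {\<zero>\<^bsub>M\<^esub>} \<and> last Us = carrier M \<and>
     (\<forall>U\<in>set Us. group_submodule R (sym_group n) M U) \<and>
     (\<forall>l\<in>set ls. is_partition_of l n) \<and>
     (\<forall>i<length ls. Us ! i \<subset> Us ! Suc i \<and>
        gmodule_isomorphic R (sym_group n)
          (quotient_gmodule (M\<lparr>carrier := Us ! Suc i\<rparr>) (Us ! i)) (specht_gmodule R (ls ! i)))"

definition has_specht_filtration ::
    "('a, 'r) ring_scheme \<Rightarrow> nat \<Rightarrow> ('a, 'b, nat \<Rightarrow> nat, 'm) gmodule_scheme \<Rightarrow> bool" where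
  "has_specht_filtration R n M \<longleftrightarrow> (\<exists>Us ls. specht_filtration R n M Us ls)"

definition has_specht_filtration_with_factors ::
    "('a, 'r) ring_scheme \<Rightarrow> nat \<Rightarrow> ('a, 'b, nat \<Rightarrow> nat, 'm) gmodule_scheme \<Rightarrow>
     nat list multiset \<Rightarrow> bool" where
  "has_specht_filtration_with_factors R n M \<Lambda> \<longleftrightarrow>
     (\<exists>Us ls. specht_filtration R n M Us ls \<and> mset ls = \<Lambda>)"

definition set_partition_stabilizer :: "nat \<Rightarrow> nat set set \<Rightarrow> (nat \<Rightarrow> nat) set" where
  "set_partition_stabilizer n P = {\<sigma> \<in> carrier (sym_group n). (\<lambda>B. \<sigma> ` B) ` P = P}"

abbreviation F2 :: "bit ring" where
  "F2 \<equiv> ring_of_type_algebra"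

abbreviation complex_field :: "complex ring" where
  "complex_field \<equiv> ring_of_type_algebra"

text \<open>The irreducible character labelled by \<open>l\<close> is that of the complex Specht module.\<close>

definition ordinary_character :: "nat list \<Rightarrow> (nat \<Rightarrow> nat) \<Rightarrow> complex" where
  "ordinary_character l = character complex_field (specht_gmodule complex_field l)"

end

theory Submission
  imports Defs
begin

text \<open>
  A function in the induced module is a function \<open>F\<close> on the three-element subsets of \<open>{1..6}\<close> with
  \<open>F A = F (- A)\<close>.

  Over \<open>F2\<close>, sending \<open>F\<close> to the sums \<open>F x y\<close> of its values on the sets that contain \<open>x\<close> but not \<open>y\<close>
  gives a cocycle, \<open>F x y + F y z = F x z\<close>. Since the Specht module of \<open>(2,1,1,1,1)\<close> is the space
  \<open>F2^6 / (1,...,1)\<close> of such cocycles, this is a surjection onto it, and its kernel is the Specht module of \<open>(3,3)\<close>.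

  Let \<open>S\<close> be the Specht module of \<open>(4,2)\<close> over \<open>F2\<close>. Its polytabloids are the four-cycles on four of the
  six points. Let \<open>h\<close> be the cocycle attached to a four-cycle by a homomorphism to the module of
  cocycles, and let \<open>c\<close> be one of the two points off the cycle. Rotating the cycle shows that \<open>h c x\<close> is the same
  for all \<open>x\<close> on it; the three four-cycles on the same points sum to zero, so \<open>3 h c x = 0\<close>. Hence \<open>S\<close> has no nonzero map
  to the cocycles. In a filtration with factors \<open>S\<close> and the trivial module, the cocycle map therefore vanishes on
  the whole module or on all \<open>g F - F\<close>, and it does neither.

  Over the complex numbers, summing over the sets that contain a given pair identifies the functions of
  sum zero with the Specht module of \<open>(4,2)\<close>.
\<close>

text \<open>Counting cannot exclude the filtration. Reduced modulo 2, the ordinary character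
  describes the induced module, so the trivial module and \<open>S\<close> together have its
  dimension, 1 + 9 = 10 = 5 + 5, and its composition factors. The obstruction has to come from
  homomorphisms.

  The cocycle rule is a parity phenomenon: the triples left over when its two sides are compared
  form complementary pairs, on which F takes equal values. The cocycles appear as the Specht module
  of (2,1,1,1,1) because, over F2, a polytabloid of that shape is the star of one point: all
  tabloids whose first row contains it. Every cocycle is a sum of stars, and the six stars add up to
  zero because a pair has two points.

  The two orders of the factors need different arguments. If the trivial module is at the bottom,
  its cocycle takes a single value k off the diagonal, and k + k = k forces k = 0; hence the cocycle
  map factors through \<open>S\<close>. If it is on top, all differences g F - F lie in the copy of
  \<open>S\<close>. The indicator of the fixed partition, whose cocycle tells whether two points lie
  in different blocks, contradicts both.\<close>

declare One_nat_def [simp del]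

text \<open>These rules turn sums of bits into formulas and thereby block ring normalisation.\<close>
declare add_bit_eq_xor [simp del] mult_bit_eq_and [simp del]

section \<open>Quotients of group modules\<close>

text \<open>Every coset is written through a representative, so that the operations of the quotient
  can be computed on elements of the module.\<close>

definition add_coset :: "('a, 'b, 'g, 'm) gmodule_scheme \<Rightarrow> 'b set \<Rightarrow> 'b \<Rightarrow> 'b set" where
  "add_coset M U v = (\<lambda>u. u \<oplus>\<^bsub>M\<^esub> v) ` U"

context group_module
begin

lemma group_submodule_closed:
  assumes "group_submodule R G M U"
  shows "U \<subseteq> carrier M" "\<zero>\<^bsub>M\<^esub> \<in> U"
    "\<And>u v. u \<in> U \<Longrightarrow> v \<in> U \<Longrightarrow> u \<oplus>\<^bsub>M\<^esub> v \<in> U"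
    "\<And>u v. u \<in> U \<Longrightarrow> v \<in> U \<Longrightarrow> u \<ominus>\<^bsub>M\<^esub> v \<in> U"
    "\<And>a u. a \<in> carrier R \<Longrightarrow> u \<in> U \<Longrightarrow> a \<odot>\<^bsub>M\<^esub> u \<in> U"
    "\<And>g u. g \<in> carrier G \<Longrightarrow> u \<in> U \<Longrightarrow> gact M g u \<in> U"
proof -
  have sm: "submodule U R M"
    using assms by (simp add: group_submodule_def)
  show "U \<subseteq> carrier M" using submoduleE(1)[OF sm] .
  show "\<zero>\<^bsub>M\<^esub> \<in> U"
    using subgroup.one_closed[OF submodule.axioms(1)[OF sm]] by simp
  show "\<And>u v. u \<in> U \<Longrightarrow> v \<in> U \<Longrightarrow> u \<oplus>\<^bsub>M\<^esub> v \<in> U"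
    using submoduleE(5)[OF sm] .
  show "\<And>u v. u \<in> U \<Longrightarrow> v \<in> U \<Longrightarrow> u \<ominus>\<^bsub>M\<^esub> v \<in> U"
    using submoduleE(3,5)[OF sm] by (simp add: a_minus_def)
  show "\<And>a u. a \<in> carrier R \<Longrightarrow> u \<in> U \<Longrightarrow> a \<odot>\<^bsub>M\<^esub> u \<in> U"
    using submoduleE(4)[OF sm] .
  show "\<And>g u. g \<in> carrier G \<Longrightarrow> u \<in> U \<Longrightarrow> gact M g u \<in> U"
    using assms by (simp add: group_submodule_def)
qed

lemma add_coset_eq_iff:
  assumes U: "group_submodule R G M U" and "v \<in> carrier M" "w \<in> carrier M"
  shows "add_coset M U v = add_coset M U w \<longleftrightarrow> v \<ominus>\<^bsub>M\<^esub> w \<in> U"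
proof
  note c = group_submodule_closed[OF U]
  assume eq: "add_coset M U v = add_coset M U w"
  have "v \<in> add_coset M U v"
    unfolding add_coset_def using c(2) assms by (auto intro!: image_eqI[where x = "\<zero>\<^bsub>M\<^esub>"])
  then obtain u where "u \<in> U" "v = u \<oplus>\<^bsub>M\<^esub> w"
    unfolding eq by (auto simp: add_coset_def)
  moreover from this have "u \<in> carrier M" using c(1) by auto
  ultimately show "v \<ominus>\<^bsub>M\<^esub> w \<in> U"
    using assms by (simp add: a_minus_def M.a_assoc M.r_neg)
next
  note c = group_submodule_closed[OF U]
  assume d: "v \<ominus>\<^bsub>M\<^esub> w \<in> U"
  have "add_coset M U x \<subseteq> add_coset M U y"
    if "x \<ominus>\<^bsub>M\<^esub> y \<in> U" "x \<in> carrier M" "y \<in> carrier M" for x y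
  proof
    fix z assume "z \<in> add_coset M U x"
    then obtain u where u: "u \<in> U" "z = u \<oplus>\<^bsub>M\<^esub> x" by (auto simp: add_coset_def)
    then have "u \<in> carrier M" using c(1) by auto
    then have "z = (u \<oplus>\<^bsub>M\<^esub> (x \<ominus>\<^bsub>M\<^esub> y)) \<oplus>\<^bsub>M\<^esub> y"
      using that u by (simp add: a_minus_def M.a_assoc M.l_neg)
    then show "z \<in> add_coset M U y"
      using c(3)[OF u(1) that(1)] by (auto simp: add_coset_def)
  qed
  moreover have "w \<ominus>\<^bsub>M\<^esub> v \<in> U"
  proof -
    have "\<zero>\<^bsub>M\<^esub> \<ominus>\<^bsub>M\<^esub> (v \<ominus>\<^bsub>M\<^esub> w) \<in> U" using c(2,4) d by blast
    moreover have "\<zero>\<^bsub>M\<^esub> \<ominus>\<^bsub>M\<^esub> (v \<ominus>\<^bsub>M\<^esub> w) = w \<ominus>\<^bsub>M\<^esub> v"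
      using assms by (simp add: a_minus_def M.minus_add M.minus_minus M.a_comm)
    ultimately show ?thesis by simp
  qed
  ultimately show "add_coset M U v = add_coset M U w"
    using d assms by blast
qed

lemma
  assumes U: "group_submodule R G M U" and V: "group_submodule R G M V" and "U \<subseteq> V"
  defines "Q \<equiv> quotient_gmodule (M\<lparr>carrier := V\<rparr>) U"
  shows quotient_carrier: "carrier Q = add_coset M U ` V"
    and quotient_add: "\<And>v w. v \<in> V \<Longrightarrow> w \<in> V \<Longrightarrow>
      add_coset M U v \<oplus>\<^bsub>Q\<^esub> add_coset M U w = add_coset M U (v \<oplus>\<^bsub>M\<^esub> w)"
    and quotient_smult: "\<And>a v. a \<in> carrier R \<Longrightarrow> v \<in> V \<Longrightarrow>
      a \<odot>\<^bsub>Q\<^esub> add_coset M U v = add_coset M U (a \<odot>\<^bsub>M\<^esub> v)"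
    and quotient_gact: "\<And>g v. g \<in> carrier G \<Longrightarrow> v \<in> V \<Longrightarrow>
      gact Q g (add_coset M U v) = add_coset M U (gact M g v)"
proof -
  note c = group_submodule_closed[OF U]
  note d = group_submodule_closed[OF V]
  show "carrier Q = add_coset M U ` V"
    by (auto simp: Q_def quotient_gmodule_def A_RCOSETS_def RCOSETS_def r_coset_def add_coset_def)
  have car: "u \<in> carrier M" if "u \<in> U \<or> u \<in> V" for u using that c(1) d(1) by auto
  have pt: "u \<oplus>\<^bsub>M\<^esub> w \<in> add_coset M U w" if "u \<in> U" for u w
    using that by (auto simp: add_coset_def)
  fix v assume v: "v \<in> V"
  show "add_coset M U v \<oplus>\<^bsub>Q\<^esub> add_coset M U w = add_coset M U (v \<oplus>\<^bsub>M\<^esub> w)"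
    if w: "w \<in> V" for w
  proof -
    have "add_coset M U v \<oplus>\<^bsub>Q\<^esub> add_coset M U w =
        {(u \<oplus>\<^bsub>M\<^esub> v) \<oplus>\<^bsub>M\<^esub> (u' \<oplus>\<^bsub>M\<^esub> w) |u u'. u \<in> U \<and> u' \<in> U}"
      by (auto simp: Q_def quotient_gmodule_def set_add_def set_mult_def add_coset_def)
    also have "\<dots> = {(u \<oplus>\<^bsub>M\<^esub> u') \<oplus>\<^bsub>M\<^esub> (v \<oplus>\<^bsub>M\<^esub> w) |u u'. u \<in> U \<and> u' \<in> U}"
      using v w car by (metis (no_types, opaque_lifting) M.add.m_assoc M.add.m_lcomm M.add.m_closed)
    also have "\<dots> = add_coset M U (v \<oplus>\<^bsub>M\<^esub> w)"
    proof
      show "\<dots> \<subseteq> add_coset M U (v \<oplus>\<^bsub>M\<^esub> w)" using c(3) pt by blast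
      show "add_coset M U (v \<oplus>\<^bsub>M\<^esub> w) \<subseteq>
          {(u \<oplus>\<^bsub>M\<^esub> u') \<oplus>\<^bsub>M\<^esub> (v \<oplus>\<^bsub>M\<^esub> w) |u u'. u \<in> U \<and> u' \<in> U}"
      proof
        fix z assume "z \<in> add_coset M U (v \<oplus>\<^bsub>M\<^esub> w)"
        then obtain u where "u \<in> U" "z = u \<oplus>\<^bsub>M\<^esub> (v \<oplus>\<^bsub>M\<^esub> w)" by (auto simp: add_coset_def)
        then have "z = (u \<oplus>\<^bsub>M\<^esub> \<zero>\<^bsub>M\<^esub>) \<oplus>\<^bsub>M\<^esub> (v \<oplus>\<^bsub>M\<^esub> w)" using car by simp
        then show "z \<in> {(u \<oplus>\<^bsub>M\<^esub> u') \<oplus>\<^bsub>M\<^esub> (v \<oplus>\<^bsub>M\<^esub> w) |u u'. u \<in> U \<and> u' \<in> U}"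
          using \<open>u \<in> U\<close> c(2) by blast
      qed
    qed
    finally show ?thesis .
  qed
  \<comment> \<open>Scalar multiplication and the group action are treated together. The image of a
    coset under an additive map that preserves \<open>U\<close> lies in one coset but need not fill
    it, as multiplication by 0 shows; adding \<open>U\<close> fills it.\<close>
  have absorb: "set_add M U (f ` add_coset M U v) = add_coset M U (f v)"
    if hom: "\<And>x y. x \<in> V \<Longrightarrow> y \<in> V \<Longrightarrow> f (x \<oplus>\<^bsub>M\<^esub> y) = f x \<oplus>\<^bsub>M\<^esub> f y"
      and fU: "\<And>x. x \<in> U \<Longrightarrow> f x \<in> U" and fV: "f v \<in> V" for f
  proof -
    have "set_add M U (f ` add_coset M U v) =
        {u \<oplus>\<^bsub>M\<^esub> (f u' \<oplus>\<^bsub>M\<^esub> f v) |u u'. u \<in> U \<and> u' \<in> U}"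
      using v hom \<open>U \<subseteq> V\<close>
      by (auto simp: set_add_def set_mult_def add_coset_def) (metis hom subsetD)+
    also have "\<dots> = {(u \<oplus>\<^bsub>M\<^esub> f u') \<oplus>\<^bsub>M\<^esub> f v |u u'. u \<in> U \<and> u' \<in> U}"
      using car fU fV by (metis (no_types, opaque_lifting) M.add.m_assoc)
    also have "\<dots> = add_coset M U (f v)"
    proof
      show "\<dots> \<subseteq> add_coset M U (f v)" using c(3) fU pt by blast
      show "add_coset M U (f v) \<subseteq> {(u \<oplus>\<^bsub>M\<^esub> f u') \<oplus>\<^bsub>M\<^esub> f v |u u'. u \<in> U \<and> u' \<in> U}"
      proof
        fix z assume "z \<in> add_coset M U (f v)"
        then obtain u where u: "u \<in> U" "z = u \<oplus>\<^bsub>M\<^esub> f v" by (auto simp: add_coset_def)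
        \<comment> \<open>At this point \<open>f\<close> of zero is only known to lie in
          \<open>U\<close>, so it is subtracted from \<open>u\<close> first.\<close>
        let ?z = "\<zero>\<^bsub>M\<^esub>"
        have "u = (u \<ominus>\<^bsub>M\<^esub> f ?z) \<oplus>\<^bsub>M\<^esub> f ?z"
          using u car fU c(2) by (simp add: a_minus_def M.a_assoc M.l_neg)
        then have "z = ((u \<ominus>\<^bsub>M\<^esub> f ?z) \<oplus>\<^bsub>M\<^esub> f ?z) \<oplus>\<^bsub>M\<^esub> f v" using u(2) by metis
        then show "z \<in> {(u \<oplus>\<^bsub>M\<^esub> f u') \<oplus>\<^bsub>M\<^esub> f v |u u'. u \<in> U \<and> u' \<in> U}"
          using c(2) c(4)[OF u(1) fU[OF c(2)]] by blast
      qed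
    qed
    finally show ?thesis .
  qed
  show "a \<odot>\<^bsub>Q\<^esub> add_coset M U v = add_coset M U (a \<odot>\<^bsub>M\<^esub> v)" if "a \<in> carrier R" for a
    using absorb[of "\<lambda>v. a \<odot>\<^bsub>M\<^esub> v"] that v c(5) d(5) car
    by (simp add: Q_def quotient_gmodule_def smult_r_distr set_add_def set_mult_def)
  show "gact Q g (add_coset M U v) = add_coset M U (gact M g v)" if "g \<in> carrier G" for g
    using absorb[of "gact M g"] that v c(6) d(6) car
    by (simp add: Q_def quotient_gmodule_def gact_add set_add_def set_mult_def)
qed

text \<open>The first isomorphism theorem, in the form in which a map is given on elements of
  \<open>V\<close> and never on cosets.\<close>

lemma quotient_isomorphicI:
  assumes U: "group_submodule R G M U" and V: "group_submodule R G M V" and UV: "U \<subseteq> V"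
    and N: "abelian_group N"
    and add: "\<And>v w. v \<in> V \<Longrightarrow> w \<in> V \<Longrightarrow> \<theta> (v \<oplus>\<^bsub>M\<^esub> w) = \<theta> v \<oplus>\<^bsub>N\<^esub> \<theta> w"
    and smult: "\<And>a v. a \<in> carrier R \<Longrightarrow> v \<in> V \<Longrightarrow> \<theta> (a \<odot>\<^bsub>M\<^esub> v) = a \<odot>\<^bsub>N\<^esub> \<theta> v"
    and gact: "\<And>g v. g \<in> carrier G \<Longrightarrow> v \<in> V \<Longrightarrow> \<theta> (gact M g v) = gact N g (\<theta> v)"
    and onto: "\<theta> ` V = carrier N"
    and ker: "\<And>v. v \<in> V \<Longrightarrow> \<theta> v = \<zero>\<^bsub>N\<^esub> \<longleftrightarrow> v \<in> U"
  shows "gmodule_isomorphic R G (quotient_gmodule (M\<lparr>carrier := V\<rparr>) U) N"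
proof -
  interpret N: abelian_group N by fact
  note d = group_submodule_closed[OF V]
  define Q where "Q = quotient_gmodule (M\<lparr>carrier := V\<rparr>) U"
  note q = quotient_carrier[OF U V UV] quotient_add[OF U V UV] quotient_smult[OF U V UV]
    quotient_gact[OF U V UV]
  have car: "v \<in> carrier M" "\<theta> v \<in> carrier N" if "v \<in> V" for v
    using that d(1) onto by auto
  have eq: "\<theta> v = \<theta> w \<longleftrightarrow> add_coset M U v = add_coset M U w" if "v \<in> V" "w \<in> V" for v w
  proof -
    have "v = (v \<ominus>\<^bsub>M\<^esub> w) \<oplus>\<^bsub>M\<^esub> w"
      using car that by (simp add: a_minus_def M.a_assoc M.l_neg)
    then have "\<theta> v = \<theta> (v \<ominus>\<^bsub>M\<^esub> w) \<oplus>\<^bsub>N\<^esub> \<theta> w"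
      using add d(4) that by metis
    then have "\<theta> v = \<theta> w \<longleftrightarrow> \<theta> (v \<ominus>\<^bsub>M\<^esub> w) = \<zero>\<^bsub>N\<^esub>"
      using car that d(4) by simp
    then show ?thesis
      using ker d(4) that add_coset_eq_iff[OF U] car by simp
  qed
  \<comment> \<open>By \<open>eq\<close>, all representatives of a coset have the same
    image.\<close>
  define \<phi> where "\<phi> C = \<theta> (SOME v. v \<in> V \<and> add_coset M U v = C)" for C
  have \<phi>: "\<phi> (add_coset M U v) = \<theta> v" if "v \<in> V" for v
  proof -
    have "\<exists>w. w \<in> V \<and> add_coset M U w = add_coset M U v" using that by blast
    from someI_ex[OF this] show ?thesis
      unfolding \<phi>_def using eq that by blast
  qed
  have "\<phi> \<in> iso (add_monoid Q) (add_monoid N)"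
  proof (rule isoI)
    show "\<phi> \<in> hom (add_monoid Q) (add_monoid N)"
      by (rule homI) (auto simp: Q_def q \<phi> car add d(3))
    show "bij_betw \<phi> (carrier (add_monoid Q)) (carrier (add_monoid N))"
      using onto by (auto simp: bij_betw_def inj_on_def Q_def q \<phi> eq image_image)
  qed
  then show ?thesis
    unfolding gmodule_isomorphic_def Q_def[symmetric]
    by (intro bexI[of _ \<phi>]) (auto simp: Q_def q \<phi> smult gact d)
qed

text \<open>The isomorphism is composed with the projection, so that later arguments work with
  elements of \<open>V\<close>. The kernel is given by differences because the later arguments
  compare two preimages of the same element.\<close>

lemma quotient_isomorphicE:
  assumes U: "group_submodule R G M U" and V: "group_submodule R G M V" and UV: "U \<subseteq> V"
    and N: "abelian_group N"
    and iso: "gmodule_isomorphic R G (quotient_gmodule (M\<lparr>carrier := V\<rparr>) U) N"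
  obtains \<theta> where
    "\<And>v w. v \<in> V \<Longrightarrow> w \<in> V \<Longrightarrow> \<theta> (v \<oplus>\<^bsub>M\<^esub> w) = \<theta> v \<oplus>\<^bsub>N\<^esub> \<theta> w"
    "\<And>a v. a \<in> carrier R \<Longrightarrow> v \<in> V \<Longrightarrow> \<theta> (a \<odot>\<^bsub>M\<^esub> v) = a \<odot>\<^bsub>N\<^esub> \<theta> v"
    "\<And>g v. g \<in> carrier G \<Longrightarrow> v \<in> V \<Longrightarrow> \<theta> (gact M g v) = gact N g (\<theta> v)"
    "\<theta> ` V = carrier N"
    "\<And>v w. v \<in> V \<Longrightarrow> w \<in> V \<Longrightarrow> \<theta> v = \<theta> w \<longleftrightarrow> v \<ominus>\<^bsub>M\<^esub> w \<in> U"
proof -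
  note d = group_submodule_closed[OF V]
  define Q where "Q = quotient_gmodule (M\<lparr>carrier := V\<rparr>) U"
  note q = quotient_carrier[OF U V UV] quotient_add[OF U V UV] quotient_smult[OF U V UV]
    quotient_gact[OF U V UV]
  from iso obtain \<phi> where \<phi>: "\<phi> \<in> iso (add_monoid Q) (add_monoid N)"
    and sm: "\<And>a v. a \<in> carrier R \<Longrightarrow> v \<in> carrier Q \<Longrightarrow> \<phi> (a \<odot>\<^bsub>Q\<^esub> v) = a \<odot>\<^bsub>N\<^esub> \<phi> v"
    and ga: "\<And>g v. g \<in> carrier G \<Longrightarrow> v \<in> carrier Q \<Longrightarrow> \<phi> (gact Q g v) = gact N g (\<phi> v)"
    unfolding gmodule_isomorphic_def Q_def by blast
  from \<phi> have hom: "\<And>x y. x \<in> carrier Q \<Longrightarrow> y \<in> carrier Q \<Longrightarrow> \<phi> (x \<oplus>\<^bsub>Q\<^esub> y) = \<phi> x \<oplus>\<^bsub>N\<^esub> \<phi> y"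
    and inj: "inj_on \<phi> (carrier Q)" and im: "\<phi> ` carrier Q = carrier N"
    by (auto simp: iso_def hom_def bij_betw_def)
  have mem: "add_coset M U v \<in> carrier Q" if "v \<in> V" for v
    using that by (simp add: Q_def q)
  show thesis
  proof (rule that[of "\<lambda>v. \<phi> (add_coset M U v)"])
    show "(\<lambda>v. \<phi> (add_coset M U v)) ` V = carrier N"
      using im by (simp add: Q_def q image_image)
    fix v assume v: "v \<in> V"
    show "\<phi> (add_coset M U (v \<oplus>\<^bsub>M\<^esub> w)) = \<phi> (add_coset M U v) \<oplus>\<^bsub>N\<^esub> \<phi> (add_coset M U w)"
      if "w \<in> V" for w
      using hom[OF mem[OF v] mem[OF that]] v that by (simp add: Q_def q)
    show "\<phi> (add_coset M U v) = \<phi> (add_coset M U w) \<longleftrightarrow> v \<ominus>\<^bsub>M\<^esub> w \<in> U" if "w \<in> V" for w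
      using add_coset_eq_iff[OF U, of v w] inj_on_eq_iff[OF inj mem[OF v] mem[OF that]] v that d(1)
      by auto
    show "\<phi> (add_coset M U (a \<odot>\<^bsub>M\<^esub> v)) = a \<odot>\<^bsub>N\<^esub> \<phi> (add_coset M U v)" if "a \<in> carrier R" for a
      using sm[OF that mem[OF v]] v that by (simp add: Q_def q)
    show "\<phi> (add_coset M U (gact M g v)) = gact N g (\<phi> (add_coset M U v))" if "g \<in> carrier G" for g
      using ga[OF that mem[OF v]] v that by (simp add: Q_def q)
  qed
qed

end

section \<open>Permutation modules over fields given as types\<close>

lemma type_ring_simps [simp]:
  "carrier (ring_of_type_algebra :: 'a::field ring) = UNIV"
  "\<zero>\<^bsub>ring_of_type_algebra :: 'a ring\<^esub> = 0"
  "\<one>\<^bsub>ring_of_type_algebra :: 'a ring\<^esub> = 1"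
  "x \<oplus>\<^bsub>ring_of_type_algebra :: 'a ring\<^esub> y = x + y"
  "x \<otimes>\<^bsub>ring_of_type_algebra :: 'a ring\<^esub> y = x * y"
  by (simp_all add: ring_of_type_algebra_def)

lemma cring_type_ring: "cring (ring_of_type_algebra :: 'a::field ring)"
  by (rule cring_from_type_algebra)

lemma type_ring_minus [simp]: "\<ominus>\<^bsub>ring_of_type_algebra :: 'a::field ring\<^esub> x = - x"
proof -
  interpret cring "ring_of_type_algebra :: 'a::field ring" by (rule cring_type_ring)
  show ?thesis by (rule minus_equality) auto
qed

lemma finsum_type_ring:
  "finite A \<Longrightarrow> (\<Oplus>\<^bsub>ring_of_type_algebra :: 'a::field ring\<^esub>i\<in>A. f i) = (\<Sum>i\<in>A. f i)"
proof (induction rule: finite_induct)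
  interpret cring "ring_of_type_algebra :: 'a::field ring" by (rule cring_type_ring)
  case (insert x F)
  then show ?case by simp
next
  interpret cring "ring_of_type_algebra :: 'a::field ring" by (rule cring_type_ring)
  case empty
  then show ?case by simp
qed

text \<open>Negation is multiplication by the scalar -1, so its closure property follows from the
  one for scalars.\<close>

lemma (in module) submoduleI':
  assumes "H \<subseteq> carrier M" "\<zero>\<^bsub>M\<^esub> \<in> H" "\<And>v w. v \<in> H \<Longrightarrow> w \<in> H \<Longrightarrow> v \<oplus>\<^bsub>M\<^esub> w \<in> H"
    "\<And>a v. a \<in> carrier R \<Longrightarrow> v \<in> H \<Longrightarrow> a \<odot>\<^bsub>M\<^esub> v \<in> H"
  shows "submodule H R M"
proof (rule submoduleI)
  fix v assume v: "v \<in> H"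
  then have "\<ominus>\<^bsub>M\<^esub> v = (\<ominus> \<one>) \<odot>\<^bsub>M\<^esub> v"
    using assms(1) smult_l_minus[of \<one> v] by auto
  then show "\<ominus>\<^bsub>M\<^esub> v \<in> H" using assms(4) v by simp
qed (use assms in auto)

lemma (in module) submodule_Inter:
  assumes "\<And>U. U \<in> \<U> \<Longrightarrow> submodule U R M" and "\<U> \<noteq> {}"
  shows "submodule (\<Inter>\<U>) R M"
proof (rule submoduleI')
  have U: "U \<subseteq> carrier M" "\<zero>\<^bsub>M\<^esub> \<in> U" if "U \<in> \<U>" for U
    using submoduleE(1)[OF assms(1)[OF that]]
      subgroup.one_closed[OF submodule.axioms(1)[OF assms(1)[OF that]]] by auto
  show "\<Inter>\<U> \<subseteq> carrier M" using U assms(2) by auto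
  show "\<zero>\<^bsub>M\<^esub> \<in> \<Inter>\<U>" using U by auto
qed (use submoduleE(4,5) assms(1) in blast)+

lemma (in group_module) group_submodule_group_module:
  assumes "group_submodule R G M U"
  shows "group_module R G (M\<lparr>carrier := U\<rparr>)"
proof -
  note c = group_submodule_closed[OF assms]
  have "module R (M\<lparr>carrier := U\<rparr>)"
    using submodule.submodule_is_module[OF _ module_axioms] assms
    by (simp add: group_submodule_def)
  then show ?thesis
    unfolding group_module_def group_module_axioms_def
    using c group_axioms by (auto simp: gact_add gact_smult gact_one gact_mult subset_iff)
qed

lemma permutation_gmodule_simps [simp]:
  "carrier (permutation_gmodule R G \<Omega> \<alpha>) = \<Omega> \<rightarrow>\<^sub>E carrier R"
  "\<zero>\<^bsub>permutation_gmodule R G \<Omega> \<alpha>\<^esub> = (\<lambda>x\<in>\<Omega>. \<zero>\<^bsub>R\<^esub>)"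
  "f \<oplus>\<^bsub>permutation_gmodule R G \<Omega> \<alpha>\<^esub> f' = (\<lambda>x\<in>\<Omega>. f x \<oplus>\<^bsub>R\<^esub> f' x)"
  "a \<odot>\<^bsub>permutation_gmodule R G \<Omega> \<alpha>\<^esub> f = (\<lambda>x\<in>\<Omega>. a \<otimes>\<^bsub>R\<^esub> f x)"
  "gact (permutation_gmodule R G \<Omega> \<alpha>) g f = (\<lambda>x\<in>\<Omega>. f (\<alpha> (inv\<^bsub>G\<^esub> g) x))"
  by (simp_all add: permutation_gmodule_def)

lemma module_permutation_gmodule:
  "module (ring_of_type_algebra :: 'a::field ring)
     (permutation_gmodule (ring_of_type_algebra :: 'a ring) G \<Omega> \<alpha>)" (is "module ?R ?M")
proof (rule moduleI)
  show "abelian_group ?M"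
  proof (rule abelian_groupI)
    fix f assume "f \<in> carrier ?M"
    then show "\<exists>h\<in>carrier ?M. h \<oplus>\<^bsub>?M\<^esub> f = \<zero>\<^bsub>?M\<^esub>"
      by (intro bexI[of _ "\<lambda>x\<in>\<Omega>. - f x"]) (auto intro!: restrict_ext)
    show "\<zero>\<^bsub>?M\<^esub> \<oplus>\<^bsub>?M\<^esub> f = f"
      using \<open>f \<in> carrier ?M\<close> by (auto intro!: extensionalityI[of _ \<Omega>] simp: PiE_def)
  qed (auto intro!: restrict_ext simp: algebra_simps)
  fix f assume "f \<in> carrier ?M"
  then show "\<one>\<^bsub>?R\<^esub> \<odot>\<^bsub>?M\<^esub> f = f"
    by (auto intro!: extensionalityI[of _ \<Omega>] simp: PiE_def)
qed (auto intro!: restrict_ext cring_type_ring simp: algebra_simps)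

lemma group_module_permutation_gmodule:
  assumes "group G"
    and "\<And>g x. g \<in> carrier G \<Longrightarrow> x \<in> \<Omega> \<Longrightarrow> \<alpha> g x \<in> \<Omega>"
    and "\<And>x. x \<in> \<Omega> \<Longrightarrow> \<alpha> \<one>\<^bsub>G\<^esub> x = x"
    and "\<And>g h x. g \<in> carrier G \<Longrightarrow> h \<in> carrier G \<Longrightarrow> x \<in> \<Omega> \<Longrightarrow>
      \<alpha> (g \<otimes>\<^bsub>G\<^esub> h) x = \<alpha> g (\<alpha> h x)"
  shows "group_module (ring_of_type_algebra :: 'a::field ring) G
    (permutation_gmodule (ring_of_type_algebra :: 'a ring) G \<Omega> \<alpha>)" (is "group_module ?R G ?M")
proof -
  interpret group G by fact
  interpret module ?R ?M by (rule module_permutation_gmodule)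
  show ?thesis
  proof
    fix f assume "f \<in> carrier ?M"
    then show "gact ?M \<one>\<^bsub>G\<^esub> f = f"
      using assms by (auto intro!: extensionalityI[of _ \<Omega>] simp: PiE_def)
  qed (use assms in \<open>auto intro!: restrict_ext simp: inv_mult_group\<close>)
qed

text \<open>The sums in \<open>is_basis\<close> and \<open>character\<close> are taken in a record
  whose carrier is the submodule. Taking \<open>U\<close> to be the whole carrier also evaluates the
  sum that defines a polytabloid.\<close>

lemma finsum_permutation_gmodule:
  fixes f :: "'i \<Rightarrow> 'x \<Rightarrow> 'a::field"
  assumes "submodule U ring_of_type_algebra (permutation_gmodule ring_of_type_algebra G \<Omega> \<alpha>)"
    and "finite A" and "f \<in> A \<rightarrow> U"
  shows "(\<Oplus>\<^bsub>(permutation_gmodule ring_of_type_algebra G \<Omega> \<alpha>)\<lparr>carrier := U\<rparr>\<^esub>i\<in>A. f i) =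
    (\<lambda>x\<in>\<Omega>. \<Sum>i\<in>A. f i x)"
proof -
  let ?M = "permutation_gmodule (ring_of_type_algebra :: 'a ring) G \<Omega> \<alpha>"
  interpret U: module ring_of_type_algebra "?M\<lparr>carrier := U\<rparr>"
    using submodule.submodule_is_module[OF assms(1) module_permutation_gmodule] .
  show ?thesis
    using assms(2,3)
  proof (induction rule: finite_induct)
    case (insert i F)
    then have "(\<Oplus>\<^bsub>?M\<lparr>carrier := U\<rparr>\<^esub>j\<in>insert i F. f j) = f i \<oplus>\<^bsub>?M\<^esub> (\<Oplus>\<^bsub>?M\<lparr>carrier := U\<rparr>\<^esub>j\<in>F. f j)"
      by (subst U.finsum_insert) auto
    with insert show ?case by (auto intro!: restrict_ext)
  qed auto
qed

lemma submodule_sum: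
  fixes f :: "'i \<Rightarrow> 'x \<Rightarrow> 'a::field"
  assumes U: "submodule U ring_of_type_algebra (permutation_gmodule ring_of_type_algebra G \<Omega> \<alpha>)"
    and "finite A" and "\<And>i. i \<in> A \<Longrightarrow> f i \<in> U"
  shows "(\<lambda>x\<in>\<Omega>. \<Sum>i\<in>A. c i * f i x) \<in> U"
proof -
  let ?M = "permutation_gmodule (ring_of_type_algebra :: 'a ring) G \<Omega> \<alpha>"
  interpret M: module ring_of_type_algebra ?M by (rule module_permutation_gmodule)
  interpret U: module ring_of_type_algebra "?M\<lparr>carrier := U\<rparr>"
    using submodule.submodule_is_module[OF assms(1) module_permutation_gmodule] .
  have cf: "c i \<odot>\<^bsub>?M\<^esub> f i \<in> U" if "i \<in> A" for i
    using M.submoduleE(4)[OF U] that assms(3) by simp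
  have "(\<Oplus>\<^bsub>?M\<lparr>carrier := U\<rparr>\<^esub>i\<in>A. c i \<odot>\<^bsub>?M\<^esub> f i) \<in> U"
    using U.finsum_closed[of "\<lambda>i. c i \<odot>\<^bsub>?M\<^esub> f i" A] cf by auto
  then show ?thesis
    using finsum_permutation_gmodule[OF U assms(2), of "\<lambda>i. c i \<odot>\<^bsub>?M\<^esub> f i"] cf
    by (auto cong: restrict_cong simp: restrict_def)
qed

text \<open>With trivial coefficients equivariance becomes invariance under right multiplication by
  \<open>H\<close>. This places the induced module inside the regular permutation module, from which
  its structure is inherited.\<close>

lemma induced_trivial_eq:
  "induced_gmodule G H (trivial_gmodule R) =
    (permutation_gmodule R G (carrier G) (\<otimes>\<^bsub>G\<^esub>))
      \<lparr>carrier := {f \<in> carrier G \<rightarrow>\<^sub>E carrier R. \<forall>x\<in>carrier G. \<forall>h\<in>H. f (x \<otimes>\<^bsub>G\<^esub> h) = f x}\<rparr>"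
  by (simp add: induced_gmodule_def trivial_gmodule_def permutation_gmodule_def)

lemma group_submodule_induced:
  assumes "group G" and "H \<subseteq> carrier G"
  shows "group_submodule (ring_of_type_algebra :: 'a::field ring) G
    (permutation_gmodule ring_of_type_algebra G (carrier G) (\<otimes>\<^bsub>G\<^esub>))
    {f \<in> carrier G \<rightarrow>\<^sub>E carrier ring_of_type_algebra. \<forall>x\<in>carrier G. \<forall>h\<in>H. f (x \<otimes>\<^bsub>G\<^esub> h) = f x}"
    (is "group_submodule ?R G ?M ?U")
proof -
  interpret G: group G by fact
  interpret M: module ?R ?M by (rule module_permutation_gmodule)
  have "submodule ?U ?R ?M"
    using assms(2) by (intro M.submoduleI') auto
  moreover have "gact ?M g u \<in> ?U" if g: "g \<in> carrier G" and u: "u \<in> ?U" for g u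
  proof -
    have "inv\<^bsub>G\<^esub> g \<otimes>\<^bsub>G\<^esub> (x \<otimes>\<^bsub>G\<^esub> h) = (inv\<^bsub>G\<^esub> g \<otimes>\<^bsub>G\<^esub> x) \<otimes>\<^bsub>G\<^esub> h" if "x \<in> carrier G" "h \<in> H" for x h
      using G.m_assoc[of "inv\<^bsub>G\<^esub> g" x h] that g assms(2) by (simp add: subset_iff)
    then show ?thesis using g u assms(2) by auto
  qed
  ultimately show ?thesis by (simp add: group_submodule_def)
qed

lemma group_module_induced:
  assumes "group G" and "H \<subseteq> carrier G"
  shows "group_module (ring_of_type_algebra :: 'a::field ring) G
    (induced_gmodule G H (trivial_gmodule ring_of_type_algebra))"
proof -
  interpret group G by fact
  interpret group_module "ring_of_type_algebra :: 'a ring" G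
    "permutation_gmodule (ring_of_type_algebra :: 'a ring) G (carrier G) (\<otimes>\<^bsub>G\<^esub>)"
    by (rule group_module_permutation_gmodule) (auto simp: m_assoc \<open>group G\<close>)
  show ?thesis
    unfolding induced_trivial_eq
    by (rule group_submodule_group_module[OF group_submodule_induced[OF assms]])
qed


section \<open>Tabloids and polytabloids\<close>

definition row_set :: "nat list \<Rightarrow> (nat \<times> nat \<Rightarrow> nat) \<Rightarrow> nat \<Rightarrow> nat set" where
  "row_set l t i = {t (i, j) |j. (i, j) \<in> young_diagram l}"

definition column_set :: "nat list \<Rightarrow> (nat \<times> nat \<Rightarrow> nat) \<Rightarrow> nat \<Rightarrow> nat set" where
  "column_set l t j = {t (i, j) |i. (i, j) \<in> young_diagram l}"

lemma young_diagram_eq_Sigma: "young_diagram l = (SIGMA i:{..<length l}. {..<l ! i})"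
  by (auto simp: young_diagram_def)

lemma finite_young_diagram: "finite (young_diagram l)"
  by (simp add: young_diagram_eq_Sigma)

lemma card_young_diagram: "card (young_diagram l) = sum_list l"
  by (simp add: young_diagram_eq_Sigma sum_list_sum_nth atLeast0LessThan)

text \<open>The diagram has as many cells as there are entries, so a surjective filling is
  injective.\<close>

lemma tableauI:
  assumes "t \<in> extensional (young_diagram l)" and "t ` young_diagram l = {1..sum_list l}"
  shows "t \<in> tableaux l"
  using assms eq_card_imp_inj_on[OF finite_young_diagram, of t l]
  by (simp add: tableaux_def bij_betw_def card_young_diagram)

lemma tableau_inj:
  "t \<in> tableaux l \<Longrightarrow> p \<in> young_diagram l \<Longrightarrow> q \<in> young_diagram l \<Longrightarrow> t p = t q \<longleftrightarrow> p = q"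
  by (auto simp: tableaux_def bij_betw_def inj_on_def)

lemma tableau_image: "t \<in> tableaux l \<Longrightarrow> t ` young_diagram l = {1..sum_list l}"
  by (auto simp: tableaux_def bij_betw_def)

lemma tableau_act_tableau:
  assumes "t \<in> tableaux l" and "\<sigma> permutes {1..sum_list l}"
  shows "tableau_act l \<sigma> t \<in> tableaux l"
  using assms permutes_image[OF assms(2)] tableau_image[OF assms(1)]
  by (intro tableauI) (auto simp: compose_def image_image[symmetric] simp flip: image_comp)

lemma row_set_act:
  "row_set l (tableau_act l \<sigma> t) i = \<sigma> ` row_set l t i"
  "column_set l (tableau_act l \<sigma> t) j = \<sigma> ` column_set l t j"
  by (auto simp: row_set_def column_set_def compose_def)

lemma tableau_act_comp:
  "t \<in> tableaux l \<Longrightarrow> tableau_act l \<sigma> (tableau_act l \<tau> t) = tableau_act l (\<sigma> \<circ> \<tau>) t"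
  "t \<in> tableaux l \<Longrightarrow> tableau_act l id t = t"
  by (auto simp: compose_def tableaux_def restrict_def extensional_def fun_eq_iff)

lemma tableau_transitive:
  assumes t: "t \<in> tableaux l" and u: "u \<in> tableaux l"
  obtains \<sigma> where "\<sigma> permutes {1..sum_list l}" "u = tableau_act l \<sigma> t"
proof -
  let ?D = "young_diagram l" and ?N = "{1..sum_list l}"
  \<comment> \<open>This is \<open>u\<close> after the inverse of \<open>t\<close>, continued by the
    identity outside the entries.\<close>
  define \<sigma> where "\<sigma> x = (if x \<in> ?N then u (inv_into ?D t x) else x)" for x
  have bt: "bij_betw t ?D ?N" and bu: "bij_betw u ?D ?N"
    using t u by (auto simp: tableaux_def)
  have "bij_betw (u \<circ> inv_into ?D t) ?N ?N"
    using bij_betw_trans[OF bij_betw_inv_into[OF bt] bu] .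
  moreover have "bij_betw \<sigma> ?N ?N = bij_betw (u \<circ> inv_into ?D t) ?N ?N"
    by (rule bij_betw_cong) (simp add: \<sigma>_def)
  ultimately have "bij_betw \<sigma> ?N ?N" by blast
  then have "\<sigma> permutes ?N"
    by (rule bij_imp_permutes) (simp add: \<sigma>_def del: atLeastAtMost_iff)
  moreover have "u = tableau_act l \<sigma> t"
  proof
    fix p
    show "u p = tableau_act l \<sigma> t p"
      using u bt bij_betwE[OF bt]
      by (cases p; cases "p \<in> ?D")
        (auto simp: compose_def \<sigma>_def tableaux_def extensional_def bij_betw_inv_into_left[OF bt])
  qed
  ultimately show thesis using that by blast
qed

text \<open>Some permutation carries \<open>t\<close> to any other tableau \<open>u\<close>, and it
  stabilizes the rows of \<open>t\<close> exactly when both have the same row sets.\<close>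

lemma tabloid_eq:
  assumes t: "t \<in> tableaux l"
  shows "tabloid l t = {u \<in> tableaux l. \<forall>i. row_set l u i = row_set l t i}"
proof (intro equalityI subsetI)
  fix u assume "u \<in> tabloid l t"
  then obtain \<sigma> where "\<sigma> permutes {1..sum_list l}" "u = tableau_act l \<sigma> t"
    "\<forall>i. \<sigma> ` row_set l t i = row_set l t i"
    unfolding tabloid_def row_stabilizer_def sym_group_carrier row_set_def by blast
  then show "u \<in> {u \<in> tableaux l. \<forall>i. row_set l u i = row_set l t i}"
    using t by (simp add: tableau_act_tableau row_set_act)
next
  fix u assume u: "u \<in> {u \<in> tableaux l. \<forall>i. row_set l u i = row_set l t i}"
  then obtain \<sigma> where "\<sigma> permutes {1..sum_list l}" "u = tableau_act l \<sigma> t"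
    using tableau_transitive[OF t] by blast
  then show "u \<in> tabloid l t"
    using u unfolding tabloid_def row_stabilizer_def sym_group_carrier
    by (auto simp: row_set_act simp flip: row_set_def)
qed

lemma tabloid_eq_iff:
  "t \<in> tableaux l \<Longrightarrow> u \<in> tableaux l \<Longrightarrow>
    tabloid l t = tabloid l u \<longleftrightarrow> (\<forall>i. row_set l t i = row_set l u i)"
  by (auto simp: tabloid_eq)

text \<open>All tableaux of a tabloid share their row sets, so any of them may be chosen. This turns
  functions of a row into functions on tabloids.\<close>

definition tabloid_row :: "nat list \<Rightarrow> (nat \<times> nat \<Rightarrow> nat) set \<Rightarrow> nat \<Rightarrow> nat set" where
  "tabloid_row l T i = row_set l (SOME t. t \<in> T) i"

lemma tabloid_row_tabloid:
  assumes "t \<in> tableaux l"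
  shows "tabloid_row l (tabloid l t) i = row_set l t i"
proof -
  have "t \<in> tabloid l t" using assms by (simp add: tabloid_eq)
  then have "(SOME u. u \<in> tabloid l t) \<in> tabloid l t" by (rule someI[of "\<lambda>u. u \<in> tabloid l t"])
  then show ?thesis using assms by (simp add: tabloid_row_def tabloid_eq)
qed

lemma tabloid_act:
  assumes t: "t \<in> tableaux l" and \<sigma>: "\<sigma> permutes {1..sum_list l}"
  shows "tableau_act l \<sigma> ` tabloid l t = tabloid l (tableau_act l \<sigma> t)"
proof (intro equalityI subsetI)
  note \<sigma>' = permutes_inv[OF \<sigma>]
  fix u assume u: "u \<in> tabloid l (tableau_act l \<sigma> t)"
  then have ut: "u \<in> tableaux l"
    using t \<sigma> by (simp add: tabloid_eq tableau_act_tableau)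
  have "u = tableau_act l \<sigma> (tableau_act l (inv' \<sigma>) u)"
    using ut by (simp add: tableau_act_comp permutes_inv_o[OF \<sigma>])
  moreover have "tableau_act l (inv' \<sigma>) u \<in> tabloid l t"
    using u t \<sigma> ut \<sigma>' permutes_inv_o(2)[OF \<sigma>]
    by (simp add: tabloid_eq tableau_act_tableau row_set_act image_comp)
  ultimately show "u \<in> tableau_act l \<sigma> ` tabloid l t" by blast
qed (use t \<sigma> in \<open>auto simp: tabloid_eq tableau_act_tableau row_set_act\<close>)

lemma tabloidsE:
  assumes "T \<in> tabloids l"
  obtains t where "t \<in> tableaux l" "T = tabloid l t"
  using assms by (auto simp: tabloids_def)

lemma module_tabloid_gmodule:
  "module (ring_of_type_algebra :: 'a::field ring) (tabloid_gmodule ring_of_type_algebra l)"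
  unfolding tabloid_gmodule_def by (rule module_permutation_gmodule)

lemma tabloid_gmodule_simps [simp]:
  "carrier (tabloid_gmodule R l) = tabloids l \<rightarrow>\<^sub>E carrier R"
  "\<zero>\<^bsub>tabloid_gmodule R l\<^esub> = (\<lambda>x\<in>tabloids l. \<zero>\<^bsub>R\<^esub>)"
  "f \<oplus>\<^bsub>tabloid_gmodule R l\<^esub> f' = (\<lambda>x\<in>tabloids l. f x \<oplus>\<^bsub>R\<^esub> f' x)"
  "a \<odot>\<^bsub>tabloid_gmodule R l\<^esub> f = (\<lambda>x\<in>tabloids l. a \<otimes>\<^bsub>R\<^esub> f x)"
  by (simp_all add: tabloid_gmodule_def)

lemma tabloid_gmodule_gact:
  assumes "\<sigma> permutes {1..sum_list l}" and "t \<in> tableaux l"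
  shows "gact (tabloid_gmodule R l) \<sigma> f (tabloid l t) = f (tabloid l (tableau_act l (inv' \<sigma>) t))"
  using assms by (simp add: tabloid_gmodule_def tabloids_def tabloid_act permutes_inv sym_group_carrier)

lemma polytabloid_closed:
  "polytabloid (ring_of_type_algebra :: 'a::field ring) l t
    \<in> carrier (tabloid_gmodule ring_of_type_algebra l)"
proof -
  interpret module "ring_of_type_algebra :: 'a ring" "tabloid_gmodule ring_of_type_algebra l"
    by (rule module_tabloid_gmodule)
  show ?thesis
    unfolding polytabloid_def
    by (intro M.finsum_closed) (auto simp: point_mass_def)
qed

lemma polytabloid_apply:
  fixes l t
  defines "S \<equiv> column_stabilizer l t"
  assumes t: "t \<in> tableaux l" and u: "u \<in> tableaux l"
  shows "polytabloid (ring_of_type_algebra :: 'a::field ring) l t (tabloid l u) =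
    (\<Sum>\<sigma> | \<sigma> \<in> column_stabilizer l t \<and> (\<forall>i. row_set l (tableau_act l \<sigma> t) i = row_set l u i).
      if evenperm \<sigma> then 1 else - 1)"
proof -
  let ?R = "ring_of_type_algebra :: 'a ring" and ?M = "tabloid_gmodule (ring_of_type_algebra :: 'a ring) l"
  let ?s = "\<lambda>\<sigma>. if evenperm \<sigma> then \<one>\<^bsub>?R\<^esub> else \<ominus>\<^bsub>?R\<^esub> \<one>\<^bsub>?R\<^esub>"
  interpret module ?R ?M
    by (rule module_tabloid_gmodule)
  have fin: "finite S"
    by (rule finite_subset[of _ "{\<sigma>. \<sigma> permutes {1..sum_list l}}"])
      (auto simp: S_def column_stabilizer_def sym_group_carrier finite_permutations)
  have act: "tableau_act l \<sigma> t \<in> tableaux l" if "\<sigma> \<in> S" for \<sigma>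
    using that t by (simp add: S_def column_stabilizer_def sym_group_carrier tableau_act_tableau)
  let ?f = "\<lambda>\<sigma>. ?s \<sigma> \<odot>\<^bsub>?M\<^esub> point_mass ?R (tabloids l) (tabloid l (tableau_act l \<sigma> t))"
  \<comment> \<open>The sum is brought into the shape with an updated carrier that
    \<open>finsum_permutation_gmodule\<close> expects.\<close>
  have eq: "?M = ?M\<lparr>carrier := carrier ?M\<rparr>" by simp
  have "polytabloid ?R l t = (\<Oplus>\<^bsub>?M\<lparr>carrier := carrier ?M\<rparr>\<^esub>\<sigma>\<in>S. ?f \<sigma>)"
    unfolding polytabloid_def S_def by (rule arg_cong[OF eq])
  also have "\<dots> = (\<lambda>T\<in>tabloids l. \<Sum>\<sigma>\<in>S. ?f \<sigma> T)"
    using carrier_is_submodule fin unfolding tabloid_gmodule_def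
    by (intro finsum_permutation_gmodule) (auto simp: point_mass_def)
  finally have "polytabloid ?R l t (tabloid l u) = (\<lambda>T\<in>tabloids l. \<Sum>\<sigma>\<in>S. ?f \<sigma> T) (tabloid l u)"
    by (rule fun_cong)
  also have "\<dots> = (\<Sum>\<sigma>\<in>S. if \<forall>i. row_set l (tableau_act l \<sigma> t) i = row_set l u i
      then ?s \<sigma> else 0)"
    using u by (auto simp: tabloids_def point_mass_def tabloid_eq_iff[symmetric] act intro!: sum.cong)
  also have "\<dots> = (\<Sum>\<sigma> | \<sigma> \<in> S \<and> (\<forall>i. row_set l (tableau_act l \<sigma> t) i = row_set l u i). ?s \<sigma>)"
    by (rule sum.inter_filter[OF fin, symmetric])
  finally show ?thesis by (simp add: S_def cong: if_cong)
qed

text \<open>Over \<open>F2\<close> signs disappear, and a tableau is determined by its row and column sets.\<close>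

lemma polytabloid_F2:
  assumes t: "t \<in> tableaux l" and u: "u \<in> tableaux l"
  shows "polytabloid F2 l t (tabloid l u) =
    of_bool (\<exists>v\<in>tableaux l. (\<forall>i. row_set l v i = row_set l u i) \<and> (\<forall>j. column_set l v j = column_set l t j))"
proof -
  let ?P = "\<lambda>v. (\<forall>i. row_set l v i = row_set l u i) \<and> (\<forall>j. column_set l v j = column_set l t j)"
  let ?S = "{\<sigma>. \<sigma> \<in> column_stabilizer l t \<and> (\<forall>i. row_set l (tableau_act l \<sigma> t) i = row_set l u i)}"
  have S: "\<sigma> \<in> ?S \<longleftrightarrow> \<sigma> permutes {1..sum_list l} \<and> ?P (tableau_act l \<sigma> t)" for \<sigma>
    by (auto simp: column_stabilizer_def sym_group_carrier row_set_act(2) simp flip: column_set_def)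
  \<comment> \<open>The entry of \<open>v\<close> in cell (i, j) lies in row i and in column j of
    \<open>w\<close>, and these meet in a single cell.\<close>
  have uniq: "v = w" if vw: "v \<in> tableaux l" "w \<in> tableaux l" and "?P v" "?P w" for v w
  proof (rule extensionalityI)
    show "v \<in> extensional (young_diagram l)" "w \<in> extensional (young_diagram l)"
      using vw by (auto simp: tableaux_def)
    fix p assume p: "p \<in> young_diagram l"
    obtain i j where ij: "p = (i, j)" by (cases p)
    have "v p \<in> row_set l w i" "v p \<in> column_set l w j"
      using that p unfolding ij row_set_def column_set_def by (metis (mono_tags, lifting) mem_Collect_eq)+
    then obtain i' j' where "v p = w (i, j')" "v p = w (i', j)" "(i, j') \<in> young_diagram l"
      "(i', j) \<in> young_diagram l"
      by (auto simp: row_set_def column_set_def)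
    then show "v p = w p"
      using tableau_inj[OF vw(2), of "(i, j')" "(i', j)"] by (auto simp: ij)
  qed
  have "(\<Sum>\<sigma>\<in>?S. if evenperm \<sigma> then 1 else - 1) = (\<Sum>\<sigma>\<in>?S. 1 :: bit)"
    by (intro sum.cong) auto
  also have "\<dots> = of_bool (\<exists>v\<in>tableaux l. ?P v)"
  proof (cases "\<exists>v\<in>tableaux l. ?P v")
    case True
    then obtain v where v: "v \<in> tableaux l" "?P v" by blast
    obtain \<sigma> where \<sigma>: "\<sigma> permutes {1..sum_list l}" "v = tableau_act l \<sigma> t"
      using tableau_transitive[OF t v(1)] by blast
    have "\<tau> = \<sigma>" if "\<tau> \<in> ?S" for \<tau>
    proof
      fix x
      have \<tau>: "\<tau> permutes {1..sum_list l}" "?P (tableau_act l \<tau> t)"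
        using that S by auto
      then have eq: "tableau_act l \<tau> t = tableau_act l \<sigma> t"
        using uniq[of "tableau_act l \<tau> t" v] v \<sigma>(2) tableau_act_tableau[OF t] by blast
      show "\<tau> x = \<sigma> x"
      proof (cases "x \<in> {1..sum_list l}")
        case True
        then obtain p where "p \<in> young_diagram l" "x = t p"
          using tableau_image[OF t] by (metis imageE)
        then show ?thesis using fun_cong[OF eq, of p] by (simp add: compose_def)
      qed (use \<tau>(1) \<sigma>(1) in \<open>auto simp: permutes_def\<close>)
    qed
    moreover have "\<sigma> \<in> ?S" using S \<sigma> v(2) by blast
    ultimately have "?S = {\<sigma>}" by blast
    then have "(\<Sum>\<sigma>\<in>?S. 1 :: bit) = 1" by (simp only:) simp
    then show ?thesis using True by simp
  next
    case False
    have "?S = {}"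
    proof (rule equals0I)
      fix \<sigma> assume "\<sigma> \<in> ?S"
      then have "\<sigma> permutes {1..sum_list l} \<and> ?P (tableau_act l \<sigma> t)" by (rule S[THEN iffD1])
      then show False using False tableau_act_tableau[OF t] by blast
    qed
    then have "(\<Sum>\<sigma>\<in>?S. 1 :: bit) = 0" by (simp only:) simp
    then show ?thesis using False by simp
  qed
  finally show ?thesis
    unfolding polytabloid_apply[OF t u] .
qed

text \<open>\<open>specht_subset\<close> serves as the induction rule for the span: a property
  closed under linear combinations has to be checked on polytabloids only. \<open>specht_eq\<close>
  puts the module into the form in which sums and traces on submodules are computed.\<close>

lemma
  fixes l :: "nat list"
  defines "S \<equiv> specht_gmodule (ring_of_type_algebra :: 'a::field ring) l"
  shows specht_submodule: "submodule (carrier S) ring_of_type_algebra (tabloid_gmodule ring_of_type_algebra l)"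
    and polytabloid_in_specht: "t \<in> tableaux l \<Longrightarrow> polytabloid ring_of_type_algebra l t \<in> carrier S"
    and specht_subset: "submodule U ring_of_type_algebra (tabloid_gmodule ring_of_type_algebra l) \<Longrightarrow>
      (\<And>t. t \<in> tableaux l \<Longrightarrow> polytabloid ring_of_type_algebra l t \<in> U) \<Longrightarrow> carrier S \<subseteq> U"
    and specht_eq: "S = (tabloid_gmodule ring_of_type_algebra l)\<lparr>carrier := carrier S\<rparr>"
proof -
  let ?R = "ring_of_type_algebra :: 'a ring" and ?M = "tabloid_gmodule (ring_of_type_algebra :: 'a ring) l"
  interpret module ?R ?M
    by (rule module_tabloid_gmodule)
  let ?U = "{U. submodule U ?R ?M \<and> polytabloid ?R l ` tableaux l \<subseteq> U}"
  have car: "carrier S = \<Inter>?U" by (simp add: S_def specht_gmodule_def)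
  have "carrier ?M \<in> ?U"
    using carrier_is_submodule polytabloid_closed by blast
  then show "submodule (carrier S) ?R ?M"
    unfolding car by (intro submodule_Inter) auto
  show "t \<in> tableaux l \<Longrightarrow> polytabloid ?R l t \<in> carrier S"
    unfolding car by auto
  show "submodule U ?R ?M \<Longrightarrow>
      (\<And>t. t \<in> tableaux l \<Longrightarrow> polytabloid ?R l t \<in> U) \<Longrightarrow> carrier S \<subseteq> U"
    unfolding car by (rule Inter_lower) auto
  show "S = ?M\<lparr>carrier := carrier S\<rparr>"
    by (simp add: S_def specht_gmodule_def)
qed

lemma module_specht:
  "module (ring_of_type_algebra :: 'a::field ring) (specht_gmodule ring_of_type_algebra l)"
  using submodule.submodule_is_module[OF specht_submodule module_tabloid_gmodule] specht_eq
  by metis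

section \<open>The induced module as functions on three-element sets\<close>

definition triples :: "nat set set" where
  "triples = {A. A \<subseteq> {1..6} \<and> card A = 3}"

abbreviation other_block :: "nat set \<Rightarrow> nat set" where
  "other_block A \<equiv> {1..6} - A"

text \<open>A permutation that sends \<open>B\<close> to one of the two blocks sends the complement
  of \<open>B\<close> to the other, so the stabilizer of the partition can be described by
  \<open>B\<close> alone.\<close>

definition block_stabilizer :: "nat set \<Rightarrow> (nat \<Rightarrow> nat) set" where
  "block_stabilizer B = {\<sigma>. \<sigma> permutes {1..6} \<and> (\<sigma> ` B = B \<or> \<sigma> ` B = other_block B)}"

type_synonym 'a ind_module = "('a, (nat \<Rightarrow> nat) \<Rightarrow> 'a, nat \<Rightarrow> nat) gmodule"

definition ind :: "nat set \<Rightarrow> 'a::field ind_module" where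
  "ind B = induced_gmodule (sym_group 6) (block_stabilizer B) (trivial_gmodule ring_of_type_algebra)"

text \<open>A coset of the stabilizer corresponds to the image of \<open>B\<close> up to complement.
  Elements of the induced module are therefore read as functions of that image, and
  \<open>unhat\<close> goes back.\<close>

definition hat :: "nat set \<Rightarrow> ((nat \<Rightarrow> nat) \<Rightarrow> 'a) \<Rightarrow> nat set \<Rightarrow> 'a" where
  "hat B f A = f (SOME \<sigma>. \<sigma> permutes {1..6} \<and> \<sigma> ` B = A)"

definition unhat :: "nat set \<Rightarrow> (nat set \<Rightarrow> 'a) \<Rightarrow> (nat \<Rightarrow> nat) \<Rightarrow> 'a" where
  "unhat B F = (\<lambda>\<sigma>\<in>{\<sigma>. \<sigma> permutes {1..6}}. F (\<sigma> ` B))"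

lemma finite_triples: "finite triples"
  by (rule finite_subset[of _ "Pow {1..6}"]) (auto simp: triples_def)

lemma other_block_triples:
  assumes "A \<in> triples"
  shows "other_block A \<in> triples" "other_block (other_block A) = A" "other_block A \<noteq> A"
proof -
  have "finite A" using assms by (auto simp: triples_def intro: card_ge_0_finite)
  then show "other_block A \<in> triples" using assms by (auto simp: triples_def card_Diff_subset)
  show "other_block (other_block A) = A" using assms by (auto simp: triples_def)
  show "other_block A \<noteq> A"
  proof
    assume "other_block A = A"
    then have "A = {}" by blast
    then show False using assms by (simp add: triples_def)
  qed
qed

lemma permutes_triples:
  assumes "\<sigma> permutes {1..6}"
  shows "A \<in> triples \<Longrightarrow> \<sigma> ` A \<in> triples" "\<sigma> ` other_block A = other_block (\<sigma> ` A)"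
proof -
  show "A \<in> triples \<Longrightarrow> \<sigma> ` A \<in> triples"
    using card_image[OF permutes_inj_on[OF assms]] permutes_image[OF assms]
    by (auto simp: triples_def)
  show "\<sigma> ` other_block A = other_block (\<sigma> ` A)"
    by (simp add: image_set_diff[OF permutes_inj[OF assms]] permutes_image[OF assms])
qed

text \<open>A bijection between the triples is glued to one between their complements.\<close>

lemma ex_permutes_triple:
  assumes "A \<in> triples" "B \<in> triples"
  obtains \<sigma> where "\<sigma> permutes {1..6}" "\<sigma> ` B = A"
proof -
  have fin: "finite Y" if "Y \<in> triples" for Y
    using that by (auto simp: triples_def intro: card_ge_0_finite)
  have bij: "\<exists>g. bij_betw g Y Z" if "Y \<in> triples" "Z \<in> triples" for Y Z
    by (rule finite_same_card_bij[OF fin[OF that(1)] fin[OF that(2)]]) (use that in \<open>simp add: triples_def\<close>)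
  obtain g where g: "bij_betw g B A" using bij assms by blast
  obtain h where h: "bij_betw h (other_block B) (other_block A)"
    using bij[OF other_block_triples(1) other_block_triples(1)] assms by blast
  define \<sigma> where "\<sigma> x = (if x \<in> B then g x else if x \<in> {1..6} then h x else x)" for x
  have 1: "bij_betw \<sigma> B A"
    using bij_betw_cong[of B \<sigma> g A] g by (simp add: \<sigma>_def)
  have 2: "bij_betw \<sigma> (other_block B) (other_block A)"
    using bij_betw_cong[of "other_block B" \<sigma> h "other_block A"] h by (simp add: \<sigma>_def)
  have un: "Y \<union> other_block Y = {1..6}" if "Y \<in> triples" for Y
    using that by (auto simp: triples_def)
  have "bij_betw \<sigma> {1..6} {1..6}"
    using bij_betw_combine[OF 1 2] un assms by auto
  moreover have "\<sigma> x = x" if "x \<notin> {1..6}" for x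
    using that assms by (auto simp: \<sigma>_def triples_def)
  ultimately have "\<sigma> permutes {1..6}" by (rule bij_imp_permutes)
  then show thesis using that 1 by (auto simp: bij_betw_def)
qed

lemma block_stabilizer_subset: "block_stabilizer B \<subseteq> carrier (sym_group 6)"
  by (auto simp: block_stabilizer_def sym_group_carrier)

lemma group_module_ind:
  "group_module (ring_of_type_algebra :: 'a::field ring) (sym_group 6) (ind B)"
  unfolding ind_def by (rule group_module_induced[OF sym_group_is_group block_stabilizer_subset])

lemma ind_simps:
  "f \<in> carrier (ind B :: 'a::field ind_module) \<longleftrightarrow> f \<in> extensional {\<sigma>. \<sigma> permutes {1..6}} \<and>
    (\<forall>\<sigma> \<tau>. \<sigma> permutes {1..6} \<longrightarrow> \<tau> \<in> block_stabilizer B \<longrightarrow> f (\<sigma> \<circ> \<tau>) = f \<sigma>)"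
  "\<zero>\<^bsub>ind B :: 'a ind_module\<^esub> = (\<lambda>\<sigma>\<in>{\<sigma>. \<sigma> permutes {1..6}}. 0)"
  "f \<oplus>\<^bsub>ind B\<^esub> h = (\<lambda>\<sigma>\<in>{\<sigma>. \<sigma> permutes {1..6}}. f \<sigma> + h \<sigma>)"
  "a \<odot>\<^bsub>ind B\<^esub> f = (\<lambda>\<sigma>\<in>{\<sigma>. \<sigma> permutes {1..6}}. a * f \<sigma>)"
  "\<tau> permutes {1..6} \<Longrightarrow> gact (ind B) \<tau> f = (\<lambda>\<sigma>\<in>{\<sigma>. \<sigma> permutes {1..6}}. f (inv' \<tau> \<circ> \<sigma>))"
  by (auto simp: ind_def induced_trivial_eq sym_group_def PiE_def
      sym_group_inv_equality[unfolded sym_group_def, simplified])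

context
  fixes B :: "nat set"
  assumes B: "B \<in> triples"
begin

lemma some_permutes:
  assumes "A \<in> triples"
  defines "\<sigma> \<equiv> SOME \<sigma>. \<sigma> permutes {1..6} \<and> \<sigma> ` B = A"
  shows "\<sigma> permutes {1..6}" "\<sigma> ` B = A"
proof -
  have "\<exists>\<sigma>. \<sigma> permutes {1..6} \<and> \<sigma> ` B = A"
    using ex_permutes_triple[OF assms(1) B] by blast
  from someI_ex[OF this] show "\<sigma> permutes {1..6}" "\<sigma> ` B = A"
    by (simp_all add: \<sigma>_def)
qed

text \<open>Two permutations with the same image of \<open>B\<close> differ on the right by an
  element of the stabilizer, so the choice made in \<open>hat\<close> does not matter.\<close>

lemma hat_image:
  assumes f: "f \<in> carrier (ind B :: 'a::field ind_module)" and \<sigma>: "\<sigma> permutes {1..6}"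
  shows "hat B f (\<sigma> ` B) = f \<sigma>"
proof -
  note A = permutes_triples(1)[OF \<sigma> B]
  define \<tau> where "\<tau> = (SOME \<tau>. \<tau> permutes {1..6} \<and> \<tau> ` B = \<sigma> ` B)"
  have \<tau>: "\<tau> permutes {1..6}" "\<tau> ` B = \<sigma> ` B"
    using some_permutes[OF A] by (simp_all add: \<tau>_def)
  have "(inv' \<tau> \<circ> \<sigma>) ` B = inv' \<tau> ` \<tau> ` B"
    by (simp only: image_comp[symmetric] \<tau>(2))
  then have "(inv' \<tau> \<circ> \<sigma>) ` B = B"
    by (simp add: image_comp permutes_inv_o(2)[OF \<tau>(1)])
  then have "inv' \<tau> \<circ> \<sigma> \<in> block_stabilizer B"
    using permutes_compose[OF \<sigma> permutes_inv[OF \<tau>(1)]] by (simp add: block_stabilizer_def)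
  then have "f (\<tau> \<circ> (inv' \<tau> \<circ> \<sigma>)) = f \<tau>" using f \<tau>(1) by (simp add: ind_simps)
  moreover have "\<tau> \<circ> (inv' \<tau> \<circ> \<sigma>) = \<sigma>"
    using permutes_inv_o(1)[OF \<tau>(1)] by (simp add: o_assoc)
  ultimately show ?thesis by (simp add: hat_def \<tau>_def)
qed

text \<open>The stabilizer contains a permutation that exchanges \<open>B\<close> with its
  complement; multiplying by it on the right complements the image of \<open>B\<close> and keeps the
  value.\<close>

lemma hat_other_block:
  assumes f: "f \<in> carrier (ind B :: 'a::field ind_module)" and A: "A \<in> triples"
  shows "hat B f (other_block A) = hat B f A"
proof -
  obtain \<sigma> where \<sigma>: "\<sigma> permutes {1..6}" "\<sigma> ` B = A" using ex_permutes_triple[OF A B] .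
  obtain \<rho> where \<rho>: "\<rho> permutes {1..6}" "\<rho> ` B = other_block B"
    using ex_permutes_triple[OF other_block_triples(1)[OF B] B] .
  have "(\<sigma> \<circ> \<rho>) ` B = other_block A"
    using \<rho>(2) \<sigma> permutes_triples(2)[OF \<sigma>(1)] by (metis image_comp)
  moreover have "f (\<sigma> \<circ> \<rho>) = f \<sigma>"
    using f \<sigma> \<rho> by (simp add: ind_simps block_stabilizer_def)
  ultimately show ?thesis
    using hat_image[OF f \<sigma>(1)] hat_image[OF f permutes_compose[OF \<rho>(1) \<sigma>(1)]] \<sigma>(2) by simp
qed

lemma unhat_closed:
  assumes "\<And>A. A \<in> triples \<Longrightarrow> F (other_block A) = F A"
  shows "unhat B F \<in> carrier (ind B :: 'a::field ind_module)"
proof -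
  have "F ((\<sigma> \<circ> \<tau>) ` B) = F (\<sigma> ` B)" if \<sigma>: "\<sigma> permutes {1..6}" and "\<tau> \<in> block_stabilizer B" for \<sigma> \<tau>
  proof -
    have "(\<sigma> \<circ> \<tau>) ` B = \<sigma> ` \<tau> ` B" by (rule image_comp[symmetric])
    then show ?thesis
      using that assms[OF permutes_triples(1)[OF \<sigma> B]] permutes_triples(2)[OF \<sigma>, of B]
      by (auto simp only: block_stabilizer_def)
  qed
  then show ?thesis
    by (auto simp: ind_simps unhat_def permutes_compose block_stabilizer_def)
qed

lemma hat_unhat: "A \<in> triples \<Longrightarrow> hat B (unhat B F) A = F A"
  using some_permutes[of A] by (simp add: hat_def unhat_def)

lemma hat_simps:
  assumes "A \<in> triples"
  shows "hat B (\<zero>\<^bsub>ind B :: 'a::field ind_module\<^esub>) A = 0"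
    "hat B (f \<oplus>\<^bsub>ind B :: 'a::field ind_module\<^esub> h) A = hat B f A + hat B h A"
    "hat B (a \<odot>\<^bsub>ind B :: 'a::field ind_module\<^esub> f) A = a * hat B f A"
  using some_permutes[OF assms] by (simp_all add: hat_def ind_simps)

lemma hat_gact:
  assumes f: "f \<in> carrier (ind B :: 'a::field ind_module)" and \<sigma>: "\<sigma> permutes {1..6}"
    and A: "A \<in> triples"
  shows "hat B (gact (ind B :: 'a::field ind_module) \<sigma> f) A = hat B f (inv' \<sigma> ` A)"
proof -
  define \<tau> where "\<tau> = (SOME \<tau>. \<tau> permutes {1..6} \<and> \<tau> ` B = A)"
  have \<tau>: "\<tau> permutes {1..6}" "\<tau> ` B = A"
    using some_permutes[OF A] by (simp_all add: \<tau>_def)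
  have "hat B (gact (ind B :: 'a::field ind_module) \<sigma> f) A = f (inv' \<sigma> \<circ> \<tau>)"
    using \<tau>(1) \<sigma> by (simp add: hat_def \<tau>_def ind_simps)
  also have "\<dots> = hat B f ((inv' \<sigma> \<circ> \<tau>) ` B)"
    by (rule hat_image[OF f permutes_compose[OF \<tau>(1) permutes_inv[OF \<sigma>]], symmetric])
  finally show ?thesis using \<tau>(2) by (metis image_comp)
qed

lemma ind_eqI:
  assumes f: "f \<in> carrier (ind B :: 'a::field ind_module)"
    and h: "h \<in> carrier (ind B :: 'a::field ind_module)"
    and eq: "\<And>A. A \<in> triples \<Longrightarrow> hat B f A = hat B h A"
  shows "f = h"
proof (rule extensionalityI)
  show "f \<in> extensional {\<sigma>. \<sigma> permutes {1..6}}" "h \<in> extensional {\<sigma>. \<sigma> permutes {1..6}}"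
    using f h by (simp_all add: ind_simps)
  fix \<sigma> :: "nat \<Rightarrow> nat" assume "\<sigma> \<in> {\<sigma>. \<sigma> permutes {1..6}}"
  then show "f \<sigma> = h \<sigma>"
    using hat_image[OF f] hat_image[OF h] eq permutes_triples(1)[OF _ B] by (metis mem_Collect_eq)
qed

end

subsection \<open>Enumerating triples\<close>

definition enumerates :: "nat \<Rightarrow> nat \<Rightarrow> nat \<Rightarrow> nat \<Rightarrow> nat \<Rightarrow> nat \<Rightarrow> bool" where
  "enumerates a b c d e f \<longleftrightarrow> {1..6} = {a, b, c, d, e, f} \<and> distinct [a, b, c, d, e, f]"

text \<open>As an equation of multisets the condition is visibly symmetric, so that
  \<open>add_mset_commute\<close> relabels the six points in any order.\<close>

lemma enumerates_list: "enumerates a b c d e f \<longleftrightarrow> mset [a, b, c, d, e, f] = mset_set {1..6}"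
proof
  assume "enumerates a b c d e f"
  then show "mset [a, b, c, d, e, f] = mset_set {1..6}"
    by (auto simp: enumerates_def mset_set_set[symmetric] simp del: mset.simps)
next
  assume eq: "mset [a, b, c, d, e, f] = mset_set {1..6}"
  have "set [a, b, c, d, e, f] = {1..6}"
    using arg_cong[OF eq, of set_mset] unfolding set_mset_mset by simp
  moreover have "distinct [a, b, c, d, e, f]"
    by (rule card_distinct) (simp only: calculation, simp)
  ultimately show "enumerates a b c d e f" unfolding enumerates_def by simp
qed

lemma ex_enumerates3:
  assumes "distinct [a, b, c]" "{a, b, c} \<subseteq> {1..6}"
  obtains d e f where "enumerates a b c d e f"
proof -
  obtain xs where xs: "set xs = {1..6} - {a, b, c}" "distinct xs"
    using finite_distinct_list[of "{1..6} - {a, b, c}"] by auto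
  have "length xs = 3"
    using distinct_card[OF xs(2)] assms unfolding xs(1) by (subst (asm) card_Diff_subset) auto
  then obtain d e f where "xs = [d, e, f]"
    by (auto simp: numeral_eq_Suc length_Suc_conv)
  then have def: "{d, e, f} = {1..6} - {a, b, c}" "distinct [d, e, f]"
    using xs by simp_all
  have "{1..6} = {a, b, c} \<union> {d, e, f}"
    unfolding def(1) using assms(2) by (simp only: Un_Diff_cancel Un_absorb1)
  moreover have "{d, e, f} \<inter> {a, b, c} = {}"
    unfolding def(1) by (rule Diff_disjoint[THEN trans[OF Int_commute]])
  ultimately have "enumerates a b c d e f"
    unfolding enumerates_def using def(2) assms(1) by (auto simp del: atLeastAtMost_iff)
  then show thesis by (rule that)
qed

lemma ex_enumerates2:
  assumes "a \<noteq> b" "a \<in> {1..6}" "b \<in> {1..6}"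
  obtains c d e f where "enumerates a b c d e f"
proof -
  have "\<not> {1..6} \<subseteq> {a, b}"
    using card_mono[of "{a, b}" "{1..6}"] assms(1) by auto
  then obtain c where "c \<in> {1..6}" "c \<noteq> a" "c \<noteq> b" by blast
  then have *: "distinct [a, b, c]" "{a, b, c} \<subseteq> {1..6}" using assms by simp_all
  show thesis by (rule ex_enumerates3[OF *]) (rule that)
qed

lemma triple_enumerates:
  assumes "A \<in> triples"
  obtains a b c d e f where "A = {a, b, c}" "enumerates a b c d e f"
  using assms ex_enumerates3 unfolding triples_def card_3_iff by (smt (verit) mem_Collect_eq distinct_length_2_or_more distinct_singleton)

lemma enumerates_triples:
  assumes "enumerates a b c d e f"
  shows "{a, b, c} \<in> triples" "other_block {a, b, c} = {d, e, f}"
  using assms unfolding enumerates_def triples_def by auto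

lemma
  assumes "enumerates a b c d e f"
  shows triples_containing: "{A \<in> triples. a \<in> A \<and> b \<in> A} =
      {{a, b, c}, {a, b, d}, {a, b, e}, {a, b, f}}" (is "?both")
    and triples_separating: "{A \<in> triples. a \<in> A \<and> b \<notin> A} =
      {{a, c, d}, {a, c, e}, {a, c, f}, {a, d, e}, {a, d, f}, {a, e, f}}" (is "?sep")
proof -
  have N: "{1..6} = {a, b, c, d, e, f}" and d: "distinct [a, b, c, d, e, f]"
    using assms by (auto simp: enumerates_def)
  have two: "\<exists>u v. A = {a, u, v} \<and> a \<noteq> u \<and> a \<noteq> v \<and> u \<noteq> v \<and> {u, v} \<subseteq> {b, c, d, e, f}"
    if "A \<in> triples" "a \<in> A" for A
  proof -
    have "card (A - {a}) = 2" using that by (simp add: triples_def)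
    then obtain u v where "A - {a} = {u, v}" "u \<noteq> v" by (auto simp: card_2_iff)
    then have "A = {a, u, v}" "u \<in> A - {a}" "v \<in> A - {a}" using that by auto
    then show ?thesis using \<open>u \<noteq> v\<close> that(1) N by (auto simp: triples_def)
  qed
  have mem: "{a, u, v} \<in> triples" if "{u, v} \<subseteq> {b, c, d, e, f}" "u \<noteq> v" "a \<noteq> u" "a \<noteq> v" for u v
    using that unfolding triples_def N by auto
  show ?both
  proof
    show "{A \<in> triples. a \<in> A \<and> b \<in> A} \<subseteq> {{a, b, c}, {a, b, d}, {a, b, e}, {a, b, f}}"
      using two d by (force simp: insert_commute)
    show "{{a, b, c}, {a, b, d}, {a, b, e}, {a, b, f}} \<subseteq> {A \<in> triples. a \<in> A \<and> b \<in> A}"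
      using mem d by auto
  qed
  show ?sep
  proof
    show "{A \<in> triples. a \<in> A \<and> b \<notin> A} \<subseteq>
        {{a, c, d}, {a, c, e}, {a, c, f}, {a, d, e}, {a, d, f}, {a, e, f}}"
    proof
      fix A assume "A \<in> {A \<in> triples. a \<in> A \<and> b \<notin> A}"
      then obtain u v where A: "A = insert a {u, v}" and "u \<noteq> v" "u \<in> {c, d, e, f}" "v \<in> {c, d, e, f}"
        using two[of A] by auto
      then have "{u, v} \<in> {{c, d}, {c, e}, {c, f}, {d, e}, {d, f}, {e, f}}"
        by (elim insertE emptyE) (simp_all add: insert_commute)
      then show "A \<in> {{a, c, d}, {a, c, e}, {a, c, f}, {a, d, e}, {a, d, f}, {a, e, f}}"
        unfolding A by (elim insertE emptyE) simp_all
    qed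
    show "{{a, c, d}, {a, c, e}, {a, c, f}, {a, d, e}, {a, d, f}, {a, e, f}} \<subseteq>
        {A \<in> triples. a \<in> A \<and> b \<notin> A}"
      using mem d by auto
  qed
qed

lemma
  fixes F :: "nat set \<Rightarrow> 'a::comm_monoid_add"
  assumes "enumerates a b c d e f"
  shows sum_triples_containing: "(\<Sum>A | A \<in> triples \<and> a \<in> A \<and> b \<in> A. F A) =
      F {a, b, c} + F {a, b, d} + F {a, b, e} + F {a, b, f}"
    and sum_triples_separating: "(\<Sum>A | A \<in> triples \<and> a \<in> A \<and> b \<notin> A. F A) =
      F {a, c, d} + F {a, c, e} + F {a, c, f} + F {a, d, e} + F {a, d, f} + F {a, e, f}"
proof -
  have d: "distinct [a, b, c, d, e, f]"
    using assms by (auto simp: enumerates_def)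
  \<comment> \<open>The reversed list gives the simplifier each inequality in the other orientation
    as well.\<close>
  then have d': "distinct [f, e, d, c, b, a]" by auto
  show "(\<Sum>A | A \<in> triples \<and> a \<in> A \<and> b \<in> A. F A) =
      F {a, b, c} + F {a, b, d} + F {a, b, e} + F {a, b, f}"
    unfolding triples_containing[OF assms]
    using d d' by (simp add: insert_ident doubleton_eq_iff add.assoc)
  show "(\<Sum>A | A \<in> triples \<and> a \<in> A \<and> b \<notin> A. F A) =
      F {a, c, d} + F {a, c, e} + F {a, c, f} + F {a, d, e} + F {a, d, f} + F {a, e, f}"
    unfolding triples_separating[OF assms]
    using d d' by (simp add: insert_ident doubleton_eq_iff add.assoc)
qed

section \<open>Tableaux of the shapes that occur\<close>

abbreviation l21111 :: "nat list" where "l21111 \<equiv> [2, 1, 1, 1, 1]"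

lemma young_diagram_shapes:
  "young_diagram [4, 2] = {(0, 0), (0, 1), (0, 2), (0, 3), (1, 0), (1, 1)}"
  "young_diagram [3, 3] = {(0, 0), (0, 1), (0, 2), (1, 0), (1, 1), (1, 2)}"
  "young_diagram l21111 = {(0, 0), (0, 1), (1, 0), (2, 0), (3, 0), (4, 0)}"
  by (auto simp: young_diagram_def numeral_eq_Suc One_nat_def less_Suc_eq)

lemma enumerates_distinct:
  assumes "enumerates a b c d e f"
  shows "distinct [a, b, c, d, e, f]" "distinct [f, e, d, c, b, a]" "{1..6} = {a, b, c, d, e, f}"
  using assms by (auto simp: enumerates_def)

lemma
  assumes t: "t \<in> tableaux [4, 2]"
  shows tableau_42_enumerates:
      "enumerates (t (0, 0)) (t (0, 1)) (t (0, 2)) (t (0, 3)) (t (1, 0)) (t (1, 1))"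
    and row_set_42: "row_set [4, 2] t 0 = other_block (row_set [4, 2] t 1)"
      "row_set [4, 2] t 1 = {t (1, 0), t (1, 1)}" "i \<notin> {0, 1} \<Longrightarrow> row_set [4, 2] t i = {}"
proof -
  have im: "t ` young_diagram [4, 2] = {1..6}" using tableau_image[OF t] by simp
  show en: "enumerates (t (0, 0)) (t (0, 1)) (t (0, 2)) (t (0, 3)) (t (1, 0)) (t (1, 1))"
    unfolding enumerates_def im[symmetric] using tableau_inj[OF t]
    by (simp add: young_diagram_shapes)
  show r1: "row_set [4, 2] t 1 = {t (1, 0), t (1, 1)}"
    by (auto simp: row_set_def young_diagram_shapes)
  show "row_set [4, 2] t i = {}" if "i \<notin> {0, 1}"
    using that by (auto simp: row_set_def young_diagram_shapes)
  have "row_set [4, 2] t 0 = {t (0, 0), t (0, 1), t (0, 2), t (0, 3)}"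
    by (auto simp: row_set_def young_diagram_shapes)
  then show "row_set [4, 2] t 0 = other_block (row_set [4, 2] t 1)"
    unfolding r1 using enumerates_distinct[OF en] by auto
qed

lemma
  assumes t: "t \<in> tableaux [3, 3]"
  shows tableau_33_enumerates:
      "enumerates (t (0, 0)) (t (0, 1)) (t (0, 2)) (t (1, 0)) (t (1, 1)) (t (1, 2))"
    and row_set_33: "row_set [3, 3] t 0 = {t (0, 0), t (0, 1), t (0, 2)}"
      "row_set [3, 3] t 1 = other_block (row_set [3, 3] t 0)" "i \<notin> {0, 1} \<Longrightarrow> row_set [3, 3] t i = {}"
    and column_set_33: "j < 3 \<Longrightarrow> column_set [3, 3] t j = {t (0, j), t (1, j)}"
      "j \<ge> 3 \<Longrightarrow> column_set [3, 3] t j = {}"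
proof -
  have im: "t ` young_diagram [3, 3] = {1..6}" using tableau_image[OF t] by simp
  show en: "enumerates (t (0, 0)) (t (0, 1)) (t (0, 2)) (t (1, 0)) (t (1, 1)) (t (1, 2))"
    unfolding enumerates_def im[symmetric] using tableau_inj[OF t]
    by (simp add: young_diagram_shapes)
  show r0: "row_set [3, 3] t 0 = {t (0, 0), t (0, 1), t (0, 2)}"
    by (auto simp: row_set_def young_diagram_shapes)
  show "row_set [3, 3] t i = {}" if "i \<notin> {0, 1}"
    using that by (auto simp: row_set_def young_diagram_shapes)
  have "row_set [3, 3] t 1 = {t (1, 0), t (1, 1), t (1, 2)}"
    by (auto simp: row_set_def young_diagram_shapes)
  then show "row_set [3, 3] t 1 = other_block (row_set [3, 3] t 0)"
    unfolding r0 using enumerates_distinct[OF en] by auto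
  show "column_set [3, 3] t j = {t (0, j), t (1, j)}" if "j < 3"
    using that by (auto simp: column_set_def young_diagram_shapes)
  show "column_set [3, 3] t j = {}" if "j \<ge> 3"
    using that by (auto simp: column_set_def young_diagram_shapes)
qed

lemma
  assumes t: "t \<in> tableaux l21111"
  shows tableau_21111_enumerates:
      "enumerates (t (0, 0)) (t (0, 1)) (t (1, 0)) (t (2, 0)) (t (3, 0)) (t (4, 0))"
    and row_set_21111: "row_set l21111 t 0 = {t (0, 0), t (0, 1)}"
      "i \<in> {1, 2, 3, 4} \<Longrightarrow> row_set l21111 t i = {t (i, 0)}"
      "i \<ge> 5 \<Longrightarrow> row_set l21111 t i = {}"
    and column_set_21111: "column_set l21111 t 0 = {1..6} - {t (0, 1)}"
      "column_set l21111 t 1 = {t (0, 1)}"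
      "j \<ge> 2 \<Longrightarrow> column_set l21111 t j = {}"
proof -
  have im: "t ` young_diagram l21111 = {1..6}" using tableau_image[OF t] by simp
  show en: "enumerates (t (0, 0)) (t (0, 1)) (t (1, 0)) (t (2, 0)) (t (3, 0)) (t (4, 0))"
    unfolding enumerates_def im[symmetric] using tableau_inj[OF t]
    by (simp add: young_diagram_shapes)
  show "row_set l21111 t 0 = {t (0, 0), t (0, 1)}"
    by (auto simp: row_set_def young_diagram_shapes)
  show "row_set l21111 t i = {t (i, 0)}" if "i \<in> {1, 2, 3, 4}"
    using that by (auto simp: row_set_def young_diagram_shapes)
  show "row_set l21111 t i = {}" if "i \<ge> 5"
    using that by (auto simp: row_set_def young_diagram_shapes)
  have "column_set l21111 t 0 = {t (0, 0), t (1, 0), t (2, 0), t (3, 0), t (4, 0)}"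
    by (auto simp: column_set_def young_diagram_shapes)
  then show "column_set l21111 t 0 = {1..6} - {t (0, 1)}"
    using enumerates_distinct[OF en] by auto
  show "column_set l21111 t 1 = {t (0, 1)}"
    by (auto simp: column_set_def young_diagram_shapes)
  show "column_set l21111 t j = {}" if "j \<ge> 2"
    using that by (auto simp: column_set_def young_diagram_shapes)
qed

section \<open>Explicit tableaux and the coefficients of polytabloids\<close>

definition tableau_of_rows :: "nat list \<Rightarrow> nat list list \<Rightarrow> nat \<times> nat \<Rightarrow> nat" where
  "tableau_of_rows l xss = (\<lambda>(i, j)\<in>young_diagram l. xss ! i ! j)"

lemma
  assumes "enumerates a b c d e f"
  shows tableau_of_rows_42: "tableau_of_rows [4, 2] [[a, b, c, d], [e, f]] \<in> tableaux [4, 2]"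
    and tableau_of_rows_33: "tableau_of_rows [3, 3] [[a, b, c], [d, e, f]] \<in> tableaux [3, 3]"
    and tableau_of_rows_21111: "tableau_of_rows l21111 [[a, b], [c], [d], [e], [f]] \<in> tableaux l21111"
  using enumerates_distinct(3)[OF assms]
  by (auto intro!: tableauI simp: tableau_of_rows_def young_diagram_shapes nth_Cons' simp del: atLeastAtMost_iff)

lemma tableau_of_rows_simps:
  "tableau_of_rows [4, 2] [[a, b, c, d], [e, f]] (0, 0) = a" "tableau_of_rows [4, 2] [[a, b, c, d], [e, f]] (0, 1) = b"
  "tableau_of_rows [4, 2] [[a, b, c, d], [e, f]] (1, 0) = e" "tableau_of_rows [4, 2] [[a, b, c, d], [e, f]] (1, 1) = f"
  "tableau_of_rows [3, 3] [[a, b, c], [d, e, f]] (0, 0) = a" "tableau_of_rows [3, 3] [[a, b, c], [d, e, f]] (0, 1) = b"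
  "tableau_of_rows [3, 3] [[a, b, c], [d, e, f]] (0, 2) = c" "tableau_of_rows [3, 3] [[a, b, c], [d, e, f]] (1, 0) = d"
  "tableau_of_rows [3, 3] [[a, b, c], [d, e, f]] (1, 1) = e" "tableau_of_rows [3, 3] [[a, b, c], [d, e, f]] (1, 2) = f"
  "tableau_of_rows l21111 [[a, b], [c], [d], [e], [f]] (0, 0) = a"
  "tableau_of_rows l21111 [[a, b], [c], [d], [e], [f]] (0, 1) = b"
  by (simp_all add: tableau_of_rows_def young_diagram_shapes nth_Cons')

text \<open>The first row is the complement of the second, so a tabloid of shape (4,2) is a pair of
  points, an edge of the complete graph on six points.\<close>

lemma rows_eq_42:
  assumes "t \<in> tableaux [4, 2]" "u \<in> tableaux [4, 2]"
  shows "(\<forall>i. row_set [4, 2] t i = row_set [4, 2] u i) \<longleftrightarrow> row_set [4, 2] t 1 = row_set [4, 2] u 1"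
proof (intro iffI allI)
  fix i assume "row_set [4, 2] t 1 = row_set [4, 2] u 1"
  then show "row_set [4, 2] t i = row_set [4, 2] u i"
    using row_set_42(1,3)[OF assms(1)] row_set_42(1,3)[OF assms(2)]
    by (cases "i = 0"; cases "i = 1") auto
qed blast

text \<open>Again one row is the complement of the other, so a tabloid of shape (3,3) is a
  triple.\<close>

lemma rows_eq_33:
  assumes "t \<in> tableaux [3, 3]" "u \<in> tableaux [3, 3]"
  shows "(\<forall>i. row_set [3, 3] t i = row_set [3, 3] u i) \<longleftrightarrow> row_set [3, 3] t 0 = row_set [3, 3] u 0"
proof (intro iffI allI)
  fix i assume "row_set [3, 3] t 0 = row_set [3, 3] u 0"
  then show "row_set [3, 3] t i = row_set [3, 3] u i"
    using row_set_33(2,3)[OF assms(1)] row_set_33(2,3)[OF assms(2)]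
    by (cases "i = 0"; cases "i = 1") auto
qed blast

text \<open>Column permutations can bring exactly those triples into the first row that contain one
  point of each of the three columns.\<close>

lemma polytabloid_33:
  assumes t: "t \<in> tableaux [3, 3]" and u: "u \<in> tableaux [3, 3]"
  defines "A \<equiv> row_set [3, 3] u 0"
  shows "polytabloid F2 [3, 3] t (tabloid [3, 3] u) =
    of_bool (\<forall>j<3. (t (0, j) \<in> A) \<noteq> (t (1, j) \<in> A))"
proof -
  have "(\<exists>v\<in>tableaux [3, 3]. row_set [3, 3] v 0 = A \<and>
      (\<forall>j. column_set [3, 3] v j = column_set [3, 3] t j)) \<longleftrightarrow>
    (\<forall>j<3. (t (0, j) \<in> A) \<noteq> (t (1, j) \<in> A))" (is "?l \<longleftrightarrow> ?r")
  proof
    assume ?l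
    then obtain v where v: "v \<in> tableaux [3, 3]" "row_set [3, 3] v 0 = A"
      "\<And>j. column_set [3, 3] v j = column_set [3, 3] t j" by blast
    show ?r
    proof (intro allI impI)
      fix j :: nat assume j: "j < 3"
      have "{v (0, j), v (1, j)} = {t (0, j), t (1, j)}"
        using v(3)[of j] column_set_33(1)[OF v(1) j] column_set_33(1)[OF t j] by simp
      moreover have "v (0, j) \<in> A" "v (1, j) \<notin> A"
      proof -
        have "j = 0 \<or> j = 1 \<or> j = 2" using j by auto
        then show "v (0, j) \<in> A" "v (1, j) \<notin> A"
          using row_set_33(1)[OF v(1)] enumerates_distinct(1,2)[OF tableau_33_enumerates[OF v(1)]]
          unfolding v(2) by auto
      qed
      ultimately show "(t (0, j) \<in> A) \<noteq> (t (1, j) \<in> A)"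
        by (auto simp: doubleton_eq_iff)
    qed
  next
    assume r: ?r
    \<comment> \<open>In column j the point that belongs to \<open>A\<close> goes to row 0 and the
      other one to row 1.\<close>
    define w where "w i j = (if (t (0, j) \<in> A) = (i = 0) then t (0, j) else t (1, j))" for i j :: nat
    define v where "v = tableau_of_rows [3, 3] [[w 0 0, w 0 1, w 0 2], [w 1 0, w 1 1, w 1 2]]"
    have "enumerates (w 0 0) (w 0 1) (w 0 2) (w 1 0) (w 1 1) (w 1 2)"
      using tableau_33_enumerates[OF t] by (auto simp: enumerates_def w_def)
    then have v: "v \<in> tableaux [3, 3]" unfolding v_def by (rule tableau_of_rows_33)
    have vw: "v (0, 0) = w 0 0" "v (0, 1) = w 0 1" "v (0, 2) = w 0 2"
      "v (1, 0) = w 1 0" "v (1, 1) = w 1 1" "v (1, 2) = w 1 2"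
      by (simp_all add: v_def tableau_of_rows_simps)
    have "w 0 j \<in> A" if "j < 3" for j
      using r that by (auto simp: w_def)
    then have sub: "row_set [3, 3] v 0 \<subseteq> A"
      by (simp add: row_set_33(1)[OF v] vw)
    \<comment> \<open>Both sets have three elements, so the inclusion is an equality.\<close>
    have "card (row_set [3, 3] s 0) = 3" if "s \<in> tableaux [3, 3]" for s
      using enumerates_distinct(1)[OF tableau_33_enumerates[OF that]] row_set_33(1)[OF that] by simp
    then have "card (row_set [3, 3] v 0) = card A" using u v by (simp add: A_def)
    then have "row_set [3, 3] v 0 = A"
      by (intro card_subset_eq[OF _ sub]) (simp_all add: A_def row_set_33(1)[OF u])
    moreover have "column_set [3, 3] v j = column_set [3, 3] t j" for j
    proof (cases "j < 3")
      case True
      then have "j = 0 \<or> j = 1 \<or> j = 2" by auto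
      then have "{v (0, j), v (1, j)} = {t (0, j), t (1, j)}"
        using vw by (auto simp: w_def)
      then show ?thesis using column_set_33(1)[OF v True] column_set_33(1)[OF t True] by simp
    next
      case False
      then show ?thesis using column_set_33(2)[OF v] column_set_33(2)[OF t] by simp
    qed
    ultimately show ?l using v by blast
  qed
  then show ?thesis
    using u by (simp add: polytabloid_F2[OF t u] rows_eq_33 A_def cong: conj_cong bex_cong)
qed

text \<open>The first column is the complement of \<open>t (0, 1)\<close>, so this entry determines
  all column sets. A tableau with the rows of \<open>u\<close> can only exchange the two points of
  the first row, hence the polytabloid is the star of that entry.\<close>

lemma polytabloid_21111:
  assumes t: "t \<in> tableaux l21111" and u: "u \<in> tableaux l21111"
  shows "polytabloid F2 l21111 t (tabloid l21111 u) =
    of_bool (t (0, 1) \<in> row_set l21111 u 0)"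
proof -
  let ?l = l21111
  have cols: "(\<forall>j. column_set ?l v j = column_set ?l t j) \<longleftrightarrow> v (0, 1) = t (0, 1)"
    if v: "v \<in> tableaux ?l" for v
  proof (intro iffI allI)
    fix j assume "v (0, 1) = t (0, 1)"
    then show "column_set ?l v j = column_set ?l t j"
      using column_set_21111[OF v] column_set_21111[OF t]
      by (cases "j = 0"; cases "j = 1") auto
  next
    assume "\<forall>j. column_set ?l v j = column_set ?l t j"
    from spec[OF this, of 1] show "v (0, 1) = t (0, 1)"
      using column_set_21111(2)[OF v] column_set_21111(2)[OF t] by simp
  qed
  have "(\<exists>v\<in>tableaux ?l. (\<forall>i. row_set ?l v i = row_set ?l u i) \<and> v (0, 1) = t (0, 1)) \<longleftrightarrow>
    t (0, 1) \<in> row_set ?l u 0" (is "?L \<longleftrightarrow> ?R")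
  proof
    assume ?L
    then obtain v where v: "v \<in> tableaux ?l" "row_set ?l v 0 = row_set ?l u 0" "v (0, 1) = t (0, 1)"
      by blast
    then show ?R using row_set_21111(1)[OF v(1)] by auto
  next
    assume ?R
    then consider "u (0, 1) = t (0, 1)" | "u (0, 0) = t (0, 1)"
      using row_set_21111(1)[OF u] by auto
    then show ?L
    proof cases
      case 1
      then show ?thesis using u by blast
    next
      case 2
      let ?s = "transpose (u (0, 0)) (u (0, 1))"
      define v where "v = tableau_act ?l ?s u"
      note en = enumerates_distinct[OF tableau_21111_enumerates[OF u]]
      have "?s permutes {1..6}" using en(3) by (intro permutes_swap_id) auto
      then have v: "v \<in> tableaux ?l" unfolding v_def by (intro tableau_act_tableau[OF u]) simp
      have "row_set ?l v i = row_set ?l u i" for i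
      proof -
        have "i = 0 \<or> i \<in> {1, 2, 3, 4} \<or> i \<ge> 5" by auto
        then show ?thesis
          using en(1,2) row_set_21111[OF u] unfolding v_def row_set_act
          by (auto simp: transpose_def)
      qed
      moreover have "v (0, 1) = t (0, 1)"
        using 2 by (simp add: v_def compose_def young_diagram_shapes)
      ultimately show ?thesis using v by blast
    qed
  qed
  then show ?thesis
    by (simp add: polytabloid_F2[OF t u] cols cong: conj_cong bex_cong)
qed

text \<open>Only the first two columns have two entries; the group generated by their transpositions
  is a Klein four-group.\<close>

lemma column_stabilizer_42:
  assumes t: "t \<in> tableaux [4, 2]"
  defines "\<alpha> \<equiv> transpose (t (0, 0)) (t (1, 0))" and "\<beta> \<equiv> transpose (t (0, 1)) (t (1, 1))"
  shows "column_stabilizer [4, 2] t = {id, \<alpha>, \<beta>, \<alpha> \<circ> \<beta>}" and "distinct [id, \<alpha>, \<beta>, \<alpha> \<circ> \<beta>]"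
proof -
  define a b c d e f where defs: "a = t (0, 0)" "b = t (0, 1)" "c = t (0, 2)" "d = t (0, 3)"
    "e = t (1, 0)" "f = t (1, 1)"
  have en: "distinct [a, b, c, d, e, f]" "distinct [f, e, d, c, b, a]" "{1..6} = {a, b, c, d, e, f}"
    using enumerates_distinct[OF tableau_42_enumerates[OF t]] by (simp_all add: defs)
  have \<alpha>: "\<alpha> = transpose a e" and \<beta>: "\<beta> = transpose b f" by (simp_all add: \<alpha>_def \<beta>_def defs)
  have cs: "{t (i, j) |i. (i, j) \<in> young_diagram [4, 2]} =
      (if j = 0 then {a, e} else if j = 1 then {b, f} else if j = 2 then {c} else if j = 3 then {d} else {})" for j
    by (auto simp: young_diagram_shapes defs)
  have all: "(\<forall>j. P j) \<longleftrightarrow> P 0 \<and> P 1 \<and> P 2 \<and> P 3 \<and> (\<forall>j. j \<notin> {0, 1, 2, 3} \<longrightarrow> P j)" (is "_ \<longleftrightarrow> ?Q")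
    for P :: "nat \<Rightarrow> bool"
  proof (intro iffI allI)
    fix j assume ?Q
    then show "P j" by (cases "j \<in> {0, 1, 2, 3}") auto
  qed auto
  have mem: "\<sigma> \<in> column_stabilizer [4, 2] t \<longleftrightarrow>
      \<sigma> permutes {1..6} \<and> \<sigma> ` {a, e} = {a, e} \<and> \<sigma> ` {b, f} = {b, f} \<and> \<sigma> c = c \<and> \<sigma> d = d" for \<sigma>
    unfolding column_stabilizer_def cs by (subst all) (auto simp: sym_group_carrier)
  have perm: "\<alpha> permutes {1..6}" "\<beta> permutes {1..6}"
    unfolding \<alpha> \<beta> en(3) by (auto intro!: permutes_swap_id)
  show "column_stabilizer [4, 2] t = {id, \<alpha>, \<beta>, \<alpha> \<circ> \<beta>}"
  proof (intro equalityI subsetI)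
    fix \<sigma> assume "\<sigma> \<in> column_stabilizer [4, 2] t"
    then have \<sigma>: "\<sigma> permutes {1..6}" "{\<sigma> a, \<sigma> e} = {a, e}" "{\<sigma> b, \<sigma> f} = {b, f}" "\<sigma> c = c" "\<sigma> d = d"
      by (auto simp: mem)
    have eqI: "\<sigma> = \<tau>" if "\<tau> permutes {1..6}" "\<And>x. x \<in> {a, b, c, d, e, f} \<Longrightarrow> \<sigma> x = \<tau> x" for \<tau>
      using that \<sigma>(1) en(3) by (metis permutes_not_in ext)
    have "\<sigma> a = a \<and> \<sigma> e = e \<or> \<sigma> a = e \<and> \<sigma> e = a" "\<sigma> b = b \<and> \<sigma> f = f \<or> \<sigma> b = f \<and> \<sigma> f = b"
      using \<sigma>(2,3) by (auto simp: doubleton_eq_iff)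
    then consider "\<sigma> a = a" "\<sigma> e = e" "\<sigma> b = b" "\<sigma> f = f" | "\<sigma> a = e" "\<sigma> e = a" "\<sigma> b = b" "\<sigma> f = f"
      | "\<sigma> a = a" "\<sigma> e = e" "\<sigma> b = f" "\<sigma> f = b" | "\<sigma> a = e" "\<sigma> e = a" "\<sigma> b = f" "\<sigma> f = b"
      by blast
    then show "\<sigma> \<in> {id, \<alpha>, \<beta>, \<alpha> \<circ> \<beta>}"
    proof cases
      case 1
      then have "\<sigma> = id" using \<sigma>(4,5) by (intro eqI permutes_id; elim insertE emptyE; simp)
      then show ?thesis by simp
    next
      case 2
      then have "\<sigma> = \<alpha>" using \<sigma>(4,5) en(1,2) by (intro eqI perm; elim insertE emptyE; simp add: \<alpha>)
      then show ?thesis by simp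
    next
      case 3
      then have "\<sigma> = \<beta>" using \<sigma>(4,5) en(1,2) by (intro eqI perm; elim insertE emptyE; simp add: \<beta>)
      then show ?thesis by simp
    next
      case 4
      then have "\<sigma> = \<alpha> \<circ> \<beta>" using \<sigma>(4,5) en(1,2)
        by (intro eqI permutes_compose perm; elim insertE emptyE; simp add: \<alpha> \<beta>)
      then show ?thesis by simp
    qed
  next
    fix \<sigma> assume "\<sigma> \<in> {id, \<alpha>, \<beta>, \<alpha> \<circ> \<beta>}"
    then show "\<sigma> \<in> column_stabilizer [4, 2] t"
      unfolding mem using perm permutes_compose[OF perm(2,1)] en(1,2)
      by (auto simp: \<alpha> \<beta> permutes_id)
  qed
  \<comment> \<open>The images of a and b tell the four permutations apart.\<close>
  have "\<alpha> a = e" "\<alpha> b = b" "\<beta> a = a" "\<beta> b = f" using en(1,2) by (simp_all add: \<alpha> \<beta>)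
  moreover from this have "(\<alpha> \<circ> \<beta>) a = e" "(\<alpha> \<circ> \<beta>) b = f" using en(1,2) by (simp_all add: \<alpha>)
  ultimately have "distinct (map (\<lambda>\<sigma>. (\<sigma> a, \<sigma> b)) [id, \<alpha>, \<beta>, \<alpha> \<circ> \<beta>])"
    using en(1,2) by simp
  then show "distinct [id, \<alpha>, \<beta>, \<alpha> \<circ> \<beta>]"
    unfolding distinct_map by (rule conjunct1)
qed

text \<open>The four pairs are the edges of the cycle through \<open>t (1, 0)\<close>,
  \<open>t (1, 1)\<close>, \<open>t (0, 0)\<close>, \<open>t (0, 1)\<close> in this order, with
  alternating signs.\<close>

lemma polytabloid_42:
  assumes t: "t \<in> tableaux [4, 2]" and u: "u \<in> tableaux [4, 2]"
  defines "S \<equiv> row_set [4, 2] u 1"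
  shows "polytabloid (ring_of_type_algebra :: 'a::field ring) [4, 2] t (tabloid [4, 2] u) =
    of_bool (S = {t (1, 0), t (1, 1)}) - of_bool (S = {t (0, 0), t (1, 1)})
      - of_bool (S = {t (1, 0), t (0, 1)}) + of_bool (S = {t (0, 0), t (0, 1)})"
proof -
  let ?\<alpha> = "transpose (t (0, 0)) (t (1, 0))" and ?\<beta> = "transpose (t (0, 1)) (t (1, 1))"
  note cs = column_stabilizer_42[OF t]
  note en = enumerates_distinct[OF tableau_42_enumerates[OF t]]
  have row: "(\<forall>i. row_set [4, 2] (tableau_act [4, 2] \<sigma> t) i = row_set [4, 2] u i) \<longleftrightarrow>
      S = {\<sigma> (t (1, 0)), \<sigma> (t (1, 1))}" if "\<sigma> \<in> column_stabilizer [4, 2] t" for \<sigma>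
  proof -
    have "tableau_act [4, 2] \<sigma> t \<in> tableaux [4, 2]"
      using that t by (simp add: column_stabilizer_def sym_group_carrier tableau_act_tableau)
    from rows_eq_42[OF this u] show ?thesis
      by (simp add: S_def row_set_act row_set_42(2)[OF t] eq_commute)
  qed
  have perm: "permutation ?\<alpha>" "permutation ?\<beta>"
    by (simp_all add: permutation_swap_id)
  have ev: "evenperm id" "\<not> evenperm ?\<alpha>" "\<not> evenperm ?\<beta>" "evenperm (?\<alpha> \<circ> ?\<beta>)"
    using en(1) by (simp_all add: evenperm_id evenperm_swap evenperm_comp[OF perm])
  have fin: "finite (column_stabilizer [4, 2] t)" by (simp add: cs(1))
  have "polytabloid (ring_of_type_algebra :: 'a ring) [4, 2] t (tabloid [4, 2] u) =
    (\<Sum>\<sigma>\<in>column_stabilizer [4, 2] t. if \<forall>i. row_set [4, 2] (tableau_act [4, 2] \<sigma> t) i = row_set [4, 2] u i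
      then if evenperm \<sigma> then 1 else - 1 else 0)"
    unfolding polytabloid_apply[OF t u] by (rule sum.inter_filter[OF fin])
  also have "\<dots> = (\<Sum>\<sigma>\<in>column_stabilizer [4, 2] t. if S = {\<sigma> (t (1, 0)), \<sigma> (t (1, 1))}
      then if evenperm \<sigma> then 1 else - 1 else 0)"
    by (rule sum.cong) (simp_all add: row)
  also have "\<dots> = (\<Sum>\<sigma>\<leftarrow>[id, ?\<alpha>, ?\<beta>, ?\<alpha> \<circ> ?\<beta>]. if S = {\<sigma> (t (1, 0)), \<sigma> (t (1, 1))}
      then if evenperm \<sigma> then 1 else - 1 else 0)"
    by (subst sum_list_distinct_conv_sum_set[OF cs(2)]) (simp only: cs(1) list.set)
  also have "\<dots> = of_bool (S = {t (1, 0), t (1, 1)}) - of_bool (S = {t (0, 0), t (1, 1)})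
      - of_bool (S = {t (1, 0), t (0, 1)}) + of_bool (S = {t (0, 0), t (0, 1)})"
    using en(1,2) ev by (simp add: if_distrib)
  finally show ?thesis .
qed

lemma tabloid_in_tabloids [simp]: "t \<in> tableaux l \<Longrightarrow> tabloid l t \<in> tabloids l"
  by (simp add: tabloids_def)

section \<open>Separating sums\<close>

definition sep :: "nat set \<Rightarrow> ((nat \<Rightarrow> nat) \<Rightarrow> 'a::field) \<Rightarrow> nat \<Rightarrow> nat \<Rightarrow> 'a" where
  "sep B f x y = (\<Sum>A | A \<in> triples \<and> x \<in> A \<and> y \<notin> A. hat B f A)"

lemma sep_same [simp]: "sep B f x x = 0"
  by (simp add: sep_def)

text \<open>Together with \<open>ac_simps\<close> these two rules cancel equal terms anywhere in a
  sum, which settles linear identities in characteristic 2.\<close>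

lemma bit_add_cancel [simp]: "x + x = 0" "x + (x + y) = (y :: bit)"
proof -
  show "x + x = 0" for x :: bit by (cases x) auto
  then show "x + (x + y) = (y :: bit)" by (metis add.assoc add_0)
qed

lemma image_submodule:
  assumes M: "group_module R G M" and V: "group_submodule R G M V" and N: "module R N"
    and into: "\<And>v. v \<in> V \<Longrightarrow> \<theta> v \<in> carrier N"
    and add: "\<And>v w. v \<in> V \<Longrightarrow> w \<in> V \<Longrightarrow> \<theta> (v \<oplus>\<^bsub>M\<^esub> w) = \<theta> v \<oplus>\<^bsub>N\<^esub> \<theta> w"
    and smult: "\<And>a v. a \<in> carrier R \<Longrightarrow> v \<in> V \<Longrightarrow> \<theta> (a \<odot>\<^bsub>M\<^esub> v) = a \<odot>\<^bsub>N\<^esub> \<theta> v"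
  shows "submodule (\<theta> ` V) R N"
proof -
  interpret M: group_module R G M by fact
  interpret N: module R N by fact
  note c = M.group_submodule_closed[OF V]
  have "\<theta> \<zero>\<^bsub>M\<^esub> = \<zero>\<^bsub>N\<^esub>"
    using smult[of "\<zero>\<^bsub>R\<^esub>" "\<zero>\<^bsub>M\<^esub>"] c(2) into[OF c(2)] by simp
  then have "\<zero>\<^bsub>N\<^esub> \<in> \<theta> ` V" using c(2) by force
  then show ?thesis
    using into c(3,5) by (intro N.submoduleI') (auto simp: add[symmetric] smult[symmetric])
qed

context
  fixes B :: "nat set"
  assumes B: "B \<in> triples"
begin

lemma sep_add: "sep B (f \<oplus>\<^bsub>ind B :: 'a::field ind_module\<^esub> h) x y = sep B f x y + sep B h x y"
  by (simp add: sep_def hat_simps[OF B] sum.distrib)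

lemma sep_smult: "sep B (a \<odot>\<^bsub>ind B :: 'a::field ind_module\<^esub> f) x y = a * sep B f x y"
  by (simp add: sep_def hat_simps[OF B] sum_distrib_left)

lemma sep_gact:
  assumes f: "f \<in> carrier (ind B :: 'a::field ind_module)" and \<sigma>: "\<sigma> permutes {1..6}"
  shows "sep B (gact (ind B :: 'a ind_module) \<sigma> f) x y = sep B f (inv' \<sigma> x) (inv' \<sigma> y)"
proof -
  note \<sigma>' = permutes_inv[OF \<sigma>]
  have id: "\<sigma> ` inv' \<sigma> ` A = A" "inv' \<sigma> ` \<sigma> ` A = A" for A
    by (simp_all add: image_comp permutes_inv_o[OF \<sigma>])
  have mem: "x \<in> \<sigma> ` A \<longleftrightarrow> inv' \<sigma> x \<in> A" for x A
    using permutes_inverses[OF \<sigma>] by (metis image_iff)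
  show ?thesis
    unfolding sep_def
    by (rule sum.reindex_bij_witness[of _ "\<lambda>A. \<sigma> ` A" "\<lambda>A. inv' \<sigma> ` A"])
      (auto simp: id mem[symmetric] permutes_triples(1)[OF \<sigma>] permutes_triples(1)[OF \<sigma>']
        hat_gact[OF B f \<sigma>])
qed

text \<open>Complements exchange the triples containing x but not y with those containing y but not
  x.\<close>

lemma sep_commute:
  assumes f: "f \<in> carrier (ind B :: 'a::field ind_module)" and "x \<in> {1..6}" "y \<in> {1..6}"
  shows "sep B f x y = sep B f y x"
  unfolding sep_def
  by (rule sum.reindex_bij_witness[of _ other_block other_block])
    (use assms in \<open>auto simp: other_block_triples hat_other_block[OF B f] simp del: atLeastAtMost_iff\<close>)

lemma sep_enumerates:
  assumes "enumerates x y c d e f"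
  shows "sep B h x y = hat B h {x, c, d} + hat B h {x, c, e} + hat B h {x, c, f}
    + hat B h {x, d, e} + hat B h {x, d, f} + hat B h {x, e, f}"
  unfolding sep_def by (rule sum_triples_separating[OF assms])

text \<open>After cancellation of common terms there remain the three triples that contain x and z
  but not y, and the three that contain y but neither x nor z. They are complements of each other,
  so their values cancel modulo 2.\<close>

lemma sep_cocycle:
  assumes h: "h \<in> carrier (ind B :: bit ind_module)"
    and xyz: "x \<in> {1..6}" "y \<in> {1..6}" "z \<in> {1..6}"
  shows "sep B h x y + sep B h y z = sep B h x z"
proof (cases "distinct [x, y, z]")
  case True
  then obtain d e f where en: "enumerates x y z d e f"
    using ex_enumerates3[of x y z] xyz by blast
  have perms: "enumerates y z x d e f" "enumerates x z y d e f" "enumerates y d e x z f"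
    "enumerates y d f x z e" "enumerates y e f x z d"
    using en by (simp_all add: enumerates_list add_mset_commute)
  have "hat B h {y, d, e} = hat B h {x, z, f}" "hat B h {y, d, f} = hat B h {x, z, e}"
    "hat B h {y, e, f} = hat B h {x, z, d}"
    using hat_other_block[OF B h] enumerates_triples[OF perms(3)] enumerates_triples[OF perms(4)]
      enumerates_triples[OF perms(5)] by metis+
  then show ?thesis
    unfolding sep_enumerates[OF en] sep_enumerates[OF perms(1)] sep_enumerates[OF perms(2)]
    by (simp add: insert_commute ac_simps)
next
  case False
  then show ?thesis using sep_commute[OF h] xyz by auto
qed

definition sep_kernel :: "((nat \<Rightarrow> nat) \<Rightarrow> bit) set" where
  "sep_kernel = {f \<in> carrier (ind B). \<forall>x\<in>{1..6}. \<forall>y\<in>{1..6}. sep B f x y = 0}"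

text \<open>A cocycle is determined by its values from one base point.\<close>

lemma sep_kernelI:
  assumes h: "h \<in> carrier (ind B)" and "x \<in> {1..6}" "\<And>y. y \<in> {1..6} \<Longrightarrow> sep B h x y = 0"
  shows "h \<in> sep_kernel"
proof -
  have "sep B h y z = 0" if "y \<in> {1..6}" "z \<in> {1..6}" for y z
    using sep_cocycle[OF h that(1) assms(2) that(2)] sep_commute[OF h assms(2) that(1)] assms(3) that
    by simp
  then show ?thesis using h unfolding sep_kernel_def by blast
qed

lemma group_submodule_sep_kernel: "group_submodule F2 (sym_group 6) (ind B) sep_kernel"
proof -
  interpret group_module F2 "sym_group 6" "ind B :: bit ind_module" by (rule group_module_ind)
  have "submodule sep_kernel F2 (ind B)"
  proof (rule submoduleI')
    have "sep B \<zero>\<^bsub>ind B :: bit ind_module\<^esub> x y = 0" for x y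
      by (simp add: sep_def hat_simps[OF B])
    then show "\<zero>\<^bsub>ind B\<^esub> \<in> sep_kernel" by (simp add: sep_kernel_def)
  qed (auto simp: sep_kernel_def sep_add sep_smult)
  moreover have "gact (ind B) \<sigma> f \<in> sep_kernel" if "\<sigma> \<in> carrier (sym_group 6)" "f \<in> sep_kernel" for \<sigma> f
    using that gact_closed[OF that(1), of f] permutes_in_image[OF permutes_inv[of \<sigma> "{1..6}"]]
    unfolding sep_kernel_def by (auto simp: sep_gact sym_group_carrier simp del: atLeastAtMost_iff)
  ultimately show ?thesis by (simp add: group_submodule_def)
qed

subsection \<open>The kernel of the separating sums\<close>

definition transversal :: "(nat \<times> nat \<Rightarrow> nat) \<Rightarrow> nat set \<Rightarrow> bool" where
  "transversal t A \<longleftrightarrow> (\<forall>j<3. (t (0, j) \<in> A) \<noteq> (t (1, j) \<in> A))"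

lemma transversal_iff:
  "transversal t A \<longleftrightarrow> (t (0, 0) \<in> A) \<noteq> (t (1, 0) \<in> A) \<and> (t (0, 1) \<in> A) \<noteq> (t (1, 1) \<in> A)
    \<and> (t (0, 2) \<in> A) \<noteq> (t (1, 2) \<in> A)"
  by (auto simp: transversal_def numeral_eq_Suc less_Suc_eq One_nat_def)

lemma transversal_other_block:
  assumes "t \<in> tableaux [3, 3]"
  shows "transversal t (other_block A) = transversal t A"
  using enumerates_distinct(3)[OF tableau_33_enumerates[OF assms]]
  by (auto simp: transversal_iff simp del: atLeastAtMost_iff)

text \<open>Since a tabloid of shape (3,3) is a triple, this is \<open>F\<close> itself, regarded as
  an element of the tabloid module.\<close>

definition to_33 :: "((nat \<Rightarrow> nat) \<Rightarrow> bit) \<Rightarrow> (nat \<times> nat \<Rightarrow> nat) set \<Rightarrow> bit" where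
  "to_33 f = (\<lambda>T\<in>tabloids [3, 3]. hat B f (tabloid_row [3, 3] T 0))"

lemma to_33_apply: "u \<in> tableaux [3, 3] \<Longrightarrow> to_33 f (tabloid [3, 3] u) = hat B f (row_set [3, 3] u 0)"
  by (simp add: to_33_def tabloid_row_tabloid tabloids_def)

lemma to_33_closed: "to_33 f \<in> carrier (tabloid_gmodule F2 [3, 3])"
  by (auto simp: to_33_def)

lemma row_set_33_triples: "u \<in> tableaux [3, 3] \<Longrightarrow> row_set [3, 3] u 0 \<in> triples"
  using enumerates_triples(1)[OF tableau_33_enumerates] by (simp add: row_set_33)

lemma to_33_hom:
  "to_33 (f \<oplus>\<^bsub>ind B\<^esub> h) = to_33 f \<oplus>\<^bsub>tabloid_gmodule F2 [3, 3]\<^esub> to_33 h"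
  "to_33 (a \<odot>\<^bsub>ind B\<^esub> f) = a \<odot>\<^bsub>tabloid_gmodule F2 [3, 3]\<^esub> to_33 f"
  by (auto intro!: restrict_ext elim!: tabloidsE
      simp: to_33_def tabloid_row_tabloid hat_simps[OF B row_set_33_triples])

lemma to_33_gact:
  assumes "f \<in> carrier (ind B)" and \<sigma>: "\<sigma> permutes {1..6}"
  shows "to_33 (gact (ind B) \<sigma> f) = gact (tabloid_gmodule F2 [3, 3]) \<sigma> (to_33 f)"
proof (rule extensionalityI[of _ "tabloids [3, 3]"])
  fix T assume "T \<in> tabloids [3, 3]"
  then obtain u where u: "u \<in> tableaux [3, 3]" "T = tabloid [3, 3] u" by (rule tabloidsE)
  have "tableau_act [3, 3] (inv' \<sigma>) u \<in> tableaux [3, 3]"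
    using tableau_act_tableau[OF u(1)] permutes_inv[OF \<sigma>] by simp
  then show "to_33 (gact (ind B) \<sigma> f) T = gact (tabloid_gmodule F2 [3, 3]) \<sigma> (to_33 f) T"
    using u \<sigma> by (simp add: tabloid_gmodule_gact to_33_apply row_set_act hat_gact[OF B assms]
        row_set_33_triples)
qed (auto simp: to_33_def tabloid_gmodule_def)

lemma to_33_eq_0_iff:
  assumes f: "f \<in> carrier (ind B)"
  shows "to_33 f = \<zero>\<^bsub>tabloid_gmodule F2 [3, 3]\<^esub> \<longleftrightarrow> f = \<zero>\<^bsub>ind B\<^esub>"
proof
  interpret group_module F2 "sym_group 6" "ind B :: bit ind_module" by (rule group_module_ind)
  assume 0: "to_33 f = \<zero>\<^bsub>tabloid_gmodule F2 [3, 3]\<^esub>"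
  show "f = \<zero>\<^bsub>ind B\<^esub>"
  proof (rule ind_eqI[OF B f M.zero_closed])
    fix A assume A: "A \<in> triples"
    obtain a b c d e g where en: "A = {a, b, c}" "enumerates a b c d e g"
      using triple_enumerates[OF A] .
    define u where "u = tableau_of_rows [3, 3] [[a, b, c], [d, e, g]]"
    have u: "u \<in> tableaux [3, 3]" unfolding u_def by (rule tableau_of_rows_33[OF en(2)])
    have "row_set [3, 3] u 0 = A"
      unfolding row_set_33(1)[OF u] by (simp add: u_def tableau_of_rows_simps en(1))
    then show "hat B f A = hat B \<zero>\<^bsub>ind B\<^esub> A"
      using fun_cong[OF 0, of "tabloid [3, 3] u"] u A
      by (simp add: to_33_apply hat_simps[OF B] tabloids_def)
  qed
next
  assume "f = \<zero>\<^bsub>ind B\<^esub>"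
  then show "to_33 f = \<zero>\<^bsub>tabloid_gmodule F2 [3, 3]\<^esub>"
    by (auto intro!: restrict_ext elim!: tabloidsE
        simp: to_33_def tabloid_row_tabloid hat_simps[OF B row_set_33_triples])
qed

text \<open>By complementation only the ten triples through 1 matter, that is, the ten edges of the
  complete graph on 2, ..., 6. The five conditions express five of these values by the other five,
  and five is the number of standard tableaux of shape (3,3). It remains to match the ten values
  with a combination of the standard polytabloids.\<close>

lemma to_33_in_specht:
  assumes f: "f \<in> sep_kernel"
  shows "to_33 f \<in> carrier (specht_gmodule F2 [3, 3])"
proof -
  have fc: "f \<in> carrier (ind B)" and sep0: "\<And>y. y \<in> {1..6} \<Longrightarrow> sep B f 1 y = 0"
    using f by (auto simp: sep_kernel_def)
  define F where "F y z = hat B f {1, y, z}" for y z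
  have comm: "F z y = F y z" for y z by (simp add: F_def insert_commute)
  have en: "enumerates 1 2 3 4 5 6"
    by (auto simp: enumerates_def)
  have en': "enumerates 1 3 2 4 5 6" "enumerates 1 4 2 3 5 6" "enumerates 1 5 2 3 4 6"
    "enumerates 1 6 2 3 4 5"
    using en by (simp_all add: enumerates_list add_mset_commute)
  note eqs = sep0[of 2, unfolded sep_enumerates[OF en]] sep0[of 3, unfolded sep_enumerates[OF en'(1)]]
    sep0[of 4, unfolded sep_enumerates[OF en'(2)]] sep0[of 5, unfolded sep_enumerates[OF en'(3)]]
    sep0[of 6, unfolded sep_enumerates[OF en'(4)]]
  have e2: "F 3 4 + F 3 5 + F 3 6 + F 4 5 + F 4 6 + F 5 6 = 0"
    and e3: "F 2 4 + F 2 5 + F 2 6 + F 4 5 + F 4 6 + F 5 6 = 0"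
    and e4: "F 2 3 + F 2 5 + F 2 6 + F 3 5 + F 3 6 + F 5 6 = 0"
    and e5: "F 2 3 + F 2 4 + F 2 6 + F 3 4 + F 3 6 + F 4 6 = 0"
    and e6: "F 2 3 + F 2 4 + F 2 5 + F 3 4 + F 3 5 + F 4 5 = 0"
    using eqs by (simp_all add: F_def)
  have solve: "x = y" if "x + y = 0" for x y :: bit
    using that by (metis add.right_neutral bit_add_cancel(2))
  \<comment> \<open>The equation for y sums the edges that avoid y. In the sum of the equations for
    3, 4, 5, 6 an edge at 2 occurs three times and any other edge twice, so the four edges at 2 add
    up to zero. The same works for the point 3 below.\<close>
  have 26: "F 2 6 = F 2 3 + F 2 4 + F 2 5"
  proof (rule solve)
    have "F 2 6 + (F 2 3 + F 2 4 + F 2 5) =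
      (F 2 4 + F 2 5 + F 2 6 + F 4 5 + F 4 6 + F 5 6) + (F 2 3 + F 2 5 + F 2 6 + F 3 5 + F 3 6 + F 5 6) +
      (F 2 3 + F 2 4 + F 2 6 + F 3 4 + F 3 6 + F 4 6) + (F 2 3 + F 2 4 + F 2 5 + F 3 4 + F 3 5 + F 4 5)"
      by (simp add: ac_simps)
    then show "F 2 6 + (F 2 3 + F 2 4 + F 2 5) = 0" unfolding e3 e4 e5 e6 by simp
  qed
  have 36: "F 3 6 = F 2 3 + F 3 4 + F 3 5"
  proof (rule solve)
    have "F 3 6 + (F 2 3 + F 3 4 + F 3 5) =
      (F 3 4 + F 3 5 + F 3 6 + F 4 5 + F 4 6 + F 5 6) + (F 2 3 + F 2 5 + F 2 6 + F 3 5 + F 3 6 + F 5 6) +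
      (F 2 3 + F 2 4 + F 2 6 + F 3 4 + F 3 6 + F 4 6) + (F 2 3 + F 2 4 + F 2 5 + F 3 4 + F 3 5 + F 4 5)"
      by (simp add: ac_simps)
    then show "F 3 6 + (F 2 3 + F 3 4 + F 3 5) = 0" unfolding e2 e4 e5 e6 by simp
  qed
  have 45: "F 4 5 = F 2 3 + F 2 4 + F 2 5 + F 3 4 + F 3 5"
    by (rule solve) (use e6 in \<open>simp add: ac_simps\<close>)
  have 46: "F 4 6 = F 2 5 + F 3 5 + F 2 3"
    by (rule solve) (use e5 in \<open>simp add: 26 36 ac_simps\<close>)
  have 56: "F 5 6 = F 2 3 + F 2 4 + F 3 4"
    by (rule solve) (use e4 in \<open>simp add: 26 36 ac_simps\<close>)
  define ts where "ts = map (tableau_of_rows [3, 3])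
    [[[1, 2, 3], [4, 5, 6]], [[1, 2, 4], [3, 5, 6]], [[1, 2, 5], [3, 4, 6]],
     [[1, 3, 4], [2, 5, 6]], [[1, 3, 5], [2, 4, 6 :: nat]]]"
  \<comment> \<open>The coefficients are forced, as the standard polytabloids are unitriangular.\<close>
  define cs where "cs = [F 2 3, F 2 4, F 2 5, F 3 4, F 3 5 + F 2 3]"
  have ts: "set ts \<subseteq> tableaux [3, 3]"
    using en by (auto simp: ts_def enumerates_list add_mset_commute intro!: tableau_of_rows_33)
  have len: "length ts = 5" by (simp add: ts_def)
  have in_ts: "ts ! i \<in> tableaux [3, 3]" if "i < 5" for i
    using ts len that nth_mem[of i ts] by auto
  define s where "s A = (\<Sum>i<5. cs ! i * of_bool (transversal (ts ! i) A))" for A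
  have s_block: "s (other_block A) = s A" for A
    unfolding s_def by (rule sum.cong) (simp_all add: transversal_other_block in_ts)
  have sum5: "(\<Sum>i<5. g i) = g 0 + g 1 + g 2 + g 3 + g 4" for g :: "nat \<Rightarrow> bit"
    by (simp add: numeral_eq_Suc One_nat_def)
  have tr: "transversal (tableau_of_rows [3, 3] [[a, b, c], [a', b', c']]) A \<longleftrightarrow>
      (a \<in> A) \<noteq> (a' \<in> A) \<and> (b \<in> A) \<noteq> (b' \<in> A) \<and> (c \<in> A) \<noteq> (c' \<in> A)" for a b c a' b' c' A
    by (simp add: transversal_iff tableau_of_rows_simps)
  have nths: "ts ! 0 = tableau_of_rows [3, 3] [[1, 2, 3], [4, 5, 6]]"
    "ts ! 1 = tableau_of_rows [3, 3] [[1, 2, 4], [3, 5, 6]]"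
    "ts ! 2 = tableau_of_rows [3, 3] [[1, 2, 5], [3, 4, 6]]"
    "ts ! 3 = tableau_of_rows [3, 3] [[1, 3, 4], [2, 5, 6]]"
    "ts ! 4 = tableau_of_rows [3, 3] [[1, 3, 5], [2, 4, 6]]"
    "cs ! 0 = F 2 3" "cs ! 1 = F 2 4" "cs ! 2 = F 2 5" "cs ! 3 = F 3 4" "cs ! 4 = F 3 5 + F 2 3"
    by (simp_all add: ts_def cs_def nth_Cons')
  have Fs: "F 2 3 = s {1, 2, 3}" "F 2 4 = s {1, 2, 4}" "F 2 5 = s {1, 2, 5}" "F 2 6 = s {1, 2, 6}"
    "F 3 4 = s {1, 3, 4}" "F 3 5 = s {1, 3, 5}" "F 3 6 = s {1, 3, 6}" "F 4 5 = s {1, 4, 5}"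
    "F 4 6 = s {1, 4, 6}" "F 5 6 = s {1, 5, 6}"
    unfolding s_def sum5 nths tr by (simp_all add: 26 36 45 46 56 ac_simps)
  have s1: "hat B f A = s A" if "A \<in> triples" "1 \<in> A" for A
  proof -
    have "A \<in> {{1, 2, 3}, {1, 2, 4}, {1, 2, 5}, {1, 2, 6}} \<union>
        {{1, 3, 4}, {1, 3, 5}, {1, 3, 6}, {1, 4, 5}, {1, 4, 6}, {1, 5, 6}}"
      using that unfolding triples_containing[OF en, symmetric] triples_separating[OF en, symmetric]
      by blast
    then show ?thesis
      by (elim UnE insertE emptyE) (simp_all only: Fs[symmetric] F_def)
  qed
  have s: "hat B f A = s A" if "A \<in> triples" for A
  proof (cases "1 \<in> A")
    case False
    then have "hat B f (other_block A) = s (other_block A)"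
      using that by (intro s1 other_block_triples(1)) auto
    then show ?thesis using hat_other_block[OF B fc that] s_block by simp
  qed (use s1 that in auto)
  let ?S = "specht_gmodule F2 [3, 3]"
  have sub: "submodule (carrier ?S) F2 (permutation_gmodule F2 (sym_group (sum_list [3, 3]))
      (tabloids [3, 3]) (\<lambda>\<sigma> T. tableau_act [3, 3] \<sigma> ` T))"
    using specht_submodule unfolding tabloid_gmodule_def .
  have "(\<lambda>T\<in>tabloids [3, 3]. \<Sum>i<5. cs ! i * polytabloid F2 [3, 3] (ts ! i) T) \<in> carrier ?S"
    using polytabloid_in_specht[OF in_ts] by (intro submodule_sum[OF sub]) auto
  moreover have "to_33 f = (\<lambda>T\<in>tabloids [3, 3]. \<Sum>i<5. cs ! i * polytabloid F2 [3, 3] (ts ! i) T)"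
  proof (rule extensionalityI[of _ "tabloids [3, 3]"])
    fix T assume T: "T \<in> tabloids [3, 3]"
    then obtain u where u: "u \<in> tableaux [3, 3]" "T = tabloid [3, 3] u" by (rule tabloidsE)
    have "to_33 f T = s (row_set [3, 3] u 0)"
      using u s row_set_33_triples by (simp add: to_33_apply)
    also have "\<dots> = (\<Sum>i<5. cs ! i * polytabloid F2 [3, 3] (ts ! i) T)"
      unfolding s_def u(2)
      by (rule sum.cong) (simp_all add: polytabloid_33[OF in_ts u(1)] transversal_def)
    finally show "to_33 f T = (\<lambda>T\<in>tabloids [3, 3]. \<Sum>i<5. cs ! i * polytabloid F2 [3, 3] (ts ! i) T) T"
      using T by simp
  qed (auto simp: to_33_def)
  ultimately show ?thesis by simp
qed

text \<open>The transversals of the three columns are closed under complement, so their indicator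
  belongs to the induced module. Four of them contain a. All four avoid the partner of a, and
  exactly two avoid any given point of another column, so every separating sum from a is
  even.\<close>

lemma polytabloid_33_in_image:
  assumes t: "t \<in> tableaux [3, 3]"
  shows "polytabloid F2 [3, 3] t \<in> to_33 ` sep_kernel"
proof -
  define f where "f = unhat B (\<lambda>A. of_bool (transversal t A) :: bit)"
  define a b c a' b' c' where defs: "a = t (0, 0)" "b = t (0, 1)" "c = t (0, 2)"
    "a' = t (1, 0)" "b' = t (1, 1)" "c' = t (1, 2)"
  have en: "enumerates a b c a' b' c'"
    using tableau_33_enumerates[OF t] by (simp add: defs)
  note d = enumerates_distinct[OF en]
  have fc: "f \<in> carrier (ind B)"
    unfolding f_def by (rule unhat_closed[OF B]) (simp add: transversal_other_block[OF t])
  have hat: "hat B f A = of_bool (transversal t A)" if "A \<in> triples" for A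
    using that unfolding f_def by (rule hat_unhat[OF B])
  have ens: "enumerates a b a' c b' c'" "enumerates a c a' b b' c'" "enumerates a a' b c b' c'"
    "enumerates a b' a' b c c'" "enumerates a c' a' b c b'"
    using en by (simp_all add: enumerates_list add_mset_commute)
  have val: "hat B f {a, u, v} = of_bool (transversal t {a, u, v})" if "{u, v} \<subseteq> {b, c, a', b', c'}" "u \<noteq> v" for u v
    by (rule hat) (use that d(1) in \<open>unfold triples_def d(3), auto\<close>)
  have "sep B f a y = 0" if "y \<in> {1..6}" for y
  proof -
    consider "y = a" | "y = b" | "y = c" | "y = a'" | "y = b'" | "y = c'"
      using \<open>y \<in> {1..6}\<close> unfolding d(3) by blast
    then show ?thesis
      by cases (use d(1,2) in \<open>simp_all add: sep_enumerates[OF ens(1)] sep_enumerates[OF ens(2)]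
        sep_enumerates[OF ens(3)] sep_enumerates[OF ens(4)] sep_enumerates[OF ens(5)] val
        transversal_iff defs[symmetric]\<close>)
  qed
  then have "f \<in> sep_kernel" using d(3) by (intro sep_kernelI[OF fc, of a]) auto
  moreover have "polytabloid F2 [3, 3] t = to_33 f"
  proof (rule extensionalityI[of _ "tabloids [3, 3]"])
    show "polytabloid F2 [3, 3] t \<in> extensional (tabloids [3, 3])"
      using polytabloid_closed[of "[3, 3]" t] by (auto simp: PiE_def)
    fix T assume "T \<in> tabloids [3, 3]"
    then obtain u where u: "u \<in> tableaux [3, 3]" "T = tabloid [3, 3] u" by (rule tabloidsE)
    then show "polytabloid F2 [3, 3] t T = to_33 f T"
      using t by (simp add: to_33_apply polytabloid_33 hat row_set_33_triples transversal_def)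
  qed (auto simp: to_33_def)
  ultimately show ?thesis by blast
qed

lemma to_33_image: "to_33 ` sep_kernel = carrier (specht_gmodule F2 [3, 3])"
proof
  show "to_33 ` sep_kernel \<subseteq> carrier (specht_gmodule F2 [3, 3])"
    using to_33_in_specht by blast
  have "submodule (to_33 ` sep_kernel) F2 (tabloid_gmodule F2 [3, 3])"
    by (rule image_submodule[OF group_module_ind group_submodule_sep_kernel module_tabloid_gmodule])
      (simp_all add: to_33_hom to_33_closed del: tabloid_gmodule_simps)
  then show "carrier (specht_gmodule F2 [3, 3]) \<subseteq> to_33 ` sep_kernel"
    by (rule specht_subset) (rule polytabloid_33_in_image)
qed

end

lemma specht_gmodule_simps:
  "\<zero>\<^bsub>specht_gmodule R l\<^esub> = \<zero>\<^bsub>tabloid_gmodule R l\<^esub>"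
  "v \<oplus>\<^bsub>specht_gmodule R l\<^esub> w = v \<oplus>\<^bsub>tabloid_gmodule R l\<^esub> w"
  "a \<odot>\<^bsub>specht_gmodule R l\<^esub> v = a \<odot>\<^bsub>tabloid_gmodule R l\<^esub> v"
  "gact (specht_gmodule R l) g v = gact (tabloid_gmodule R l) g v"
  by (simp_all add: specht_gmodule_def)

section \<open>The filtration with factors \<open>(3,3)\<close> and \<open>(2,1,1,1,1)\<close>\<close>

context
  fixes B :: "nat set"
  assumes B: "B \<in> triples"
begin

text \<open>\<open>Min\<close> and \<open>Max\<close> only serve to name the two points of the first
  row; \<open>sep_commute\<close> makes their order irrelevant.\<close>

definition to_21111 :: "((nat \<Rightarrow> nat) \<Rightarrow> bit) \<Rightarrow> (nat \<times> nat \<Rightarrow> nat) set \<Rightarrow> bit" where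
  "to_21111 f = (\<lambda>T\<in>tabloids l21111. sep B f (Min (tabloid_row l21111 T 0)) (Max (tabloid_row l21111 T 0)))"

lemma to_21111_apply:
  assumes f: "f \<in> carrier (ind B)" and u: "u \<in> tableaux l21111"
  shows "to_21111 f (tabloid l21111 u) = sep B f (u (0, 0)) (u (0, 1))"
proof -
  have mem: "u (0, 0) \<in> {1..6}" "u (0, 1) \<in> {1..6}"
    using enumerates_distinct(3)[OF tableau_21111_enumerates[OF u]] by auto
  have "to_21111 f (tabloid l21111 u) =
      sep B f (min (u (0, 0)) (u (0, 1))) (max (u (0, 0)) (u (0, 1)))"
    using u by (simp add: to_21111_def tabloid_row_tabloid row_set_21111)
  also have "\<dots> = sep B f (u (0, 0)) (u (0, 1))"
    using sep_commute[OF B f mem] by (simp add: min_def max_def)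
  finally show ?thesis .
qed

lemma to_21111_closed: "to_21111 f \<in> carrier (tabloid_gmodule F2 l21111)"
  by (auto simp: to_21111_def)

lemma to_21111_hom:
  "to_21111 (f \<oplus>\<^bsub>ind B\<^esub> h) = to_21111 f \<oplus>\<^bsub>tabloid_gmodule F2 l21111\<^esub> to_21111 h"
  "to_21111 (a \<odot>\<^bsub>ind B\<^esub> f) = a \<odot>\<^bsub>tabloid_gmodule F2 l21111\<^esub> to_21111 f"
  by (auto intro!: restrict_ext simp: to_21111_def sep_add[OF B] sep_smult[OF B])

lemma to_21111_gact:
  assumes f: "f \<in> carrier (ind B)" and \<sigma>: "\<sigma> permutes {1..6}"
  shows "to_21111 (gact (ind B) \<sigma> f) = gact (tabloid_gmodule F2 l21111) \<sigma> (to_21111 f)"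
proof (rule extensionalityI[of _ "tabloids l21111"])
  interpret group_module F2 "sym_group 6" "ind B :: bit ind_module" by (rule group_module_ind)
  have gf: "gact (ind B) \<sigma> f \<in> carrier (ind B)"
    using f \<sigma> by (simp add: gact_closed sym_group_carrier)
  fix T assume "T \<in> tabloids l21111"
  then obtain u where u: "u \<in> tableaux l21111" "T = tabloid l21111 u" by (rule tabloidsE)
  have "tableau_act l21111 (inv' \<sigma>) u \<in> tableaux l21111"
    using tableau_act_tableau[OF u(1)] permutes_inv[OF \<sigma>] by simp
  then show "to_21111 (gact (ind B) \<sigma> f) T = gact (tabloid_gmodule F2 l21111) \<sigma> (to_21111 f) T"
    using u \<sigma> by (simp add: tabloid_gmodule_gact to_21111_apply f gf sep_gact[OF B f \<sigma>] compose_def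
        young_diagram_shapes)
qed (auto simp: to_21111_def tabloid_gmodule_def)

lemma to_21111_eq_0_iff:
  assumes f: "f \<in> carrier (ind B)"
  shows "to_21111 f = \<zero>\<^bsub>tabloid_gmodule F2 l21111\<^esub> \<longleftrightarrow> f \<in> sep_kernel B"
proof
  assume 0: "to_21111 f = \<zero>\<^bsub>tabloid_gmodule F2 l21111\<^esub>"
  have "sep B f x y = 0" if xy: "x \<in> {1..6}" "y \<in> {1..6}" for x y
  proof (cases "x = y")
    case False
    obtain c d e g where en: "enumerates x y c d e g" using ex_enumerates2[OF False xy] .
    define u where "u = tableau_of_rows l21111 [[x, y], [c], [d], [e], [g]]"
    have u: "u \<in> tableaux l21111" unfolding u_def by (rule tableau_of_rows_21111[OF en])
    then show ?thesis
      using fun_cong[OF 0, of "tabloid l21111 u"]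
      by (simp add: to_21111_apply[OF f]) (simp add: u_def tableau_of_rows_simps)
  qed simp
  then show "f \<in> sep_kernel B" using f by (simp add: sep_kernel_def[OF B])
next
  assume k: "f \<in> sep_kernel B"
  show "to_21111 f = \<zero>\<^bsub>tabloid_gmodule F2 l21111\<^esub>"
  proof (rule extensionalityI[of _ "tabloids l21111"])
    fix T assume "T \<in> tabloids l21111"
    then obtain u where u: "u \<in> tableaux l21111" "T = tabloid l21111 u" by (rule tabloidsE)
    then have "u (0, 0) \<in> {1..6}" "u (0, 1) \<in> {1..6}"
      using enumerates_distinct(3)[OF tableau_21111_enumerates[OF u(1)]] by auto
    then show "to_21111 f T = \<zero>\<^bsub>tabloid_gmodule F2 l21111\<^esub> T"
      using k u by (simp add: to_21111_apply[OF f] sep_kernel_def[OF B])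
  qed (auto simp: to_21111_def)
qed

text \<open>The cocycle rule gives sep y z = sep 1 y + sep 1 z. Hence the cocycle is the sum of the
  stars of all points x with coefficients sep 1 x.\<close>

lemma to_21111_in_specht:
  assumes f: "f \<in> carrier (ind B)"
  shows "to_21111 f \<in> carrier (specht_gmodule F2 l21111)"
proof -
  let ?S = "specht_gmodule F2 l21111"
  have "\<exists>t\<in>tableaux l21111. t (0, 1) = x" if x: "x \<in> {1..6}" for x
  proof -
    have "\<exists>y\<in>{1..6}. y \<noteq> x" by (rule bexI[of _ "if x = 1 then 2 else 1"]) auto
    then obtain y where y: "y \<in> {1..6}" "y \<noteq> x" by blast
    obtain c d e g where en: "enumerates y x c d e g" using ex_enumerates2[OF y(2,1) x] .
    show ?thesis
      by (rule bexI[OF _ tableau_of_rows_21111[OF en]]) (simp add: tableau_of_rows_simps)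
  qed
  then obtain t where t: "\<And>x. x \<in> {1..6} \<Longrightarrow> t x \<in> tableaux l21111 \<and> t x (0, 1) = x"
    by metis
  have sub: "submodule (carrier ?S) F2 (permutation_gmodule F2 (sym_group (sum_list l21111))
      (tabloids l21111) (\<lambda>\<sigma> T. tableau_act l21111 \<sigma> ` T))"
    using specht_submodule unfolding tabloid_gmodule_def .
  have "(\<lambda>T\<in>tabloids l21111. \<Sum>x\<in>{1..6}. sep B f 1 x * polytabloid F2 l21111 (t x) T) \<in> carrier ?S"
    using polytabloid_in_specht t by (intro submodule_sum[OF sub]) auto
  moreover have "to_21111 f = (\<lambda>T\<in>tabloids l21111. \<Sum>x\<in>{1..6}. sep B f 1 x * polytabloid F2 l21111 (t x) T)"
  proof (rule extensionalityI[of _ "tabloids l21111"])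
    fix T assume T: "T \<in> tabloids l21111"
    then obtain u where u: "u \<in> tableaux l21111" "T = tabloid l21111 u" by (rule tabloidsE)
    let ?p = "{u (0, 0), u (0, 1)}"
    note en = enumerates_distinct[OF tableau_21111_enumerates[OF u(1)]]
    then have mem: "u (0, 0) \<in> {1..6}" "u (0, 1) \<in> {1..6}" by auto
    have "(\<Sum>x\<in>{1..6}. sep B f 1 x * polytabloid F2 l21111 (t x) T) =
        (\<Sum>x\<in>{1..6}. if x \<in> ?p then sep B f 1 x else 0)"
      using t by (intro sum.cong) (auto simp: u polytabloid_21111 row_set_21111)
    also have "\<dots> = (\<Sum>x\<in>{1..6} \<inter> ?p. sep B f 1 x)"
      by (rule sum.inter_restrict[symmetric]) simp
    also have "{1..6} \<inter> ?p = ?p" using mem by blast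
    also have "(\<Sum>x\<in>?p. sep B f 1 x) = sep B f 1 (u (0, 0)) + sep B f 1 (u (0, 1))"
      using en(1) by simp
    also have "\<dots> = sep B f (u (0, 0)) (u (0, 1))"
      using sep_cocycle[OF B f mem(1) _ mem(2), of 1] sep_commute[OF B f mem(1), of 1] by simp
    finally show "to_21111 f T = (\<lambda>T\<in>tabloids l21111. \<Sum>x\<in>{1..6}. sep B f 1 x * polytabloid F2 l21111 (t x) T) T"
      using T u to_21111_apply[OF f] by simp
  qed (auto simp: to_21111_def)
  ultimately show ?thesis by simp
qed

text \<open>The witness is supported on the triples {x,a,b}, {x,a,c}, {x,b,c} and their complements.
  Exactly one of these three avoids a given point among a, b, c, and all three avoid d and e, so
  every separating sum from x is odd. The cocycle rule then yields the star of x.\<close>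

lemma polytabloid_21111_in_image:
  assumes t: "t \<in> tableaux l21111"
  shows "polytabloid F2 l21111 t \<in> to_21111 ` carrier (ind B)"
proof -
  define x a b c d e where defs: "x = t (0, 1)" "a = t (0, 0)" "b = t (1, 0)" "c = t (2, 0)"
    "d = t (3, 0)" "e = t (4, 0)"
  have en: "enumerates x a b c d e"
    using tableau_21111_enumerates[OF t] by (simp add: defs enumerates_list add_mset_commute)
  note dis = enumerates_distinct[OF en]
  define P where "P A \<longleftrightarrow> (if x \<in> A then A \<subseteq> {x, a, b, c} else other_block A \<subseteq> {x, a, b, c})" for A
  define f where "f = unhat B (\<lambda>A. of_bool (P A) :: bit)"
  have x: "x \<in> {1..6}" using dis(3) by auto
  have fc: "f \<in> carrier (ind B)"
    unfolding f_def using x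
    by (intro unhat_closed[OF B]) (auto simp: P_def other_block_triples simp del: atLeastAtMost_iff)
  have ens: "enumerates x b a c d e" "enumerates x c a b d e" "enumerates x d a b c e"
    "enumerates x e a b c d"
    using en by (simp_all add: enumerates_list add_mset_commute)
  have val: "hat B f {x, u, v} = of_bool ({u, v} \<subseteq> {a, b, c})"
    if "{u, v} \<subseteq> {a, b, c, d, e}" "u \<noteq> v" for u v
  proof -
    have "{x, u, v} \<in> triples"
      using that dis(1) unfolding triples_def dis(3) by auto
    from hat_unhat[OF B this, of "\<lambda>A. of_bool (P A)"] show ?thesis
      using that dis(1,2) unfolding f_def P_def by auto
  qed
  have sx: "sep B f x y = 1" if y: "y \<in> {1..6}" "y \<noteq> x" for y
  proof -
    consider "y = a" | "y = b" | "y = c" | "y = d" | "y = e"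
      using y unfolding dis(3) by blast
    then show ?thesis
      by cases (use dis(1,2) in \<open>simp_all add: sep_enumerates[OF B en] sep_enumerates[OF B ens(1)]
        sep_enumerates[OF B ens(2)] sep_enumerates[OF B ens(3)] sep_enumerates[OF B ens(4)] val\<close>)
  qed
  have "polytabloid F2 l21111 t = to_21111 f"
  proof (rule extensionalityI[of _ "tabloids l21111"])
    show "polytabloid F2 l21111 t \<in> extensional (tabloids l21111)"
      using polytabloid_closed[of l21111 t] by (auto simp: PiE_def)
    fix T assume "T \<in> tabloids l21111"
    then obtain u where u: "u \<in> tableaux l21111" "T = tabloid l21111 u" by (rule tabloidsE)
    note en' = enumerates_distinct[OF tableau_21111_enumerates[OF u(1)]]
    then have mem: "u (0, 0) \<in> {1..6}" "u (0, 1) \<in> {1..6}" "u (0, 0) \<noteq> u (0, 1)" by auto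
    have "sep B f (u (0, 0)) (u (0, 1)) = sep B f x (u (0, 0)) + sep B f x (u (0, 1))"
      using sep_cocycle[OF B fc mem(1) x mem(2)] sep_commute[OF B fc mem(1) x] by simp
    also have "\<dots> = of_bool (x \<in> {u (0, 0), u (0, 1)})"
      using sx mem by (cases "u (0, 0) = x"; cases "u (0, 1) = x") auto
    finally show "polytabloid F2 l21111 t T = to_21111 f T"
      using t u by (simp add: to_21111_apply[OF fc] polytabloid_21111 row_set_21111 defs(1))
  qed (auto simp: to_21111_def)
  then show ?thesis using fc by blast
qed

lemma to_21111_image: "to_21111 ` carrier (ind B) = carrier (specht_gmodule F2 l21111)"
proof
  interpret group_module F2 "sym_group 6" "ind B :: bit ind_module" by (rule group_module_ind)
  show "to_21111 ` carrier (ind B) \<subseteq> carrier (specht_gmodule F2 l21111)"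
    using to_21111_in_specht by blast
  have "group_submodule F2 (sym_group 6) (ind B :: bit ind_module) (carrier (ind B))"
    by (simp add: group_submodule_def carrier_is_submodule gact_closed)
  then have "submodule (to_21111 ` carrier (ind B)) F2 (tabloid_gmodule F2 l21111)"
    by (rule image_submodule[OF group_module_ind _ module_tabloid_gmodule])
      (simp_all add: to_21111_hom to_21111_closed del: tabloid_gmodule_simps)
  then show "carrier (specht_gmodule F2 l21111) \<subseteq> to_21111 ` carrier (ind B)"
    by (rule specht_subset) (rule polytabloid_21111_in_image)
qed

text \<open>The indicator of the partition into \<open>B\<close> and its complement. It shows that
  the kernel of the cocycle map is proper, and it later refutes the forbidden filtration.\<close>

lemma unhat_block:
  defines "f \<equiv> unhat B (\<lambda>A. of_bool (A = B \<or> A = other_block B) :: 'a::field)"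
  shows "f \<in> carrier (ind B)" "A \<in> triples \<Longrightarrow> hat B f A = of_bool (A = B \<or> A = other_block B)"
    "x \<in> B \<Longrightarrow> y \<in> B \<Longrightarrow> sep B f x y = 0" "x \<in> B \<Longrightarrow> y \<notin> B \<Longrightarrow> sep B f x y = 1"
proof -
  have swap: "other_block A = Y \<longleftrightarrow> A = other_block Y" if "A \<in> triples" "Y \<in> triples" for A Y
    using other_block_triples(2)[OF that(1)] other_block_triples(2)[OF that(2)] by metis
  show "f \<in> carrier (ind B)"
    unfolding f_def
    by (rule unhat_closed[OF B])
      (auto simp only: swap B other_block_triples(1,2) of_bool_eq_iff)
  show hat: "hat B f A = of_bool (A = B \<or> A = other_block B)" if "A \<in> triples" for A
    unfolding f_def by (rule hat_unhat[OF B that])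
  show "sep B f x y = 0" if "x \<in> B" "y \<in> B"
    unfolding sep_def by (rule sum.neutral) (use that hat in auto)
  show "sep B f x y = 1" if xy: "x \<in> B" "y \<notin> B"
  proof -
    have "sep B f x y = (\<Sum>A | A \<in> triples \<and> x \<in> A \<and> y \<notin> A. if A = B then 1 else 0)"
      unfolding sep_def using that hat by (intro sum.cong) auto
    then show ?thesis using B xy finite_triples by simp
  qed
qed

lemma ind_specht_filtration:
  "specht_filtration F2 6 (ind B) [{\<zero>\<^bsub>ind B\<^esub>}, sep_kernel B, carrier (ind B)] [[3, 3], l21111]"
proof -
  let ?M = "ind B :: bit ind_module"
  interpret group_module F2 "sym_group 6" ?M by (rule group_module_ind)
  have M: "group_submodule F2 (sym_group 6) ?M (carrier ?M)"
    by (simp add: group_submodule_def carrier_is_submodule gact_closed)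
  note K = group_submodule_sep_kernel[OF B]
  have "gact ?M g \<zero>\<^bsub>?M\<^esub> = \<zero>\<^bsub>?M\<^esub>" if "g \<in> carrier (sym_group 6)" for g
    using gact_smult[OF that, of "\<zero>\<^bsub>F2\<^esub>" "\<zero>\<^bsub>?M\<^esub>"] gact_closed[OF that]
    by (simp del: type_ring_simps)
  moreover have "submodule {\<zero>\<^bsub>?M\<^esub>} F2 ?M" by (rule submoduleI') auto
  ultimately have Z: "group_submodule F2 (sym_group 6) ?M {\<zero>\<^bsub>?M\<^esub>}"
    by (simp add: group_submodule_def)
  note Kc = group_submodule_closed[OF K]
  have S: "abelian_group (specht_gmodule F2 l)" for l
    using module_specht unfolding module_def by blast
  have iso1: "gmodule_isomorphic F2 (sym_group 6) (quotient_gmodule (?M\<lparr>carrier := sep_kernel B\<rparr>) {\<zero>\<^bsub>?M\<^esub>})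
      (specht_gmodule F2 [3, 3])"
    using Kc(1,2) by (intro quotient_isomorphicI[OF Z K _ S, of "to_33 B"])
      (auto simp: specht_gmodule_simps to_33_hom[OF B] to_33_gact[OF B] to_33_image[OF B]
        to_33_eq_0_iff[OF B] sym_group_carrier subset_iff simp del: tabloid_gmodule_simps)
  have iso2: "gmodule_isomorphic F2 (sym_group 6) (quotient_gmodule (?M\<lparr>carrier := carrier ?M\<rparr>) (sep_kernel B))
      (specht_gmodule F2 l21111)"
    using Kc(1,2) by (intro quotient_isomorphicI[OF K M _ S, of to_21111])
      (auto simp: specht_gmodule_simps to_21111_hom to_21111_gact to_21111_image
        to_21111_eq_0_iff sym_group_carrier subset_iff simp del: tabloid_gmodule_simps)
  have strict1: "{\<zero>\<^bsub>?M\<^esub>} \<subset> sep_kernel B"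
  proof -
    \<comment> \<open>Each separating sum has six terms, so the constant function 1 lies in the
      kernel.\<close>
    define f where "f = unhat B (\<lambda>A. 1 :: bit)"
    have fc: "f \<in> carrier ?M" unfolding f_def by (rule unhat_closed[OF B]) simp
    have hat: "hat B f A = 1" if "A \<in> triples" for A
      unfolding f_def by (rule hat_unhat[OF B that])
    have "sep B f x y = 0" if xy: "x \<in> {1..6}" "y \<in> {1..6}" for x y
    proof (cases "x = y")
      case False
      obtain c d e g where en: "enumerates x y c d e g" using ex_enumerates2[OF False xy] .
      have "sep B f x y = (\<Sum>A | A \<in> triples \<and> x \<in> A \<and> y \<notin> A. 1)"
        unfolding sep_def by (rule sum.cong) (simp_all add: hat)
      also have "\<dots> = 0" unfolding sum_triples_separating[OF en] by simp
      finally show ?thesis .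
    qed simp
    then have "f \<in> sep_kernel B" using fc by (simp add: sep_kernel_def[OF B])
    moreover have "f \<noteq> \<zero>\<^bsub>?M\<^esub>"
      using hat[OF B] hat_simps(1)[OF B B, where 'a = bit] by auto
    ultimately show ?thesis using Kc(2) by blast
  qed
  have strict2: "sep_kernel B \<subset> carrier ?M"
  proof -
    obtain a b c d e f where B': "B = {a, b, c}" "enumerates a b c d e f"
      using triple_enumerates[OF B] .
    note dis = enumerates_distinct[OF B'(2)]
    have "sep B (unhat B (\<lambda>A. of_bool (A = B \<or> A = other_block B) :: bit)) a d = 1"
      using dis(1,2) by (intro unhat_block(4)) (auto simp: B'(1))
    moreover have "a \<in> {1..6}" "d \<in> {1..6}" using dis(3) by auto
    ultimately have "unhat B (\<lambda>A. of_bool (A = B \<or> A = other_block B) :: bit) \<notin> sep_kernel B"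
      by (auto simp: sep_kernel_def[OF B] simp del: atLeastAtMost_iff)
    then show ?thesis using unhat_block(1)[where 'a = bit] Kc(1) by blast
  qed
  have "\<forall>i<2. [{\<zero>\<^bsub>?M\<^esub>}, sep_kernel B, carrier ?M] ! i \<subset> [{\<zero>\<^bsub>?M\<^esub>}, sep_kernel B, carrier ?M] ! Suc i \<and>
      gmodule_isomorphic F2 (sym_group 6)
        (quotient_gmodule (?M\<lparr>carrier := [{\<zero>\<^bsub>?M\<^esub>}, sep_kernel B, carrier ?M] ! Suc i\<rparr>)
          ([{\<zero>\<^bsub>?M\<^esub>}, sep_kernel B, carrier ?M] ! i))
        (specht_gmodule F2 ([[3, 3], l21111] ! i))" (is "\<forall>i<2. ?P i")
  proof (intro allI impI)
    fix i :: nat assume "i < 2"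
    then consider "i = 0" | "i = Suc 0" by linarith
    then show "?P i"
      by cases (use iso1 iso2 strict1 strict2 in simp_all)
  qed
  then show ?thesis
    using Z K M group_module_axioms
    by (simp add: specht_filtration_def is_partition_of_def numeral_2_eq_2)
qed

end

section \<open>No filtration with factors \<open>(6)\<close> and \<open>(4,2)\<close>\<close>

lemma polytabloid_42_gact:
  assumes t: "t \<in> tableaux [4, 2]" and \<sigma>: "\<sigma> permutes {1..6}"
  shows "gact (tabloid_gmodule ring_of_type_algebra [4, 2]) \<sigma> (polytabloid ring_of_type_algebra [4, 2] t) =
    (polytabloid ring_of_type_algebra [4, 2] (tableau_act [4, 2] \<sigma> t) :: _ \<Rightarrow> 'a::field)"
proof (rule extensionalityI[of _ "tabloids [4, 2]"])
  show "(polytabloid ring_of_type_algebra [4, 2] (tableau_act [4, 2] \<sigma> t) :: _ \<Rightarrow> 'a)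
      \<in> extensional (tabloids [4, 2])"
    using polytabloid_closed[where 'a = 'a, of "[4, 2]" "tableau_act [4, 2] \<sigma> t"] by (auto simp: PiE_def)
  fix T assume "T \<in> tabloids [4, 2]"
  then obtain u where u: "u \<in> tableaux [4, 2]" "T = tabloid [4, 2] u" by (rule tabloidsE)
  have act: "tableau_act [4, 2] (inv' \<sigma>) u \<in> tableaux [4, 2]" "tableau_act [4, 2] \<sigma> t \<in> tableaux [4, 2]"
    using tableau_act_tableau[OF u(1)] tableau_act_tableau[OF t] permutes_inv[OF \<sigma>] \<sigma> by simp_all
  have "inv' \<sigma> ` S = {x, y} \<longleftrightarrow> S = {\<sigma> x, \<sigma> y}" for S x y
  proof -
    have "inv' \<sigma> ` S = {x, y} \<longleftrightarrow> \<sigma> ` inv' \<sigma> ` S = \<sigma> ` {x, y}"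
      by (rule inj_image_eq_iff[OF permutes_inj[OF \<sigma>], symmetric])
    then show ?thesis by (simp add: image_comp permutes_inv_o(1)[OF \<sigma>])
  qed
  then have row: "row_set [4, 2] (tableau_act [4, 2] (inv' \<sigma>) u) 1 = {x, y} \<longleftrightarrow>
      row_set [4, 2] u 1 = {\<sigma> x, \<sigma> y}" for x y
    unfolding row_set_act .
  have val: "tableau_act [4, 2] \<sigma> t (0, 0) = \<sigma> (t (0, 0))" "tableau_act [4, 2] \<sigma> t (0, 1) = \<sigma> (t (0, 1))"
    "tableau_act [4, 2] \<sigma> t (1, 0) = \<sigma> (t (1, 0))" "tableau_act [4, 2] \<sigma> t (1, 1) = \<sigma> (t (1, 1))"
    by (simp_all add: compose_def young_diagram_shapes)
  have \<sigma>': "\<sigma> permutes {1..sum_list [4, 2]}" using \<sigma> by simp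
  show "gact (tabloid_gmodule ring_of_type_algebra [4, 2]) \<sigma> (polytabloid ring_of_type_algebra [4, 2] t) T =
      (polytabloid ring_of_type_algebra [4, 2] (tableau_act [4, 2] \<sigma> t) T :: 'a)"
    unfolding u(2) tabloid_gmodule_gact[OF \<sigma>' u(1)] polytabloid_42[OF t act(1)]
      polytabloid_42[OF act(2) u(1)] row val by (rule refl)
qed (simp add: tabloid_gmodule_def)

text \<open>There is only one tabloid of shape (6).\<close>

lemma tabloid_6_gact:
  assumes s: "s \<in> carrier (tabloid_gmodule R [6])" and \<sigma>: "\<sigma> permutes {1..6}"
  shows "gact (tabloid_gmodule R [6]) \<sigma> s = s"
proof (rule extensionalityI[of _ "tabloids [6]"])
  fix T assume "T \<in> tabloids [6]"
  then obtain u where u: "u \<in> tableaux [6]" "T = tabloid [6] u" by (rule tabloidsE)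
  have row: "row_set [6] v i = (if i = 0 then {1..6} else {})" if "v \<in> tableaux [6]" for v i
  proof -
    have "row_set [6] v 0 = v ` young_diagram [6]" by (auto simp: row_set_def young_diagram_def)
    moreover have "row_set [6] v i = {}" if "i \<noteq> 0"
      using that by (auto simp: row_set_def young_diagram_def)
    ultimately show ?thesis using tableau_image[OF that] by simp
  qed
  have act: "tableau_act [6] (inv' \<sigma>) u \<in> tableaux [6]"
    using tableau_act_tableau[OF u(1)] permutes_inv[OF \<sigma>] by simp
  then have "tabloid [6] (tableau_act [6] (inv' \<sigma>) u) = tabloid [6] u"
    using u(1) by (simp add: tabloid_eq_iff row)
  then show "gact (tabloid_gmodule R [6]) \<sigma> s T = s T"
    using u \<sigma> by (simp add: tabloid_gmodule_gact)
qed (use s in \<open>auto simp: tabloid_gmodule_def PiE_def\<close>)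

text \<open>Rotating the four-cycle by one step permutes its edges. It reverses the signs, which
  makes no difference over F2.\<close>

lemma polytabloid_42_rotate:
  assumes t: "t \<in> tableaux [4, 2]" and t': "t' \<in> tableaux [4, 2]"
    and "t' (1, 0) = t (1, 1)" "t' (1, 1) = t (0, 0)" "t' (0, 0) = t (0, 1)" "t' (0, 1) = t (1, 0)"
  shows "polytabloid F2 [4, 2] t' = polytabloid F2 [4, 2] t"
proof (rule extensionalityI[of _ "tabloids [4, 2]"])
  fix T assume "T \<in> tabloids [4, 2]"
  then obtain u where u: "u \<in> tableaux [4, 2]" "T = tabloid [4, 2] u" by (rule tabloidsE)
  show "polytabloid F2 [4, 2] t' T = polytabloid F2 [4, 2] t T"
    unfolding u(2) polytabloid_42[OF t u(1)] polytabloid_42[OF t' u(1)] assms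
    by (simp add: insert_commute ac_simps)
qed (use polytabloid_closed[of "[4, 2]"] in \<open>auto simp: PiE_def\<close>)

text \<open>The three four-cycles on four points cover every edge of the complete graph twice.\<close>

lemma polytabloid_42_three_cycles:
  assumes t: "t \<in> tableaux [4, 2]" and t': "t' \<in> tableaux [4, 2]" and t'': "t'' \<in> tableaux [4, 2]"
    and "t' (1, 0) = t (1, 0)" "t' (1, 1) = t (0, 0)" "t' (0, 0) = t (0, 1)" "t' (0, 1) = t (1, 1)"
    and "t'' (1, 0) = t (1, 0)" "t'' (1, 1) = t (0, 1)" "t'' (0, 0) = t (1, 1)" "t'' (0, 1) = t (0, 0)"
    and T: "T \<in> tabloids [4, 2]"
  shows "polytabloid F2 [4, 2] t T + polytabloid F2 [4, 2] t' T + polytabloid F2 [4, 2] t'' T = 0"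
proof -
  obtain u where u: "u \<in> tableaux [4, 2]" "T = tabloid [4, 2] u" using T by (rule tabloidsE)
  show ?thesis
    unfolding u(2) polytabloid_42[OF t u(1)] polytabloid_42[OF t' u(1)] polytabloid_42[OF t'' u(1)] assms
    by (simp add: insert_commute ac_simps)
qed

context
  fixes B :: "nat set"
  assumes B: "B \<in> triples"
begin

interpretation ind: group_module F2 "sym_group 6" "ind B :: bit ind_module"
  by (rule group_module_ind)

lemma ind_diff_add:
  "v \<in> carrier (ind B) \<Longrightarrow> w \<in> carrier (ind B) \<Longrightarrow> v = (v \<ominus>\<^bsub>ind B :: bit ind_module\<^esub> w) \<oplus>\<^bsub>ind B\<^esub> w"
  by (simp add: a_minus_def ind.M.a_assoc ind.M.l_neg)

text \<open>This expresses that the Specht module has no nonzero map to the cocycles. It is stated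
  for a submodule \<open>V\<close> mapped onto the Specht module with kernel inside
  \<open>sep_kernel\<close>, so that it applies both when this factor is at the bottom and when it
  is on top.\<close>

lemma specht_42_quotient_in_sep_kernel:
  assumes V: "group_submodule F2 (sym_group 6) (ind B) V"
    and add: "\<And>v w. v \<in> V \<Longrightarrow> w \<in> V \<Longrightarrow> \<theta> (v \<oplus>\<^bsub>ind B\<^esub> w) = \<theta> v \<oplus>\<^bsub>tabloid_gmodule F2 [4, 2]\<^esub> \<theta> w"
    and smult: "\<And>a v. v \<in> V \<Longrightarrow> \<theta> (a \<odot>\<^bsub>ind B\<^esub> v) = a \<odot>\<^bsub>tabloid_gmodule F2 [4, 2]\<^esub> \<theta> v"
    and gact: "\<And>\<sigma> v. \<sigma> permutes {1..6} \<Longrightarrow> v \<in> V \<Longrightarrow>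
      \<theta> (gact (ind B) \<sigma> v) = gact (tabloid_gmodule F2 [4, 2]) \<sigma> (\<theta> v)"
    and onto: "\<theta> ` V = carrier (specht_gmodule F2 [4, 2])"
    and ker: "\<And>v w. v \<in> V \<Longrightarrow> w \<in> V \<Longrightarrow> \<theta> v = \<theta> w \<Longrightarrow> v \<ominus>\<^bsub>ind B\<^esub> w \<in> sep_kernel B"
  shows "V \<subseteq> sep_kernel B"
proof -
  note c = ind.group_submodule_closed[OF V]
  note K = group_submodule_sep_kernel[OF B]
  note k = ind.group_submodule_closed[OF K]
  have car: "v \<in> carrier (ind B)" if "v \<in> V" for v using that c(1) by blast
  \<comment> \<open>The cocycle of a preimage depends only on its image under
    \<open>\<theta>\<close>. This is the homomorphism from the Specht module to the cocycles,
    without a name.\<close>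
  have sep_eq: "sep B v x y = sep B w x y"
    if vw: "v \<in> V" "w \<in> V" "\<theta> v = \<theta> w" and xy: "x \<in> {1..6}" "y \<in> {1..6}" for v w x y
  proof -
    have "sep B v x y = sep B (v \<ominus>\<^bsub>ind B\<^esub> w) x y + sep B w x y"
      using arg_cong[OF ind_diff_add[OF car[OF vw(1)] car[OF vw(2)]], of "\<lambda>v. sep B v x y"]
      by (simp add: sep_add[OF B])
    then show ?thesis using ker[OF vw] xy by (simp add: sep_kernel_def[OF B])
  qed
  have key: "f \<in> sep_kernel B" if f: "f \<in> V" and \<theta>f: "\<theta> f = polytabloid F2 [4, 2] t"
    and t: "t \<in> tableaux [4, 2]" for f t
  proof -
    define a b c d e g where defs: "a = t (0, 0)" "b = t (0, 1)" "c = t (0, 2)" "d = t (0, 3)"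
      "e = t (1, 0)" "g = t (1, 1)"
    have en: "distinct [a, b, c, d, e, g]" "distinct [g, e, d, c, b, a]" "{1..6} = {a, b, c, d, e, g}"
      using enumerates_distinct[OF tableau_42_enumerates[OF t]] by (simp_all add: defs)
    have mem: "a \<in> {1..6}" "b \<in> {1..6}" "c \<in> {1..6}" "d \<in> {1..6}" "e \<in> {1..6}" "g \<in> {1..6}"
      unfolding en(3) by simp_all
    \<comment> \<open>\<open>\<tau>\<close> is the three-cycle g to a to b to g. It fixes e and
      permutes the three four-cycles on a, b, e, g. \<open>\<rho>\<close> rotates the given
      four-cycle, e to g to a to b to e. Both fix c and d.\<close>
    define \<tau> where "\<tau> = transpose g a \<circ> transpose a b"
    define \<rho> where "\<rho> = transpose e g \<circ> \<tau>"
    have \<tau>: "\<tau> permutes {1..6}"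
      unfolding \<tau>_def by (intro permutes_compose permutes_swap_id mem)
    have \<rho>: "\<rho> permutes {1..6}"
      unfolding \<rho>_def by (intro permutes_compose permutes_swap_id mem \<tau>)
    have \<tau>v: "\<tau> g = a" "\<tau> a = b" "\<tau> b = g" "\<tau> c = c" "\<tau> d = d" "\<tau> e = e"
      using en(1,2) by (simp_all add: \<tau>_def)
    have \<rho>v: "\<rho> e = g" "\<rho> g = a" "\<rho> a = b" "\<rho> b = e" "\<rho> c = c" "\<rho> d = d"
      using en(1,2) \<tau>v by (simp_all add: \<rho>_def)
    have act: "tableau_act [4, 2] \<sigma> t \<in> tableaux [4, 2]" if "\<sigma> permutes {1..6}" for \<sigma>
      using tableau_act_tableau[OF t] that by simp
    have actv: "tableau_act [4, 2] \<sigma> s p = \<sigma> (s p)" if "p \<in> {(0, 0), (0, 1), (1, 0), (1, 1)}" for \<sigma> s p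
      using that by (auto simp: compose_def young_diagram_shapes)
    have inv: "inv' \<sigma> x = y" if "\<sigma> permutes {1..6}" "\<sigma> y = x" for \<sigma> x y
      using that permutes_inverses(2)[OF that(1)] by metis
    have gV: "gact (ind B) \<sigma> v \<in> V" if "\<sigma> permutes {1..6}" "v \<in> V" for \<sigma> v
      using c(6) that by (simp add: sym_group_carrier)
    have \<theta>g: "\<theta> (gact (ind B) \<sigma> f) = polytabloid F2 [4, 2] (tableau_act [4, 2] \<sigma> t)"
      if "\<sigma> permutes {1..6}" for \<sigma>
      using that f t by (simp add: gact \<theta>f polytabloid_42_gact)
    have "polytabloid F2 [4, 2] (tableau_act [4, 2] \<rho> t) = polytabloid F2 [4, 2] t"
      by (rule polytabloid_42_rotate[OF t act[OF \<rho>]]) (simp_all add: actv defs[symmetric] \<rho>v)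
    then have "\<theta> (gact (ind B) \<rho> f) = \<theta> f" by (simp add: \<theta>g[OF \<rho>] \<theta>f)
    note rot_eq = sep_eq[OF gV[OF \<rho> f] f this]
    have rot: "sep B f z x = sep B f z (\<rho> x)" if "x \<in> {1..6}" "z \<in> {1..6}" "\<rho> z = z" for x z
      using that rot_eq[of z "\<rho> x"] inv[OF \<rho>, of x "\<rho> x"] inv[OF \<rho>, of z z] permutes_in_image[OF \<rho>, of x]
      by (simp add: sep_gact[OF B car[OF f] \<rho>])
    define h where "h = gact (ind B) \<tau> f"
    define h' where "h' = gact (ind B) (\<tau> \<circ> \<tau>) f"
    have \<tau>\<tau>: "\<tau> \<circ> \<tau> permutes {1..6}" by (rule permutes_compose[OF \<tau> \<tau>])
    have hV: "h \<in> V" "h' \<in> V" unfolding h_def h'_def by (rule gV[OF \<tau> f], rule gV[OF \<tau>\<tau> f])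
    \<comment> \<open>The three translates lie over the three four-cycles on the same points, so
      \<open>\<theta>\<close> sends their sum to zero.\<close>
    let ?w = "f \<oplus>\<^bsub>ind B\<^esub> h \<oplus>\<^bsub>ind B\<^esub> h'"
    have w: "?w \<in> V" using f hV c(3) by blast
    have "polytabloid F2 [4, 2] t T + polytabloid F2 [4, 2] (tableau_act [4, 2] \<tau> t) T
        + polytabloid F2 [4, 2] (tableau_act [4, 2] (\<tau> \<circ> \<tau>) t) T = 0" if "T \<in> tabloids [4, 2]" for T
      by (rule polytabloid_42_three_cycles[OF t act[OF \<tau>] act[OF \<tau>\<tau>] _ _ _ _ _ _ _ _ that])
        (simp_all add: actv defs[symmetric] \<tau>v)
    then have "\<theta> ?w = (\<lambda>T\<in>tabloids [4, 2]. 0)"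
      using f hV c(3) by (auto simp: add \<theta>f \<theta>g[OF \<tau>] \<theta>g[OF \<tau>\<tau>] h_def h'_def)
    also have "\<dots> = \<theta> \<zero>\<^bsub>ind B\<^esub>"
      using smult[OF c(2), of 0] ind.smult_l_null[OF ind.M.zero_closed] by simp
    finally have "sep B ?w z e = sep B \<zero>\<^bsub>ind B :: bit ind_module\<^esub> z e" if "z \<in> {1..6}" for z
      using sep_eq[OF w c(2)] that mem(5) by blast
    then have sum0: "sep B f z e + sep B h z e + sep B h' z e = 0" if "z \<in> {1..6}" for z
      using that k(2) mem(5) by (simp add: sep_add[OF B] sep_kernel_def[OF B])
    \<comment> \<open>As \<open>\<tau>\<close> fixes both z and e, the three terms of
      \<open>sum0\<close> are equal, and three times a bit is that bit. This is why e is kept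
      fixed.\<close>
    have ze: "sep B f z e = 0" if z: "z \<in> {1..6}" "\<tau> z = z" for z
    proof -
      have "sep B h z e = sep B f z e" "sep B h' z e = sep B f z e"
        using inv[OF \<tau>, of z z] inv[OF \<tau>, of e e] inv[OF \<tau>\<tau>, of z z] inv[OF \<tau>\<tau>, of e e] z \<tau>v
        by (simp_all add: h_def h'_def sep_gact[OF B car[OF f] \<tau>] sep_gact[OF B car[OF f] \<tau>\<tau>])
      then show ?thesis using sum0[OF z(1)] by simp
    qed
    have za: "sep B f z x = 0" if "z = c \<or> z = d" "x \<in> {a, b, e, g}" for x z
      using that ze[of z] rot[of e z] rot[of g z] rot[of a z] mem \<tau>v \<rho>v by auto
    \<comment> \<open>The value between the two points off the cycle is all that is missing from the
      base point c; the cocycle rule computes it through e.\<close>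
    have "sep B f c d = 0"
      using sep_cocycle[OF B car[OF f] mem(3,5,4)] za[of c e] za[of d e]
        sep_commute[OF B car[OF f] mem(4,5)] by simp
    then show ?thesis
      using za en(3) by (intro sep_kernelI[OF B car[OF f] mem(3)]) auto
  qed
  \<comment> \<open>By \<open>key\<close> the image of \<open>?W\<close> contains the polytabloids,
    hence it is the whole Specht module. So every element of \<open>V\<close> differs from one of
    \<open>?W\<close> by an element with zero image, which lies in \<open>sep_kernel\<close> as
    well.\<close>
  let ?W = "V \<inter> sep_kernel B"
  have "submodule ?W F2 (ind B)"
    using ind.submodule_Inter[of "{V, sep_kernel B}"] V K by (auto simp: group_submodule_def)
  then have W: "group_submodule F2 (sym_group 6) (ind B) ?W"
    using c(6) k(6) by (simp add: group_submodule_def)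
  have "\<theta> v \<in> carrier (tabloid_gmodule F2 [4, 2])" if "v \<in> V" for v
    using onto that ind.submoduleE(1) module.submoduleE(1)[OF module_tabloid_gmodule specht_submodule] by blast
  then have "submodule (\<theta> ` ?W) F2 (tabloid_gmodule F2 [4, 2])"
    by (intro image_submodule[OF group_module_ind W module_tabloid_gmodule])
      (simp_all add: add smult del: tabloid_gmodule_simps)
  moreover have "polytabloid F2 [4, 2] t \<in> \<theta> ` ?W" if "t \<in> tableaux [4, 2]" for t
  proof -
    have "polytabloid F2 [4, 2] t \<in> \<theta> ` V" unfolding onto by (rule polytabloid_in_specht[OF that])
    then obtain f where "f \<in> V" "\<theta> f = polytabloid F2 [4, 2] t" by auto
    then show ?thesis using key that by (metis IntI image_eqI)
  qed
  ultimately have sub: "carrier (specht_gmodule F2 [4, 2]) \<subseteq> \<theta> ` ?W" by (rule specht_subset)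
  show ?thesis
  proof
    fix v assume v: "v \<in> V"
    then have "\<theta> v \<in> \<theta> ` ?W" using sub onto by blast
    then obtain w where w: "w \<in> V" "w \<in> sep_kernel B" "\<theta> v = \<theta> w" by auto
    then have "(v \<ominus>\<^bsub>ind B\<^esub> w) \<oplus>\<^bsub>ind B\<^esub> w \<in> sep_kernel B" using k(3) ker v by blast
    then show "v \<in> sep_kernel B" using ind_diff_add[OF car[OF v] car[OF w(1)]] by simp
  qed
qed

lemma ind_no_specht_filtration:
  "\<not> has_specht_filtration_with_factors F2 6 (ind B :: bit ind_module) {#[6], [4, 2]#}"
proof
  let ?M = "ind B :: bit ind_module"
  assume "has_specht_filtration_with_factors F2 6 ?M {#[6], [4, 2]#}"
  then obtain Us ls where filt: "specht_filtration F2 6 ?M Us ls" and ls: "mset ls = {#[6], [4, 2]#}"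
    by (auto simp: has_specht_filtration_with_factors_def)
  have "size (mset ls) = 2" unfolding ls by simp
  then have len: "length ls = 2" by simp
  then obtain p q where pq: "ls = [p, q]" by (auto simp: numeral_2_eq_2 length_Suc_conv)
  have "length Us = 3" using filt len by (simp add: specht_filtration_def)
  then obtain U0 U1 U2 where Us: "Us = [U0, U1, U2]" by (auto simp: numeral_3_eq_3 length_Suc_conv)
  have U0: "U0 = {\<zero>\<^bsub>?M\<^esub>}" and U2: "U2 = carrier ?M"
    and gs: "group_submodule F2 (sym_group 6) ?M U0" "group_submodule F2 (sym_group 6) ?M U1"
      "group_submodule F2 (sym_group 6) ?M U2"
  proof -
    have *: "hd Us = {\<zero>\<^bsub>?M\<^esub>}" "last Us = carrier ?M"
      "\<forall>U\<in>set Us. group_submodule F2 (sym_group 6) ?M U"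
      using filt unfolding specht_filtration_def by blast+
    show "U0 = {\<zero>\<^bsub>?M\<^esub>}" "U2 = carrier ?M" "group_submodule F2 (sym_group 6) ?M U0"
      "group_submodule F2 (sym_group 6) ?M U1" "group_submodule F2 (sym_group 6) ?M U2"
      using *(1) *(2) *(3) unfolding Us by simp_all
  qed
  have "\<forall>i<2. Us ! i \<subset> Us ! Suc i \<and>
      gmodule_isomorphic F2 (sym_group 6) (quotient_gmodule (?M\<lparr>carrier := Us ! Suc i\<rparr>) (Us ! i))
        (specht_gmodule F2 (ls ! i))"
    using filt len by (simp add: specht_filtration_def)
  from spec[OF this, of 0] spec[OF this, of "Suc 0"]
  have sub: "U0 \<subseteq> U1" "U1 \<subseteq> U2"
    and iso: "gmodule_isomorphic F2 (sym_group 6) (quotient_gmodule (?M\<lparr>carrier := U1\<rparr>) U0) (specht_gmodule F2 p)"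
      "gmodule_isomorphic F2 (sym_group 6) (quotient_gmodule (?M\<lparr>carrier := U2\<rparr>) U1) (specht_gmodule F2 q)"
    by (auto simp: Us pq)
  note c = ind.group_submodule_closed[OF gs(2)]
  note K = group_submodule_sep_kernel[OF B]
  have S: "abelian_group (specht_gmodule F2 l)" for l
    using module_specht unfolding module_def by blast
  have triv: "gact (specht_gmodule F2 [6]) \<sigma> s = s"
    if "\<sigma> \<in> carrier (sym_group 6)" "s \<in> carrier (specht_gmodule F2 [6])" for \<sigma> s
  proof -
    have "s \<in> carrier (tabloid_gmodule F2 [6])"
      using module.submoduleE(1)[OF module_tabloid_gmodule specht_submodule] that(2) by (rule subsetD)
    from tabloid_6_gact[OF this] show ?thesis
      using that(1) by (simp only: specht_gmodule_simps sym_group_carrier)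
  qed
  obtain \<theta> where \<theta>: "\<And>v w. v \<in> U1 \<Longrightarrow> w \<in> U1 \<Longrightarrow> \<theta> (v \<oplus>\<^bsub>?M\<^esub> w) = \<theta> v \<oplus>\<^bsub>specht_gmodule F2 p\<^esub> \<theta> w"
    "\<And>a v. a \<in> carrier F2 \<Longrightarrow> v \<in> U1 \<Longrightarrow> \<theta> (a \<odot>\<^bsub>?M\<^esub> v) = a \<odot>\<^bsub>specht_gmodule F2 p\<^esub> \<theta> v"
    "\<And>\<sigma> v. \<sigma> \<in> carrier (sym_group 6) \<Longrightarrow> v \<in> U1 \<Longrightarrow> \<theta> (gact ?M \<sigma> v) = gact (specht_gmodule F2 p) \<sigma> (\<theta> v)"
    "\<theta> ` U1 = carrier (specht_gmodule F2 p)"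
    "\<And>v w. v \<in> U1 \<Longrightarrow> w \<in> U1 \<Longrightarrow> \<theta> v = \<theta> w \<longleftrightarrow> v \<ominus>\<^bsub>?M\<^esub> w \<in> U0"
  proof (rule ind.quotient_isomorphicE[OF gs(1,2) sub(1) S iso(1)], goal_cases)
    case (1 \<theta>)
    show ?case by (rule 1(1)) (fact 1(2-6))+
  qed
  obtain \<eta> where \<eta>: "\<And>v w. v \<in> U2 \<Longrightarrow> w \<in> U2 \<Longrightarrow> \<eta> (v \<oplus>\<^bsub>?M\<^esub> w) = \<eta> v \<oplus>\<^bsub>specht_gmodule F2 q\<^esub> \<eta> w"
    "\<And>a v. a \<in> carrier F2 \<Longrightarrow> v \<in> U2 \<Longrightarrow> \<eta> (a \<odot>\<^bsub>?M\<^esub> v) = a \<odot>\<^bsub>specht_gmodule F2 q\<^esub> \<eta> v"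
    "\<And>\<sigma> v. \<sigma> \<in> carrier (sym_group 6) \<Longrightarrow> v \<in> U2 \<Longrightarrow> \<eta> (gact ?M \<sigma> v) = gact (specht_gmodule F2 q) \<sigma> (\<eta> v)"
    "\<eta> ` U2 = carrier (specht_gmodule F2 q)"
    "\<And>v w. v \<in> U2 \<Longrightarrow> w \<in> U2 \<Longrightarrow> \<eta> v = \<eta> w \<longleftrightarrow> v \<ominus>\<^bsub>?M\<^esub> w \<in> U1"
  proof (rule ind.quotient_isomorphicE[OF gs(2,3) sub(2) S iso(2)], goal_cases)
    case (1 \<eta>)
    show ?case by (rule 1(1)) (fact 1(2-6))+
  qed
  define f where "f = unhat B (\<lambda>A. of_bool (A = B \<or> A = other_block B) :: bit)"
  note f = unhat_block[OF B, where 'a = bit, folded f_def]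
  obtain a b c d e g where B': "B = {a, b, c}" and "enumerates a b c d e g"
    using triple_enumerates[OF B] .
  note dis = enumerates_distinct[OF this(2)]
  have mem: "a \<in> {1..6}" "b \<in> {1..6}" "d \<in> {1..6}" unfolding dis(3) by simp_all
  have notB: "d \<notin> B" using dis(1,2) by (simp add: B')
  \<comment> \<open>The transposition moves b out of \<open>B\<close>: the cocycle of the translate
    of \<open>f\<close> at (a, d) is that of \<open>f\<close> at (a, b), which is 0, whereas
    \<open>f\<close> itself has value 1 at (a, d).\<close>
  define \<sigma> where "\<sigma> = transpose b d"
  have \<sigma>: "\<sigma> permutes {1..6}" unfolding \<sigma>_def by (intro permutes_swap_id mem)
  have inv\<sigma>: "inv' \<sigma> a = a" "inv' \<sigma> d = b"
    using dis(1,2) permutes_inverses(2)[OF \<sigma>, of a] permutes_inverses(2)[OF \<sigma>, of b]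
    by (simp_all add: \<sigma>_def)
  from ls have "p = [6] \<and> q = [4, 2] \<or> p = [4, 2] \<and> q = [6]"
    by (auto simp: pq add_eq_conv_ex)
  then show False
  proof (elim disjE conjE)
    assume p: "p = [6]" and q: "q = [4, 2]"
    have "U1 \<subseteq> sep_kernel B"
    proof
      fix u assume u: "u \<in> U1"
      then have uc: "u \<in> carrier ?M" using c(1) by blast
      have fixed: "gact ?M \<tau> u = u" if "\<tau> permutes {1..6}" for \<tau>
      proof -
        have \<tau>: "\<tau> \<in> carrier (sym_group 6)" using that by (simp add: sym_group_carrier)
        have "\<theta> u \<in> carrier (specht_gmodule F2 [6])" using \<theta>(4) u p by blast
        then have "\<theta> (gact ?M \<tau> u) = \<theta> u" using \<theta>(3)[OF \<tau> u] triv[OF \<tau>] p by simp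
        then have "gact ?M \<tau> u \<ominus>\<^bsub>?M\<^esub> u = \<zero>\<^bsub>?M\<^esub>" using \<theta>(5) c(6)[OF \<tau> u] u U0 by blast
        then show ?thesis using ind_diff_add[OF ind.gact_closed[OF \<tau> uc] uc] uc by simp
      qed
      \<comment> \<open>By invariance the cocycle takes the same value on the pairs formed from a, y
        and a third point z. The cocycle rule then says that this value equals its double, which is
        zero.\<close>
      have const: "sep B u x y = sep B u (\<tau> x) (\<tau> y)" if "\<tau> permutes {1..6}" for \<tau> x y
        using sep_gact[OF B uc that, of "\<tau> x" "\<tau> y"] fixed[OF that] permutes_inverses(2)[OF that]
        by simp
      have "sep B u a y = 0" if "y \<in> {1..6}" for y
      proof (cases "y = a")
        case False
        obtain z where z: "z \<in> {1..6}" "z \<noteq> a" "z \<noteq> y" 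
          using dis that by (cases "y = b") auto
        have t1: "transpose y z permutes {1..6}" and t2: "transpose a z permutes {1..6}"
          by (intro permutes_swap_id that z mem)+
        have "sep B u a y = sep B u a z" using const[OF t1, of a y] z False by simp
        moreover have "sep B u a y = sep B u z y" using const[OF t2, of a y] z False by simp
        moreover have "sep B u a z + sep B u z y = sep B u a y"
          by (rule sep_cocycle[OF B uc mem(1) z(1) that])
        ultimately show ?thesis by simp
      qed simp
      then show "u \<in> sep_kernel B" by (rule sep_kernelI[OF B uc mem(1)])
    qed
    then have "U2 \<subseteq> sep_kernel B"
      using \<eta> q by (intro specht_42_quotient_in_sep_kernel[OF gs(3), of \<eta>])
        (auto simp: specht_gmodule_simps sym_group_carrier simp del: tabloid_gmodule_simps)
    then have "f \<in> sep_kernel B" using f(1) U2 by blast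
    then have "sep B f a d = 0" using mem by (simp add: sep_kernel_def[OF B])
    then show False using f(4)[OF _ notB, of a] by (simp add: B')
  next
    assume p: "p = [4, 2]" and q: "q = [6]"
    have "U0 \<subseteq> sep_kernel B" using ind.group_submodule_closed(2)[OF K] U0 by blast
    then have "U1 \<subseteq> sep_kernel B"
      using \<theta> p by (intro specht_42_quotient_in_sep_kernel[OF gs(2), of \<theta>])
        (auto simp: specht_gmodule_simps sym_group_carrier simp del: tabloid_gmodule_simps)
    moreover have "gact ?M \<sigma> f \<ominus>\<^bsub>?M\<^esub> f \<in> U1"
    proof -
      have \<sigma>': "\<sigma> \<in> carrier (sym_group 6)" using \<sigma> by (simp add: sym_group_carrier)
      have fU: "f \<in> U2" "gact ?M \<sigma> f \<in> U2" using f(1) ind.gact_closed[OF \<sigma>'] U2 by auto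
      then have "\<eta> f \<in> carrier (specht_gmodule F2 [6])" using \<eta>(4) q by blast
      then have "\<eta> (gact ?M \<sigma> f) = \<eta> f" using \<eta>(3)[OF \<sigma>' fU(1)] triv[OF \<sigma>'] q by simp
      then show ?thesis using \<eta>(5) fU by blast
    qed
    ultimately have "gact ?M \<sigma> f \<ominus>\<^bsub>?M\<^esub> f \<in> sep_kernel B" by blast
    then have "sep B (gact ?M \<sigma> f \<ominus>\<^bsub>?M\<^esub> f) a d = 0"
      using mem by (simp add: sep_kernel_def[OF B])
    moreover have gf: "gact ?M \<sigma> f \<in> carrier ?M"
      using ind.gact_closed f(1) \<sigma> by (simp add: sym_group_carrier)
    ultimately have "sep B (gact ?M \<sigma> f) a d = sep B f a d"
      using arg_cong[OF ind_diff_add[OF gf f(1)], of "\<lambda>v. sep B v a d"] by (simp add: sep_add[OF B])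
    moreover have "sep B (gact ?M \<sigma> f) a d = 0"
      unfolding sep_gact[OF B f(1) \<sigma>] inv\<sigma> by (rule f(3)) (simp_all add: B')
    moreover have "sep B f a d = 1" by (rule f(4)[OF _ notB]) (simp add: B')
    ultimately show False by simp
  qed
qed

end

section \<open>Traces\<close>

definition lin_comb :: "'x set \<Rightarrow> nat \<Rightarrow> (nat \<Rightarrow> 'a::field) \<Rightarrow> (nat \<Rightarrow> 'x \<Rightarrow> 'a) \<Rightarrow> 'x \<Rightarrow> 'a" where
  "lin_comb \<Omega> n c b = (\<lambda>x\<in>\<Omega>. \<Sum>i<n. c i * b i x)"

text \<open>A version of \<open>is_basis\<close> with plain sums. Coefficient functions are
  arbitrary and are compared only below n, which suits calculations with matrices.\<close>

definition basis_on :: "'x set \<Rightarrow> ('x \<Rightarrow> 'a::field) set \<Rightarrow> nat \<Rightarrow> (nat \<Rightarrow> 'x \<Rightarrow> 'a) \<Rightarrow> bool" where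
  "basis_on \<Omega> U n b \<longleftrightarrow> (\<forall>i<n. b i \<in> U) \<and> (\<forall>v\<in>U. \<exists>c. v = lin_comb \<Omega> n c b) \<and>
     (\<forall>c c'. lin_comb \<Omega> n c b = lin_comb \<Omega> n c' b \<longrightarrow> (\<forall>i<n. c i = c' i))"

lemma lin_comb_cong:
  "(\<And>i. i < n \<Longrightarrow> c i = c' i) \<Longrightarrow> (\<And>i. i < n \<Longrightarrow> b i = b' i) \<Longrightarrow> lin_comb \<Omega> n c b = lin_comb \<Omega> n c' b'"
  unfolding lin_comb_def by (intro restrict_ext sum.cong) auto

lemma lin_comb_lin_comb:
  "lin_comb \<Omega> m c (\<lambda>j. lin_comb \<Omega> n (D j) b) = lin_comb \<Omega> n (\<lambda>i. \<Sum>j<m. c j * D j i) b"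
  unfolding lin_comb_def
proof (rule restrict_ext)
  fix x assume x: "x \<in> \<Omega>"
  have "(\<Sum>j<m. c j * (\<lambda>x\<in>\<Omega>. \<Sum>i<n. D j i * b i x) x) = (\<Sum>j<m. \<Sum>i<n. c j * D j i * b i x)"
    using x by (simp add: sum_distrib_left mult.assoc)
  also have "\<dots> = (\<Sum>i<n. \<Sum>j<m. c j * D j i * b i x)" by (rule sum.swap)
  finally show "(\<Sum>j<m. c j * (\<lambda>x\<in>\<Omega>. \<Sum>i<n. D j i * b i x) x) = (\<Sum>i<n. (\<Sum>j<m. c j * D j i) * b i x)"
    by (simp add: sum_distrib_right)
qed

lemma lin_comb_unit:
  assumes "b k \<in> extensional \<Omega>" "k < n"
  shows "lin_comb \<Omega> n (\<lambda>i. of_bool (i = k)) b = b k"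
proof (rule extensionalityI[of _ \<Omega>])
  fix x assume "x \<in> \<Omega>"
  have "(\<Sum>i<n. of_bool (i = k) * b i x) = (\<Sum>i<n. if i = k then b i x else 0)"
    by (rule sum.cong) auto
  then show "lin_comb \<Omega> n (\<lambda>i. of_bool (i = k)) b x = b k x"
    using \<open>x \<in> \<Omega>\<close> assms(2) by (simp add: lin_comb_def)
qed (use assms in \<open>auto simp: lin_comb_def\<close>)

text \<open>Substituting one change of basis into the other expresses \<open>b k\<close> through
  \<open>b\<close>, and these coefficients are unique.\<close>

lemma basis_change_inverse:
  assumes b: "basis_on \<Omega> U n b" and ext: "U \<subseteq> extensional \<Omega>"
    and P: "\<And>j. j < n' \<Longrightarrow> b' j = lin_comb \<Omega> n (P j) b"
    and Q: "\<And>i. i < n \<Longrightarrow> b i = lin_comb \<Omega> n' (Q i) b'"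
    and "i < n" "k < n"
  shows "(\<Sum>j<n'. Q k j * P j i) = of_bool (i = k)"
proof -
  have "b k = lin_comb \<Omega> n' (Q k) (\<lambda>j. lin_comb \<Omega> n (P j) b)"
    using Q[OF \<open>k < n\<close>] P by (auto intro: trans lin_comb_cong)
  then have "lin_comb \<Omega> n (\<lambda>i. \<Sum>j<n'. Q k j * P j i) b = lin_comb \<Omega> n (\<lambda>i. of_bool (i = k)) b"
    using lin_comb_unit[of b k \<Omega> n] b ext \<open>k < n\<close> by (auto simp: lin_comb_lin_comb basis_on_def)
  then show ?thesis using b \<open>i < n\<close> unfolding basis_on_def by blast
qed

text \<open>\<open>comm\<close> says that the change of basis \<open>P\<close> intertwines the two
  matrices. Since \<open>P\<close> and \<open>Q\<close> are inverse to each other, the traces agree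
  by cyclicity. The lengths n and n' are not compared, so \<open>P\<close> and \<open>Q\<close> are
  treated as rectangular matrices with a two-sided inverse relation.\<close>

lemma trace_unique:
  assumes b: "basis_on \<Omega> U n b" and b': "basis_on \<Omega> U n' b'" and ext: "U \<subseteq> extensional \<Omega>"
    and F: "\<And>m c w. F (lin_comb \<Omega> m c w) = lin_comb \<Omega> m c (\<lambda>i. F (w i))"
    and A: "\<And>j. j < n \<Longrightarrow> F (b j) = lin_comb \<Omega> n (\<lambda>i. A i j) b"
    and A': "\<And>j. j < n' \<Longrightarrow> F (b' j) = lin_comb \<Omega> n' (\<lambda>i. A' i j) b'"
  shows "(\<Sum>i<n. A i i) = (\<Sum>i<n'. A' i i)"
proof -
  have "\<forall>j. \<exists>c. j < n' \<longrightarrow> b' j = lin_comb \<Omega> n c b" "\<forall>i. \<exists>c. i < n \<longrightarrow> b i = lin_comb \<Omega> n' c b'"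
    using b b' unfolding basis_on_def by blast+
  then obtain P Q where P: "\<And>j. j < n' \<Longrightarrow> b' j = lin_comb \<Omega> n (P j) b"
    and Q: "\<And>i. i < n \<Longrightarrow> b i = lin_comb \<Omega> n' (Q i) b'"
    by metis
  note PQ = basis_change_inverse[OF b ext P Q] and QP = basis_change_inverse[OF b' ext Q P]
  have comm: "(\<Sum>i<n. P j i * A k i) = (\<Sum>l<n'. A' l j * P l k)" if j: "j < n'" and k: "k < n" for j k
  proof -
    have "F (b' j) = lin_comb \<Omega> n (P j) (\<lambda>i. lin_comb \<Omega> n (\<lambda>k. A k i) b)"
      unfolding P[OF j] F by (rule lin_comb_cong) (simp_all add: A)
    moreover have "F (b' j) = lin_comb \<Omega> n' (\<lambda>l. A' l j) (\<lambda>l. lin_comb \<Omega> n (P l) b)"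
      unfolding A'[OF j] by (rule lin_comb_cong) (simp_all add: P)
    ultimately have "lin_comb \<Omega> n (\<lambda>k. \<Sum>i<n. P j i * A k i) b = lin_comb \<Omega> n (\<lambda>k. \<Sum>l<n'. A' l j * P l k) b"
      by (simp add: lin_comb_lin_comb)
    then show ?thesis using b k unfolding basis_on_def by blast
  qed
  have "(\<Sum>j<n'. A' j j) = (\<Sum>j<n'. \<Sum>l<n'. A' l j * of_bool (j = l))"
    by (intro sum.cong refl) (simp add: of_bool_def if_distrib cong: if_cong)
  also have "\<dots> = (\<Sum>j<n'. \<Sum>l<n'. A' l j * (\<Sum>i<n. P l i * Q i j))"
    using QP by (intro sum.cong refl) simp
  also have "\<dots> = (\<Sum>j<n'. \<Sum>l<n'. \<Sum>i<n. A' l j * P l i * Q i j)"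
    by (simp add: sum_distrib_left mult.assoc)
  also have "\<dots> = (\<Sum>j<n'. \<Sum>i<n. \<Sum>l<n'. A' l j * P l i * Q i j)"
    by (intro sum.cong refl sum.swap)
  also have "\<dots> = (\<Sum>j<n'. \<Sum>i<n. (\<Sum>k<n. P j k * A i k) * Q i j)"
    using comm by (intro sum.cong refl) (simp add: sum_distrib_right[symmetric])
  also have "\<dots> = (\<Sum>j<n'. \<Sum>i<n. \<Sum>k<n. A i k * (Q i j * P j k))"
    by (simp add: sum_distrib_right sum_distrib_left ac_simps)
  also have "\<dots> = (\<Sum>i<n. \<Sum>j<n'. \<Sum>k<n. A i k * (Q i j * P j k))"
    by (rule sum.swap)
  also have "\<dots> = (\<Sum>i<n. \<Sum>k<n. \<Sum>j<n'. A i k * (Q i j * P j k))"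
    by (intro sum.cong refl sum.swap)
  also have "\<dots> = (\<Sum>i<n. \<Sum>k<n. A i k * of_bool (k = i))"
    using PQ by (intro sum.cong refl) (simp add: sum_distrib_left[symmetric])
  also have "\<dots> = (\<Sum>i<n. A i i)"
    by (intro sum.cong refl) (simp add: of_bool_def if_distrib cong: if_cong)
  finally show ?thesis by simp
qed

text \<open>\<open>is_basis\<close> asks for a unique extensional coefficient function; restricting
  coefficients to indices below n translates this into \<open>basis_on\<close>.\<close>

lemma is_basis_iff:
  assumes U: "submodule U ring_of_type_algebra (permutation_gmodule ring_of_type_algebra G \<Omega> \<alpha>)"
  shows "is_basis (ring_of_type_algebra :: 'a::field ring)
      ((permutation_gmodule ring_of_type_algebra G \<Omega> \<alpha>)\<lparr>carrier := U\<rparr>) n b \<longleftrightarrow> basis_on \<Omega> U n b"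
    (is "is_basis ?R ?M n b \<longleftrightarrow> _")
proof (cases "\<forall>i<n. b i \<in> U")
  case True
  interpret P: module ?R "permutation_gmodule ?R G \<Omega> \<alpha>" by (rule module_permutation_gmodule)
  have comb: "(\<Oplus>\<^bsub>?M\<^esub>i\<in>{..<n}. c i \<odot>\<^bsub>?M\<^esub> b i) = lin_comb \<Omega> n c b" for c
    using True P.submoduleE(4)[OF U]
    by (subst finsum_permutation_gmodule[OF U]) (auto simp: lin_comb_def intro!: restrict_ext)
  have comb_U: "lin_comb \<Omega> n c b \<in> U" for c
    unfolding lin_comb_def by (rule submodule_sum[OF U]) (use True in auto)
  have restr: "lin_comb \<Omega> n (restrict c {..<n}) b = lin_comb \<Omega> n c b" for c
    by (rule lin_comb_cong) auto
  have "(\<forall>v\<in>U. \<exists>!c. c \<in> {..<n} \<rightarrow>\<^sub>E UNIV \<and> v = lin_comb \<Omega> n c b) \<longleftrightarrow> basis_on \<Omega> U n b"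
  proof
    assume ex1: "\<forall>v\<in>U. \<exists>!c. c \<in> {..<n} \<rightarrow>\<^sub>E UNIV \<and> v = lin_comb \<Omega> n c b"
    have "c i = c' i" if eq: "lin_comb \<Omega> n c b = lin_comb \<Omega> n c' b" and "i < n" for c c' i
    proof -
      have "restrict c {..<n} = restrict c' {..<n}"
      proof -
        have m: "restrict c {..<n} \<in> {..<n} \<rightarrow>\<^sub>E UNIV" for c :: "nat \<Rightarrow> 'a" by simp
        show ?thesis
          using bspec[OF ex1 comb_U[of c]] m[of c] m[of c'] restr[of c] restr[of c'] eq by metis
      qed
      then show ?thesis using \<open>i < n\<close> by (metis lessThan_iff restrict_apply')
    qed
    then show "basis_on \<Omega> U n b" using True ex1 unfolding basis_on_def by blast
  next
    assume bo: "basis_on \<Omega> U n b"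
    show "\<forall>v\<in>U. \<exists>!c. c \<in> {..<n} \<rightarrow>\<^sub>E UNIV \<and> v = lin_comb \<Omega> n c b"
    proof
      fix v assume "v \<in> U"
      then obtain c where c: "v = lin_comb \<Omega> n c b" using bo unfolding basis_on_def by blast
      show "\<exists>!c. c \<in> {..<n} \<rightarrow>\<^sub>E UNIV \<and> v = lin_comb \<Omega> n c b"
      proof (rule ex1I[of _ "restrict c {..<n}"])
        show "restrict c {..<n} \<in> {..<n} \<rightarrow>\<^sub>E UNIV \<and> v = lin_comb \<Omega> n (restrict c {..<n}) b"
          using c restr by simp
        fix c' assume c': "c' \<in> {..<n} \<rightarrow>\<^sub>E UNIV \<and> v = lin_comb \<Omega> n c' b"
        then have "c' i = c i" if "i < n" for i
          using bo c that unfolding basis_on_def by metis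
        then show "c' = restrict c {..<n}"
          using c' by (intro extensionalityI[of _ "{..<n}"]) (auto simp: PiE_def)
      qed
    qed
  qed
  then show ?thesis using True unfolding is_basis_def comb by (auto simp: Pi_def)
next
  case False
  then show ?thesis by (auto simp: is_basis_def basis_on_def)
qed

text \<open>This resolves the definite description in \<open>character\<close>: the given basis
  provides a value, and \<open>trace_unique\<close> shows that every other basis gives the same
  one.\<close>

lemma character_eq:
  fixes G :: "('g, 'h) monoid_scheme" and g and \<Omega> :: "'x set" and \<alpha> :: "'g \<Rightarrow> 'x \<Rightarrow> 'x"
  defines "P \<equiv> permutation_gmodule (ring_of_type_algebra :: 'a::field ring) G \<Omega> \<alpha>"
  assumes U: "submodule U ring_of_type_algebra P" and act: "\<And>x. x \<in> \<Omega> \<Longrightarrow> \<alpha> (inv\<^bsub>G\<^esub> g) x \<in> \<Omega>"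
    and b: "basis_on \<Omega> U n b"
    and A: "\<And>j. j < n \<Longrightarrow> gact P g (b j) = lin_comb \<Omega> n (\<lambda>i. A i j) b"
  shows "character ring_of_type_algebra (P\<lparr>carrier := U\<rparr>) g = (\<Sum>i<n. A i i)"
proof -
  let ?R = "ring_of_type_algebra :: 'a ring" and ?M = "P\<lparr>carrier := U\<rparr>"
  interpret P: module ?R P unfolding P_def by (rule module_permutation_gmodule)
  note U' = U[unfolded P_def]
  have ext: "U \<subseteq> extensional \<Omega>"
    using P.submoduleE(1)[OF U] by (auto simp: P_def PiE_def)
  have comb: "(\<Oplus>\<^bsub>?M\<^esub>i\<in>{..<m}. c i \<odot>\<^bsub>?M\<^esub> w i) = lin_comb \<Omega> m c w" if "\<forall>i<m. w i \<in> U" for m c w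
    using that P.submoduleE(4)[OF U] unfolding P_def
    by (subst finsum_permutation_gmodule[OF U']) (auto simp: lin_comb_def intro!: restrict_ext)
  have lin: "gact P g (lin_comb \<Omega> m c w) = lin_comb \<Omega> m c (\<lambda>i. gact P g (w i))" for m c w
    using act by (auto simp: P_def lin_comb_def intro!: restrict_ext)
  have gact_eq: "gact ?M = gact P" by simp
  show ?thesis
    unfolding character_def
  proof (rule the_equality)
    show "\<exists>n' b' A'. is_basis ?R ?M n' b' \<and> (\<forall>i<n'. \<forall>j<n'. A' i j \<in> carrier ?R) \<and>
        (\<forall>j<n'. gact ?M g (b' j) = (\<Oplus>\<^bsub>?M\<^esub>i\<in>{..<n'}. A' i j \<odot>\<^bsub>?M\<^esub> b' i)) \<and>
        (\<Sum>i<n. A i i) = (\<Oplus>\<^bsub>?R\<^esub>i\<in>{..<n'}. A' i i)"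
    proof (rule exI[of _ n], rule exI[of _ b], rule exI[of _ A], intro conjI)
      show "is_basis ?R ?M n b" unfolding P_def is_basis_iff[OF U'] by (rule b)
      show "\<forall>j<n. gact ?M g (b j) = (\<Oplus>\<^bsub>?M\<^esub>i\<in>{..<n}. A i j \<odot>\<^bsub>?M\<^esub> b i)"
      proof (intro allI impI)
        fix j assume "j < n"
        have "\<forall>i<n. b i \<in> U" using b by (simp add: basis_on_def)
        then have "(\<Oplus>\<^bsub>?M\<^esub>i\<in>{..<n}. A i j \<odot>\<^bsub>?M\<^esub> b i) = lin_comb \<Omega> n (\<lambda>i. A i j) b"
          by (rule comb)
        then show "gact ?M g (b j) = (\<Oplus>\<^bsub>?M\<^esub>i\<in>{..<n}. A i j \<odot>\<^bsub>?M\<^esub> b i)"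
          using A[OF \<open>j < n\<close>] by (simp only: gact_eq)
      qed
    qed (simp_all add: finsum_type_ring)
  next
    fix \<tau> assume "\<exists>n b A. is_basis ?R ?M n b \<and> (\<forall>i<n. \<forall>j<n. A i j \<in> carrier ?R) \<and>
        (\<forall>j<n. gact ?M g (b j) = (\<Oplus>\<^bsub>?M\<^esub>i\<in>{..<n}. A i j \<odot>\<^bsub>?M\<^esub> b i)) \<and>
        \<tau> = (\<Oplus>\<^bsub>?R\<^esub>i\<in>{..<n}. A i i)"
    then obtain n' b' A' where *: "is_basis ?R ?M n' b'"
      "\<forall>j<n'. gact ?M g (b' j) = (\<Oplus>\<^bsub>?M\<^esub>i\<in>{..<n'}. A' i j \<odot>\<^bsub>?M\<^esub> b' i)"
      "\<tau> = (\<Oplus>\<^bsub>?R\<^esub>i\<in>{..<n'}. A' i i)" by blast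
    have b': "basis_on \<Omega> U n' b'" using *(1) unfolding P_def is_basis_iff[OF U'] .
    have "\<forall>i<n'. b' i \<in> U" using b' by (simp add: basis_on_def)
    then have "(\<Oplus>\<^bsub>?M\<^esub>i\<in>{..<n'}. A' i j \<odot>\<^bsub>?M\<^esub> b' i) = lin_comb \<Omega> n' (\<lambda>i. A' i j) b'" for j
      by (rule comb)
    then have "gact P g (b' j) = lin_comb \<Omega> n' (\<lambda>i. A' i j) b'" if "j < n'" for j
      using spec[OF *(2), of j] that by (simp only: gact_eq)
    from trace_unique[OF b b' ext lin A this] show "\<tau> = (\<Sum>i<n. A i i)"
      using *(3) by (simp add: finsum_type_ring)
  qed
qed

section \<open>The ordinary character\<close>

text \<open>For \<open>A\<close> running through the triples that contain a fixed point, these are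
  the indicators of the ten partitions, the natural basis of the induced module.\<close>

definition block_indicator :: "nat set \<Rightarrow> nat set \<Rightarrow> 'a::field_char_0" where
  "block_indicator A C = of_bool (C = A \<or> C = other_block A)"

lemma other_block_swap:
  "A \<in> triples \<Longrightarrow> C \<in> triples \<Longrightarrow> other_block A = C \<longleftrightarrow> A = other_block C"
  using other_block_triples(2)[of A] other_block_triples(2)[of C] by metis

lemma block_indicator_other_block:
  assumes "A \<in> triples" "C \<in> triples"
  shows "block_indicator A (other_block C) = (block_indicator A C :: 'a::field_char_0)"
    "block_indicator (other_block A) C = (block_indicator A C :: 'a)"
proof -
  show "block_indicator A (other_block C) = (block_indicator A C :: 'a)"
    using other_block_swap[OF assms(2,1)] other_block_swap[OF assms(2) other_block_triples(1)[OF assms(1)]]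
      other_block_triples(2)[OF assms(1)]
    unfolding block_indicator_def by auto
  show "block_indicator (other_block A) C = (block_indicator A C :: 'a)"
    using other_block_triples(2)[OF assms(1)] unfolding block_indicator_def by auto
qed

text \<open>The set \<open>S\<close> is kept general: the empty set gives the total and a
  two-element set gives a pair sum.\<close>

lemma sum_block_indicator:
  assumes "A \<in> triples"
  shows "(\<Sum>C | C \<in> triples \<and> S \<subseteq> C. block_indicator A C :: 'a::field_char_0) =
    of_bool (S \<subseteq> A) + of_bool (S \<subseteq> other_block A)"
proof -
  have "(\<Sum>C | C \<in> triples \<and> S \<subseteq> C. block_indicator A C :: 'a) =
      (\<Sum>C | C \<in> triples \<and> S \<subseteq> C. (if C = A then 1 else 0) + (if C = other_block A then 1 else 0))"
    using other_block_triples(3)[OF assms] by (intro sum.cong) (auto simp: block_indicator_def)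
  also have "\<dots> = (\<Sum>C | C \<in> triples \<and> S \<subseteq> C. if C = A then 1 else 0)
      + (\<Sum>C | C \<in> triples \<and> S \<subseteq> C. if C = other_block A then 1 else 0)"
    by (rule sum.distrib)
  also have "(\<Sum>C | C \<in> triples \<and> S \<subseteq> C. if C = Y then 1 else 0 :: 'a) = of_bool (S \<subseteq> Y)"
    if "Y \<in> triples" for Y
    using that finite_triples by simp
  note this[OF assms]
  also have "(\<Sum>C | C \<in> triples \<and> S \<subseteq> C. if C = other_block A then 1 else 0 :: 'a) = of_bool (S \<subseteq> other_block A)"
    using other_block_triples(1)[OF assms] finite_triples by simp
  finally show ?thesis .
qed

abbreviation perms6 :: "(nat \<Rightarrow> nat) set" where "perms6 \<equiv> {\<sigma>. \<sigma> permutes {1..6}}"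

context
  fixes B :: "nat set"
  assumes B: "B \<in> triples"
begin

definition triple_total :: "((nat \<Rightarrow> nat) \<Rightarrow> 'a::field_char_0) \<Rightarrow> 'a" where
  "triple_total f = (\<Sum>A\<in>triples. hat B f A)"

definition pair_sum :: "((nat \<Rightarrow> nat) \<Rightarrow> 'a::field_char_0) \<Rightarrow> nat set \<Rightarrow> 'a" where
  "pair_sum f S = (\<Sum>A | A \<in> triples \<and> S \<subseteq> A. hat B f A)"

definition to_42 :: "((nat \<Rightarrow> nat) \<Rightarrow> 'a::field_char_0) \<Rightarrow> (nat \<times> nat \<Rightarrow> nat) set \<Rightarrow> 'a" where
  "to_42 f = (\<lambda>T\<in>tabloids [4, 2]. pair_sum f (tabloid_row [4, 2] T 1))"

lemma to_42_apply: "u \<in> tableaux [4, 2] \<Longrightarrow> to_42 f (tabloid [4, 2] u) = pair_sum f (row_set [4, 2] u 1)"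
  by (simp add: to_42_def tabloid_row_tabloid)

lemma hat_lin_comb:
  "A \<in> triples \<Longrightarrow> hat B (lin_comb perms6 n c b) A = (\<Sum>i<n. c i * hat B (b i) A)"
  using some_permutes[OF B, of A] by (simp add: hat_def lin_comb_def)

lemma pair_sum_lin_comb: "pair_sum (lin_comb perms6 n c b) S = (\<Sum>i<n. c i * pair_sum (b i) S)"
proof -
  have "pair_sum (lin_comb perms6 n c b) S = (\<Sum>A | A \<in> triples \<and> S \<subseteq> A. \<Sum>i<n. c i * hat B (b i) A)"
    unfolding pair_sum_def by (rule sum.cong) (simp_all add: hat_lin_comb)
  also have "\<dots> = (\<Sum>i<n. \<Sum>A | A \<in> triples \<and> S \<subseteq> A. c i * hat B (b i) A)"
    by (rule sum.swap)
  finally show ?thesis by (simp add: pair_sum_def sum_distrib_left)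
qed

lemma to_42_lin_comb: "to_42 (lin_comb perms6 n c b) = lin_comb (tabloids [4, 2]) n c (\<lambda>i. to_42 (b i))"
  by (auto simp: to_42_def lin_comb_def[of "tabloids [4, 2]"] pair_sum_lin_comb intro!: restrict_ext)

lemma triple_total_eq_pair_sum: "triple_total f = pair_sum f {}"
  by (simp add: triple_total_def pair_sum_def)

lemma triple_total_lin_comb: "triple_total (lin_comb perms6 n c b) = (\<Sum>i<n. c i * triple_total (b i))"
  by (simp add: triple_total_eq_pair_sum pair_sum_lin_comb)

lemma pair_sum_gact:
  assumes f: "f \<in> carrier (ind B :: 'a::field_char_0 ind_module)" and \<sigma>: "\<sigma> permutes {1..6}"
  shows "pair_sum (gact (ind B :: 'a ind_module) \<sigma> f) S = pair_sum f (inv' \<sigma> ` S)"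
proof -
  note \<sigma>' = permutes_inv[OF \<sigma>]
  have id: "\<sigma> ` inv' \<sigma> ` A = A" "inv' \<sigma> ` \<sigma> ` A = A" for A
    by (simp_all add: image_comp permutes_inv_o[OF \<sigma>])
  have sub: "inv' \<sigma> ` S \<subseteq> A \<longleftrightarrow> S \<subseteq> \<sigma> ` A" for A
    using id by (metis image_mono)
  show ?thesis
    unfolding pair_sum_def sub
    by (rule sum.reindex_bij_witness[of _ "\<lambda>A. \<sigma> ` A" "\<lambda>A. inv' \<sigma> ` A"])
      (auto simp: id permutes_triples(1)[OF \<sigma>] permutes_triples(1)[OF \<sigma>'] hat_gact[OF B f \<sigma>])
qed

lemma triple_total_gact:
  "f \<in> carrier (ind B :: 'a::field_char_0 ind_module) \<Longrightarrow> \<sigma> permutes {1..6} \<Longrightarrow>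
    triple_total (gact (ind B :: 'a ind_module) \<sigma> f) = triple_total f"
  by (simp add: triple_total_eq_pair_sum pair_sum_gact)

lemma to_42_gact:
  assumes f: "f \<in> carrier (ind B :: 'a::field_char_0 ind_module)" and \<sigma>: "\<sigma> permutes {1..6}"
  shows "to_42 (gact (ind B :: 'a ind_module) \<sigma> f) =
    gact (tabloid_gmodule ring_of_type_algebra [4, 2]) \<sigma> (to_42 f)"
proof (rule extensionalityI[of _ "tabloids [4, 2]"])
  fix T assume "T \<in> tabloids [4, 2]"
  then obtain u where u: "u \<in> tableaux [4, 2]" "T = tabloid [4, 2] u" by (rule tabloidsE)
  have "tableau_act [4, 2] (inv' \<sigma>) u \<in> tableaux [4, 2]"
    using tableau_act_tableau[OF u(1)] permutes_inv[OF \<sigma>] by simp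
  then show "to_42 (gact (ind B :: 'a ind_module) \<sigma> f) T =
      gact (tabloid_gmodule ring_of_type_algebra [4, 2]) \<sigma> (to_42 f) T"
    using u \<sigma> by (simp add: tabloid_gmodule_gact to_42_apply row_set_act pair_sum_gact[OF f \<sigma>])
qed (auto simp: to_42_def tabloid_gmodule_def)

text \<open>Exactly one of two complementary triples contains x, and both have the same
  value.\<close>

lemma triple_total_half:
  assumes f: "f \<in> carrier (ind B :: 'a::field_char_0 ind_module)" and x: "x \<in> {1..6}"
  shows "triple_total f = 2 * (\<Sum>A | A \<in> triples \<and> x \<in> A. hat B f A)"
proof -
  have "triple_total f = (\<Sum>A | A \<in> triples \<and> x \<in> A. hat B f A) + (\<Sum>A | A \<in> triples \<and> x \<notin> A. hat B f A)"
    unfolding triple_total_def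
    by (subst sum.union_disjoint[symmetric]) (auto simp: finite_triples intro!: sum.cong)
  also have "(\<Sum>A | A \<in> triples \<and> x \<notin> A. hat B f A) = (\<Sum>A | A \<in> triples \<and> x \<in> A. hat B f A)"
    by (rule sum.reindex_bij_witness[of _ other_block other_block])
      (use x in \<open>auto simp: other_block_triples hat_other_block[OF B f] simp del: atLeastAtMost_iff\<close>)
  finally show ?thesis by simp
qed

text \<open>The pair sums at {a,b}, {a,c} and {b,c} together count {a,b,c} three times and every
  triple that shares two points with it once. The sum over the triples through a counts each of
  these once, if {a,d,e} and its like are replaced by their complements. The difference is twice the
  value at {a,b,c}.\<close>

lemma to_42_injective:
  assumes f: "f \<in> carrier (ind B :: 'a::field_char_0 ind_module)"
    and tot: "triple_total f = 0" and 0: "\<And>T. T \<in> tabloids [4, 2] \<Longrightarrow> to_42 f T = 0" and A: "A \<in> triples"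
  shows "hat B f A = 0"
proof -
  obtain a b c d e g where A': "A = {a, b, c}" and en: "enumerates a b c d e g"
    using triple_enumerates[OF A] .
  define F where "F x y z = hat B f {x, y, z}" for x y z
  note ob = hat_other_block[OF B f]
  have pair: "F x y u + F x y v + F x y w + F x y z = 0" if "enumerates x y u v w z" for x y u v w z
  proof -
    define t where "t = tableau_of_rows [4, 2] [[u, v, w, z], [x, y]]"
    have "enumerates u v w z x y" using that by (simp add: enumerates_list add_mset_commute)
    then have t: "t \<in> tableaux [4, 2]" unfolding t_def by (rule tableau_of_rows_42)
    have "row_set [4, 2] t 1 = {x, y}"
      unfolding row_set_42(2)[OF t] by (simp add: t_def tableau_of_rows_simps)
    then have "pair_sum f {x, y} = 0"
      using 0[of "tabloid [4, 2] t"] t by (simp add: to_42_apply)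
    then show ?thesis
      using sum_triples_containing[OF that, of "hat B f"] by (simp add: pair_sum_def F_def)
  qed
  have ens: "enumerates a c b d e g" "enumerates b c a d e g" "enumerates a d e b c g"
    "enumerates a d g b c e" "enumerates a e g b c d"
    using en by (simp_all add: enumerates_list add_mset_commute)
  have "a \<in> {1..6}" using enumerates_distinct(3)[OF en] by auto
  then have "(\<Sum>A | A \<in> triples \<and> a \<in> A. hat B f A) = 0" using triple_total_half[OF f] tot by simp
  moreover have "(\<Sum>A | A \<in> triples \<and> a \<in> A. hat B f A) =
      (\<Sum>A | A \<in> triples \<and> a \<in> A \<and> b \<in> A. hat B f A) + (\<Sum>A | A \<in> triples \<and> a \<in> A \<and> b \<notin> A. hat B f A)"
    by (subst sum.union_disjoint[symmetric]) (auto simp: finite_triples intro!: sum.cong)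
  ultimately have tot': "F a b c + F a b d + F a b e + F a b g
      + (F a c d + F a c e + F a c g + F a d e + F a d g + F a e g) = 0"
    by (simp add: sum_triples_containing[OF en] sum_triples_separating[OF en] F_def)
  have comp: "F a d e = F b c g" "F a d g = F b c e" "F a e g = F b c d"
    using ob[OF enumerates_triples(1)[OF ens(3)]] enumerates_triples(2)[OF ens(3)]
      ob[OF enumerates_triples(1)[OF ens(4)]] enumerates_triples(2)[OF ens(4)]
      ob[OF enumerates_triples(1)[OF ens(5)]] enumerates_triples(2)[OF ens(5)]
    by (simp_all add: F_def)
  have perm: "F a c b = F a b c" "F b c a = F a b c" by (simp_all add: F_def insert_commute)
  have "2 * F a b c = (F a b c + F a b d + F a b e + F a b g) + (F a c b + F a c d + F a c e + F a c g)
      + (F b c a + F b c d + F b c e + F b c g)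
      - (F a b c + F a b d + F a b e + F a b g + (F a c d + F a c e + F a c g + F a d e + F a d g + F a e g))"
    unfolding comp perm by (simp add: algebra_simps)
  also have "\<dots> = 0" unfolding tot' unfolding pair[OF en] pair[OF ens(1)] pair[OF ens(2)] by simp
  finally show ?thesis by (simp add: A' F_def)
qed

subsection \<open>The image of the sum-zero functions\<close>

lemma pair_sum_unhat:
  "pair_sum (unhat B F) S = (\<Sum>A | A \<in> triples \<and> S \<subseteq> A. F A)"
  unfolding pair_sum_def by (rule sum.cong) (simp_all add: hat_unhat[OF B])

text \<open>
  Exchanging \<open>g\<close> and \<open>b\<close> in the blocks \<open>{e, c, g}\<close> and \<open>{e, d, g}\<close> changes the pair sums by two expressions in
  which the contributions of \<open>c\<close> and \<open>d\<close> cancel and the polytabloid appears twice.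
\<close>

lemma polytabloid_42_in_image:
  assumes t: "t \<in> tableaux [4, 2]"
  shows "(polytabloid ring_of_type_algebra [4, 2] t :: _ \<Rightarrow> 'a::field_char_0) \<in>
    to_42 ` {f \<in> carrier (ind B). triple_total f = 0}"
proof -
  let ?E = "block_indicator :: nat set \<Rightarrow> nat set \<Rightarrow> 'a"
  define a b c d e g where defs: "a = t (0, 0)" "b = t (0, 1)" "c = t (0, 2)" "d = t (0, 3)"
    "e = t (1, 0)" "g = t (1, 1)"
  have en: "enumerates a b c d e g" using tableau_42_enumerates[OF t] by (simp add: defs)
  note dis = enumerates_distinct[OF en]
  have ens: "enumerates e c g a b d" "enumerates e c b a d g" "enumerates e d g a b c"
    "enumerates e d b a c g"
    using en by (simp_all add: enumerates_list add_mset_commute)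
  note tr = enumerates_triples[OF ens(1)] enumerates_triples[OF ens(2)] enumerates_triples[OF ens(3)]
    enumerates_triples[OF ens(4)]
  define F where "F C = (?E {e, c, g} C - ?E {e, c, b} C + ?E {e, d, g} C - ?E {e, d, b} C) / 2" for C
  define f where "f = unhat B F"
  have fc: "f \<in> carrier (ind B)"
    unfolding f_def by (rule unhat_closed[OF B]) (simp add: F_def block_indicator_other_block tr)
  have ps: "pair_sum f S = ((of_bool (S \<subseteq> {e, c, g}) + of_bool (S \<subseteq> {a, b, d}))
      - (of_bool (S \<subseteq> {e, c, b}) + of_bool (S \<subseteq> {a, d, g}))
      + (of_bool (S \<subseteq> {e, d, g}) + of_bool (S \<subseteq> {a, b, c}))
      - (of_bool (S \<subseteq> {e, d, b}) + of_bool (S \<subseteq> {a, c, g}))) / 2" for S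
    unfolding f_def pair_sum_unhat F_def sum_divide_distrib[symmetric] sum.distrib sum_subtractf
    by (simp add: sum_block_indicator tr)
  have "triple_total f = 0" by (simp add: triple_total_eq_pair_sum ps)
  moreover have "polytabloid ring_of_type_algebra [4, 2] t = to_42 f"
  proof (rule extensionalityI[of _ "tabloids [4, 2]"])
    show "(polytabloid ring_of_type_algebra [4, 2] t :: _ \<Rightarrow> 'a) \<in> extensional (tabloids [4, 2])"
      using polytabloid_closed[where 'a = 'a, of "[4, 2]" t] by (auto simp: PiE_def)
    fix T assume "T \<in> tabloids [4, 2]"
    then obtain u where u: "u \<in> tableaux [4, 2]" "T = tabloid [4, 2] u" by (rule tabloidsE)
    note en' = enumerates_distinct[OF tableau_42_enumerates[OF u(1)]]
    define x y where xy: "x = u (1, 0)" "y = u (1, 1)"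
    have "x \<noteq> y" using en'(1) by (simp add: xy)
    have "x \<in> {1..6}" "y \<in> {1..6}" unfolding en'(3) by (simp_all add: xy)
    then have "x \<in> {a, b, c, d, e, g}" "y \<in> {a, b, c, d, e, g}" unfolding dis(3) .
    then have "of_bool ({x, y} = {e, g}) - of_bool ({x, y} = {a, g}) - of_bool ({x, y} = {e, b})
        + of_bool ({x, y} = {a, b}) = pair_sum f {x, y}"
      using \<open>x \<noteq> y\<close> dis(1,2) unfolding ps
      by (elim insertE emptyE) (simp_all add: doubleton_eq_iff)
    then show "polytabloid ring_of_type_algebra [4, 2] t T = to_42 f T"
      unfolding u(2) to_42_apply[OF u(1)] polytabloid_42[OF t u(1)] row_set_42(2)[OF u(1)]
      by (simp only: defs[symmetric] xy[symmetric])
  qed (auto simp: to_42_def)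
  ultimately show ?thesis using fc by blast
qed

text \<open>In the pair sums of the two partitions the pairs {p,q} and {x,y} cancel. The other eight
  pairs form two four-cycles, p-r-x-s and q-r-y-s, with alternating signs.\<close>

lemma to_42_swap_in_specht:
  assumes en: "enumerates p q r s x y"
  shows "to_42 (unhat B (\<lambda>C. block_indicator {p, q, r} C - block_indicator {p, q, s} C :: 'a::field_char_0))
    \<in> carrier (specht_gmodule ring_of_type_algebra [4, 2])" (is "to_42 ?f \<in> carrier ?S")
proof -
  have ens: "enumerates x s q y p r" "enumerates y s p x q r" "enumerates p q s r x y"
    using en by (simp_all add: enumerates_list add_mset_commute)
  define t1 where "t1 = tableau_of_rows [4, 2] [[x, s, q, y], [p, r]]"
  define t2 where "t2 = tableau_of_rows [4, 2] [[y, s, p, x], [q, r]]"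
  have t: "t1 \<in> tableaux [4, 2]" "t2 \<in> tableaux [4, 2]"
    unfolding t1_def t2_def by (rule tableau_of_rows_42[OF ens(1)], rule tableau_of_rows_42[OF ens(2)])
  note dis = enumerates_distinct[OF en]
  note tr = enumerates_triples[OF en] enumerates_triples[OF ens(3)]
  have ps: "pair_sum ?f S = (of_bool (S \<subseteq> {p, q, r}) + of_bool (S \<subseteq> {s, x, y}))
      - (of_bool (S \<subseteq> {p, q, s}) + of_bool (S \<subseteq> {r, x, y}))" for S
    unfolding pair_sum_unhat sum_subtractf by (simp add: sum_block_indicator tr)
  have vals: "t1 (0, 0) = x" "t1 (0, 1) = s" "t1 (1, 0) = p" "t1 (1, 1) = r"
    "t2 (0, 0) = y" "t2 (0, 1) = s" "t2 (1, 0) = q" "t2 (1, 1) = r"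
    by (simp_all add: t1_def t2_def tableau_of_rows_simps)
  let ?e = "\<lambda>t. polytabloid (ring_of_type_algebra :: 'a ring) [4, 2] t"
  have "to_42 ?f = ?e t1 \<oplus>\<^bsub>tabloid_gmodule ring_of_type_algebra [4, 2]\<^esub> ?e t2"
  proof (rule extensionalityI[of _ "tabloids [4, 2]"])
    fix T assume T: "T \<in> tabloids [4, 2]"
    then obtain u where u: "u \<in> tableaux [4, 2]" "T = tabloid [4, 2] u" by (rule tabloidsE)
    note en' = enumerates_distinct[OF tableau_42_enumerates[OF u(1)]]
    define v w where vw: "v = u (1, 0)" "w = u (1, 1)"
    have "v \<noteq> w" using en'(1) by (simp add: vw)
    have "v \<in> {1..6}" "w \<in> {1..6}" unfolding en'(3) by (simp_all add: vw)
    then have "v \<in> {p, q, r, s, x, y}" "w \<in> {p, q, r, s, x, y}" unfolding dis(3) .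
    then have "pair_sum ?f {v, w} =
        (of_bool ({v, w} = {p, r}) - of_bool ({v, w} = {x, r}) - of_bool ({v, w} = {p, s}) + of_bool ({v, w} = {x, s}))
      + (of_bool ({v, w} = {q, r}) - of_bool ({v, w} = {y, r}) - of_bool ({v, w} = {q, s}) + of_bool ({v, w} = {y, s}))"
      using \<open>v \<noteq> w\<close> dis(1,2) unfolding ps
      by (elim insertE emptyE) (simp_all add: doubleton_eq_iff)
    then show "to_42 ?f T = (?e t1 \<oplus>\<^bsub>tabloid_gmodule ring_of_type_algebra [4, 2]\<^esub> ?e t2) T"
      using T unfolding u(2) to_42_apply[OF u(1)] row_set_42(2)[OF u(1)]
      by (simp add: polytabloid_42[OF t(1) u(1)] polytabloid_42[OF t(2) u(1)] row_set_42(2)[OF u(1)]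
          vals vw[symmetric])
  qed (auto simp: to_42_def)
  also have "\<dots> \<in> carrier ?S"
    by (rule module.submoduleE(5)[OF module_tabloid_gmodule specht_submodule
        polytabloid_in_specht[OF t(1)] polytabloid_in_specht[OF t(2)]])
  finally show ?thesis .
qed

text \<open>Of a triple and its complement, one shares at least two points with \<open>A0\<close>.
  Up to complement, \<open>A\<close> is therefore \<open>A0\<close> itself or arises from it by
  exchanging one point, which is the case of the preceding lemma.\<close>

lemma to_42_difference_in_specht:
  assumes A0: "A0 \<in> triples" and A: "A \<in> triples"
  shows "to_42 (unhat B (\<lambda>C. block_indicator A0 C - block_indicator A C :: 'a::field_char_0))
    \<in> carrier (specht_gmodule ring_of_type_algebra [4, 2])"
proof -
  define D where "D A = to_42 (unhat B (\<lambda>C. block_indicator A0 C - block_indicator A C :: 'a))" for A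
  let ?S = "carrier (specht_gmodule (ring_of_type_algebra :: 'a ring) [4, 2])"
  obtain p q r s x y where A0': "A0 = {p, q, r}" and en: "enumerates p q r s x y"
    using triple_enumerates[OF A0] .
  have zero: "D A0 \<in> ?S"
  proof -
    have "D A0 = \<zero>\<^bsub>tabloid_gmodule ring_of_type_algebra [4, 2]\<^esub>"
      by (auto simp: D_def to_42_def pair_sum_unhat intro!: restrict_ext)
    then show ?thesis
      using subgroup.one_closed[OF submodule.axioms(1)[OF specht_submodule[where 'a = 'a, of "[4, 2]"]]] by simp
  qed
  have other: "D (other_block A) = D A" if "A \<in> triples" for A
    using that by (auto simp: D_def to_42_def pair_sum_unhat block_indicator_other_block
        intro!: restrict_ext sum.cong)
  have sw: "D {i, j, l} \<in> ?S" if "enumerates i j k l m n" "A0 = {i, j, k}" for i j k l m n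
    using to_42_swap_in_specht[OF that(1)] unfolding D_def that(2) .
  have ens: "enumerates p q r x s y" "enumerates p q r y s x" "enumerates p r q s x y"
    "enumerates p r q x s y" "enumerates p r q y s x" "enumerates q r p s x y" "enumerates q r p x s y"
    "enumerates q r p y s x" "enumerates p s x q r y" "enumerates p s y q r x" "enumerates p x y q r s"
    using en by (simp_all add: enumerates_list add_mset_commute)
  have eqs: "A0 = {p, r, q}" "A0 = {q, r, p}" by (simp_all add: A0' insert_commute)
  have q: "D {q, r, s} \<in> ?S" "D {q, r, x} \<in> ?S" "D {q, r, y} \<in> ?S"
    by (rule sw[OF ens(6) eqs(2)], rule sw[OF ens(7) eqs(2)], rule sw[OF ens(8) eqs(2)])
  have p: "D A \<in> ?S" if A: "A \<in> triples" "p \<in> A" for A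
  proof -
    have "A \<in> {{p, q, r}, {p, q, s}, {p, q, x}, {p, q, y}} \<union>
        {{p, r, s}, {p, r, x}, {p, r, y}, {p, s, x}, {p, s, y}, {p, x, y}}"
      using A unfolding triples_containing[OF en, symmetric] triples_separating[OF en, symmetric] by blast
    moreover have "D {p, s, x} \<in> ?S" "D {p, s, y} \<in> ?S" "D {p, x, y} \<in> ?S"
      using q other enumerates_triples[OF ens(9)] enumerates_triples[OF ens(10)] enumerates_triples[OF ens(11)]
      by metis+
    moreover have "D {p, q, r} \<in> ?S" using zero by (simp add: A0')
    ultimately show ?thesis
      using sw[OF en A0'] sw[OF ens(1) A0'] sw[OF ens(2) A0'] sw[OF ens(3) eqs(1)]
        sw[OF ens(4) eqs(1)] sw[OF ens(5) eqs(1)]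
      by (elim UnE insertE emptyE) simp_all
  qed
  have "D A \<in> ?S"
  proof (cases "p \<in> A")
    case False
    have "p \<in> {1..6}" using enumerates_distinct(3)[OF en] by auto
    then have "D (other_block A) \<in> ?S" using False by (intro p other_block_triples(1)[OF A]) simp
    then show ?thesis using other[OF A] by simp
  qed (rule p[OF A])
  then show ?thesis by (simp add: D_def)
qed

end

section \<open>Characters computed from bases\<close>

lemma ind_eq:
  "(ind B :: 'a::field ind_module) =
    (permutation_gmodule ring_of_type_algebra (sym_group 6) perms6 (\<otimes>\<^bsub>sym_group 6\<^esub>))\<lparr>carrier := carrier (ind B)\<rparr>"
proof -
  have "carrier (sym_group 6) = perms6" by (auto simp: sym_group_carrier)
  then show ?thesis by (simp add: ind_def induced_trivial_eq)
qed

lemma submodule_ind: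
  "submodule (carrier (ind B)) (ring_of_type_algebra :: 'a::field ring)
    (permutation_gmodule ring_of_type_algebra (sym_group 6) perms6 (\<otimes>\<^bsub>sym_group 6\<^esub>))"
proof -
  have "carrier (sym_group 6) = perms6" by (auto simp: sym_group_carrier)
  then show ?thesis
    using group_submodule_induced[OF sym_group_is_group block_stabilizer_subset, of B, where 'a = 'a]
    by (simp add: group_submodule_def ind_def induced_trivial_eq)
qed

lemma lin_comb_ind:
  assumes "\<And>i. i < n \<Longrightarrow> b i \<in> carrier (ind B :: 'a::field ind_module)"
  shows "lin_comb perms6 n c b \<in> carrier (ind B)"
  unfolding lin_comb_def by (rule submodule_sum[OF submodule_ind]) (use assms in auto)

text \<open>All columns are single points, so only the identity stabilizes them and the polytabloid
  is the unique tabloid. The Specht module is one-dimensional with trivial action.\<close>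

lemma character_6:
  assumes \<sigma>: "\<sigma> permutes {1..6}"
  shows "ordinary_character [6] \<sigma> = 1"
proof -
  let ?P = "tabloid_gmodule complex_field [6]" and ?S = "carrier (specht_gmodule complex_field [6])"
  define t where "t = (\<lambda>(i, j)\<in>young_diagram [6]. Suc j)"
  have "(i, j) \<in> young_diagram [6] \<longleftrightarrow> i = 0 \<and> j < 6" for i j
    by (auto simp: young_diagram_def)
  note yd = this
  have t: "t \<in> tableaux [6]"
  proof (rule tableauI)
    have "t ` young_diagram [6] = (\<lambda>(i, j). Suc j) ` young_diagram [6]" by (simp add: t_def)
    also have "\<dots> = Suc ` {..<6}" by (auto simp: yd image_iff)
    also have "\<dots> = {1..6}" by (auto simp: lessThan_atLeast0 One_nat_def)
    finally show "t ` young_diagram [6] = {1..sum_list [6]}" by simp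
  qed (simp add: t_def)
  have row: "row_set [6] u i = (if i = 0 then {1..6} else {})" if "u \<in> tableaux [6]" for u i
  proof -
    have "row_set [6] u 0 = u ` young_diagram [6]" by (auto simp: row_set_def yd)
    moreover have "row_set [6] u i = {}" if "i \<noteq> 0" using that by (auto simp: row_set_def yd)
    ultimately show ?thesis using tableau_image[OF that] by simp
  qed
  have all: "T = tabloid [6] t" if T: "T \<in> tabloids [6]" for T
    by (rule tabloidsE[OF T]) (simp add: tabloid_eq_iff row t)
  have id: "\<tau> = id" if \<tau>: "\<tau> \<in> column_stabilizer [6] t" for \<tau>
  proof
    fix x
    have perm: "\<tau> permutes {1..6}" and col: "\<And>j. \<tau> ` column_set [6] t j = column_set [6] t j"
      using \<tau> by (simp_all add: column_stabilizer_def sym_group_carrier column_set_def)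
    show "\<tau> x = id x"
    proof (cases "x \<in> {1..6}")
      case True
      then obtain i j where "(i, j) \<in> young_diagram [6]" "x = t (i, j)"
        using tableau_image[OF t] by (metis image_iff prod.exhaust sum_list.Cons sum_list.Nil add.right_neutral)
      then have "column_set [6] t j = {x}" by (auto simp: column_set_def yd)
      then show ?thesis using col[of j] by simp
    qed (use perm in \<open>auto simp: permutes_def\<close>)
  qed
  moreover have "id \<in> column_stabilizer [6] t"
    by (simp add: column_stabilizer_def sym_group_carrier permutes_id)
  ultimately have "{\<tau>. \<tau> \<in> column_stabilizer [6] t \<and> (\<forall>i. row_set [6] (tableau_act [6] \<tau> t) i = row_set [6] t i)} = {id}"
    by (auto simp: row_set_act)
  then have val: "polytabloid complex_field [6] t (tabloid [6] t) = 1"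
    by (simp add: polytabloid_apply[OF t t] evenperm_id)
  define b where "b i = polytabloid complex_field [6] t" for i :: nat
  have bS: "b i \<in> ?S" for i unfolding b_def by (rule polytabloid_in_specht[OF t])
  have ext: "v \<in> extensional (tabloids [6])" if "v \<in> ?S" for v
    using subsetD[OF module.submoduleE(1)[OF module_tabloid_gmodule specht_submodule] that]
    by (auto simp: PiE_def)
  have rep: "v = lin_comb (tabloids [6]) 1 (\<lambda>i. v (tabloid [6] t)) b" if "v \<in> ?S" for v
  proof (rule extensionalityI[OF ext[OF that]])
    fix T assume T: "T \<in> tabloids [6]"
    show "v T = lin_comb (tabloids [6]) 1 (\<lambda>i. v (tabloid [6] t)) b T"
      using T val unfolding all[OF T] by (simp add: lin_comb_def b_def t)
  qed (simp add: lin_comb_def)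
  have basis: "basis_on (tabloids [6]) ?S 1 b"
    unfolding basis_on_def
  proof (intro conjI allI impI ballI)
    show "\<exists>c. v = lin_comb (tabloids [6]) 1 c b" if "v \<in> ?S" for v using rep[OF that] by blast
    show "c i = c' i" if eq: "lin_comb (tabloids [6]) 1 c b = lin_comb (tabloids [6]) 1 c' b" and "i < 1" for c c' i
      using fun_cong[OF eq, of "tabloid [6] t"] \<open>i < 1\<close> val by (simp add: lin_comb_def b_def t One_nat_def)
  qed (rule bS)
  have act: "tableau_act [6] (inv\<^bsub>sym_group (sum_list [6])\<^esub> \<sigma>) ` T \<in> tabloids [6]" if T: "T \<in> tabloids [6]" for T
  proof -
    have "inv' \<sigma> permutes {1..sum_list [6]}" using permutes_inv[OF \<sigma>] by simp
    then show ?thesis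
      unfolding all[OF T] using \<sigma> t by (simp add: sym_group_carrier tabloid_act tableau_act_tableau)
  qed
  have ga: "gact ?P \<sigma> (b j) = lin_comb (tabloids [6]) 1 (\<lambda>i. 1) b" for j
  proof -
    have "b j \<in> carrier ?P" unfolding b_def by (rule polytabloid_closed)
    from tabloid_6_gact[OF this \<sigma>] rep[OF bS[of j]] show ?thesis by (simp add: b_def val)
  qed
  have "character complex_field (?P\<lparr>carrier := ?S\<rparr>) \<sigma> = (\<Sum>i<(1::nat). 1)"
    unfolding tabloid_gmodule_def
    by (intro character_eq[OF specht_submodule[unfolded tabloid_gmodule_def] _ basis, where A = "\<lambda>i j. 1"])
      (rule act, assumption, rule ga[unfolded tabloid_gmodule_def])
  then show ?thesis
    unfolding ordinary_character_def by (subst specht_eq) simp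
qed

context
  fixes B :: "nat set"
  assumes B: "B \<in> triples"
begin

text \<open>The functions of sum zero form an invariant hyperplane, which \<open>to_42\<close>
  identifies with the Specht module, and the action on the quotient is trivial. In a basis of the
  hyperplane completed by one vector the trace splits accordingly.\<close>

lemma character_ind:
  assumes \<sigma>: "\<sigma> permutes {1..6}"
  shows "character complex_field (ind B) \<sigma> = 1 + ordinary_character [4, 2] \<sigma>"
proof -
  let ?E = "block_indicator :: nat set \<Rightarrow> nat set \<Rightarrow> complex"
  let ?M = "ind B :: complex ind_module"
  let ?P = "permutation_gmodule complex_field (sym_group 6) perms6 (\<otimes>\<^bsub>sym_group 6\<^esub>)"
  let ?T = "tabloid_gmodule complex_field [4, 2]" and ?S = "carrier (specht_gmodule complex_field [4, 2])"
  let ?\<Omega> = "tabloids [4, 2]"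
  let ?K = "{f \<in> carrier ?M. triple_total B f = 0}"
  interpret ind: group_module complex_field "sym_group 6" ?M by (rule group_module_ind)
  obtain x where x: "x \<in> B" using B by (force simp: triples_def)
  then have x6: "x \<in> {1..6}" using B by (auto simp: triples_def)
  \<comment> \<open>Each partition has one block through x, so \<open>X'\<close> represents all
    partitions except the one with block \<open>B\<close>.\<close>
  define X' where "X' = {A \<in> triples. x \<in> A} - {B}"
  have "finite X'" by (simp add: X'_def finite_triples)
  define n where "n = card X'"
  obtain h where h: "bij_betw h {..<n} X'"
    using ex_bij_betw_nat_finite[OF \<open>finite X'\<close>] unfolding n_def atLeast0LessThan by blast
  have hX: "h i \<in> triples" "x \<in> h i" "h i \<noteq> B" if "i < n" for i
    using bij_betwE[OF h] that by (auto simp: X'_def)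
  \<comment> \<open>The first n vectors have sum zero. The last one is the indicator of the
    partition of \<open>B\<close>, whose sum over all triples is 2.\<close>
  define \<beta> where "\<beta> i = (if i < n then unhat B (\<lambda>C. ?E (h i) C - ?E B C) else unhat B (?E B))" for i
  have \<beta>c: "\<beta> i \<in> carrier ?M" for i
    unfolding \<beta>_def using hX(1) B
    by (auto intro!: unhat_closed[OF B] simp: block_indicator_other_block)
  have hat\<beta>: "hat B (\<beta> i) C = (if i < n then ?E (h i) C - ?E B C else ?E B C)" if "C \<in> triples" for i C
    using hat_unhat[OF B that, where 'a = complex] by (simp add: \<beta>_def)
  have E: "?E A C = of_bool (C = A)" if "A \<in> triples" "x \<in> A" "C \<in> triples" "x \<in> C" for A C
    using that by (auto simp: block_indicator_def)
  have total_E: "(\<Sum>C\<in>triples. ?E A C) = 2" if "A \<in> triples" for A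
    using sum_block_indicator[OF that, of "{}", where 'a = complex] by simp
  have tot\<beta>: "triple_total B (\<beta> i) = (if i < n then 0 else 2)" for i
  proof -
    have "triple_total B (\<beta> i) = (\<Sum>C\<in>triples. if i < n then ?E (h i) C - ?E B C else ?E B C)"
      unfolding triple_total_def[OF B] by (rule sum.cong) (simp_all add: hat\<beta>)
    then show ?thesis using hX(1) B by (simp add: sum_subtractf total_E)
  qed
  \<comment> \<open>At the triple \<open>h i\<close> only \<open>\<beta> i\<close> is nonzero, so
    the value there is its coefficient. The last coefficient is half the total because only the last
    vector contributes to it, with total 2.\<close>
  define co where "co f i = (if i < n then hat B f (h i) else triple_total B f / 2 :: complex)" for f i
  have rep: "f = lin_comb perms6 (Suc n) (co f) \<beta>" if f: "f \<in> carrier ?M" for f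
  proof (rule ind_eqI[OF B f lin_comb_ind])
    have hat_eq: "hat B f C = hat B (lin_comb perms6 (Suc n) (co f) \<beta>) C" if C: "C \<in> triples" "x \<in> C" for C
    proof -
      have "(\<Sum>i<n. hat B f (h i) * ?E (h i) C) = (\<Sum>A\<in>X'. hat B f A * ?E A C)"
        using sum.reindex_bij_betw[OF h, of "\<lambda>A. hat B f A * ?E A C"] .
      also have "\<dots> = (\<Sum>A\<in>X'. if A = C then hat B f A else 0)"
        using C by (intro sum.cong) (auto simp: X'_def E)
      also have "\<dots> = (if C \<in> X' then hat B f C else 0)" using \<open>finite X'\<close> by simp
      also have "\<dots> = (if C = B then 0 else hat B f C)" using C by (simp add: X'_def)
      finally have 1: "(\<Sum>i<n. hat B f (h i) * ?E (h i) C) = (if C = B then 0 else hat B f C)" .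
      have "(\<Sum>i<n. hat B f (h i)) = (\<Sum>A\<in>X'. hat B f A)"
        using sum.reindex_bij_betw[OF h] .
      also have "\<dots> = (\<Sum>A | A \<in> triples \<and> x \<in> A. hat B f A) - hat B f B"
        unfolding X'_def using B x finite_triples by (subst sum_diff1) auto
      also have "\<dots> = triple_total B f / 2 - hat B f B"
        using triple_total_half[OF B f x6] by simp
      finally have 2: "(\<Sum>i<n. hat B f (h i)) = triple_total B f / 2 - hat B f B" .
      have "hat B (lin_comb perms6 (Suc n) (co f) \<beta>) C =
          (\<Sum>i<n. hat B f (h i) * (?E (h i) C - ?E B C)) + triple_total B f / 2 * ?E B C"
        by (simp add: hat_lin_comb[OF B C(1)] co_def hat\<beta>[OF C(1)])
      also have "\<dots> = (\<Sum>i<n. hat B f (h i) * ?E (h i) C) - (\<Sum>i<n. hat B f (h i)) * ?E B C + triple_total B f / 2 * ?E B C"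
        by (simp add: algebra_simps sum_subtractf sum_distrib_left sum_distrib_right)
      also have "\<dots> = hat B f C"
        unfolding 1 2 using E[OF B x C] by (cases "C = B") (simp_all add: algebra_simps)
      finally show ?thesis by simp
    qed
    fix C assume C: "C \<in> triples"
    show "hat B f C = hat B (lin_comb perms6 (Suc n) (co f) \<beta>) C"
    proof (cases "x \<in> C")
      case False
      then have "hat B f (other_block C) = hat B (lin_comb perms6 (Suc n) (co f) \<beta>) (other_block C)"
        using x6 by (intro hat_eq other_block_triples(1)[OF C]) simp
      then show ?thesis using hat_other_block[OF B _ C] f lin_comb_ind[of "Suc n" \<beta> B, OF \<beta>c] by metis
    qed (use hat_eq C in blast)
  qed (rule \<beta>c)
  have hat_k: "hat B (lin_comb perms6 n c \<beta>) (h k) = c k" if k: "k < n" for c k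
  proof -
    have "(\<Sum>i<n. c i * (?E (h i) (h k) - ?E B (h k))) = (\<Sum>i<n. if i = k then c i else 0)"
    proof (rule sum.cong)
      fix i assume i: "i \<in> {..<n}"
      have "h k = h i \<longleftrightarrow> k = i"
        using inj_on_eq_iff[OF bij_betw_imp_inj_on[OF h], of k i] i k by simp
      then show "c i * (?E (h i) (h k) - ?E B (h k)) = (if i = k then c i else 0)"
        using E hX[OF k] hX[of i] i B x by auto
    qed simp
    then show ?thesis using k hX(1)[OF k] by (simp add: hat_lin_comb[OF B] hat\<beta>)
  qed
  \<comment> \<open>For functions of sum zero the last coefficient vanishes, so that the vectors
    below n suffice.\<close>
  have lin_Suc: "lin_comb \<Omega>' (Suc n) c b = lin_comb \<Omega>' n c b" if "c n = 0" for \<Omega>' :: "'x set" and c :: "nat \<Rightarrow> complex" and b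
    using that by (auto simp: lin_comb_def intro!: restrict_ext)
  have diff: "lin_comb \<Omega>' m c b = lin_comb \<Omega>' m c' b \<Longrightarrow> x \<in> \<Omega>' \<Longrightarrow> lin_comb \<Omega>' m (\<lambda>i. c i - c' i) b x = 0"
    for \<Omega>' :: "'x set" and c c' :: "nat \<Rightarrow> complex" and b m x
    by (auto simp: lin_comb_def sum_subtractf left_diff_distrib dest: fun_cong[where x = x])
  have basisM: "basis_on perms6 (carrier ?M) (Suc n) \<beta>"
    unfolding basis_on_def
  proof (intro conjI allI impI ballI)
    show "\<exists>c. v = lin_comb perms6 (Suc n) c \<beta>" if "v \<in> carrier ?M" for v using rep[OF that] by blast
    fix c c' i assume eq: "lin_comb perms6 (Suc n) c \<beta> = lin_comb perms6 (Suc n) c' \<beta>" and i: "i < Suc n"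
    have n: "c n = c' n"
      using arg_cong[OF eq, of "triple_total B"] by (simp add: triple_total_lin_comb[OF B] tot\<beta>)
    have "hat B (lin_comb perms6 (Suc n) c \<beta>) (h k) = hat B (lin_comb perms6 n c \<beta>) (h k)" if "k < n" for k c
      using hX[OF that] E[OF B x, of "h k"] by (simp add: hat_lin_comb[OF B] hat\<beta>)
    then have "c k = c' k" if "k < n" for k using that eq hat_k by metis
    then show "c i = c' i" using n i by (cases "i = n") auto
  qed (rule \<beta>c)
  define \<gamma> where "\<gamma> i = to_42 B (\<beta> i)" for i
  have \<gamma>S: "\<gamma> i \<in> ?S" if "i < n" for i
    using to_42_difference_in_specht[OF B hX(1)[OF that] B, where 'a = complex] that
    by (simp add: \<gamma>_def \<beta>_def)
  have to_rep: "to_42 B f = lin_comb ?\<Omega> n (co f) \<gamma>" if f: "f \<in> ?K" for f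
  proof -
    have "to_42 B f = lin_comb ?\<Omega> (Suc n) (co f) \<gamma>"
      using arg_cong[OF rep[of f], of "to_42 B"] f by (simp add: to_42_lin_comb[OF B] \<gamma>_def[abs_def])
    moreover have "co f n = 0" using f by (simp add: co_def)
    ultimately show ?thesis by (simp only: lin_Suc)
  qed
  have K: "submodule (to_42 B ` ?K) complex_field ?T"
  proof -
    have tot_add: "pair_sum B (f \<oplus>\<^bsub>?M\<^esub> g) S = pair_sum B f S + pair_sum B g S"
      and tot_smult: "pair_sum B (a \<odot>\<^bsub>?M\<^esub> f) S = a * pair_sum B f S"
      and tot_zero: "pair_sum B \<zero>\<^bsub>?M\<^esub> S = 0" for f g a S
      by (simp_all add: pair_sum_def[OF B] hat_simps[OF B] sum.distrib sum_distrib_left)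
    have "submodule ?K complex_field ?M"
      by (rule ind.submoduleI') (auto simp: triple_total_eq_pair_sum[OF B] tot_add tot_smult tot_zero)
    then have "group_submodule complex_field (sym_group 6) ?M ?K"
      by (auto simp: group_submodule_def sym_group_carrier triple_total_gact[OF B] ind.gact_closed)
    then show ?thesis
      by (rule image_submodule[OF group_module_ind _ module_tabloid_gmodule])
        (auto simp: to_42_def[OF B] tot_add tot_smult intro!: restrict_ext)
  qed
  have S_sub: "?S \<subseteq> to_42 B ` ?K"
    using polytabloid_42_in_image[OF B] by (rule specht_subset[OF K])
  have basisS: "basis_on ?\<Omega> ?S n \<gamma>"
    unfolding basis_on_def
  proof (intro conjI allI impI ballI)
    show "\<exists>c. v = lin_comb ?\<Omega> n c \<gamma>" if "v \<in> ?S" for v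
      using S_sub that to_rep by blast
    fix c c' i assume eq: "lin_comb ?\<Omega> n c \<gamma> = lin_comb ?\<Omega> n c' \<gamma>" and i: "i < n"
    \<comment> \<open>A linear relation between the images is lifted to a function of sum zero in
      the kernel of \<open>to_42\<close>, which is zero.\<close>
    let ?f = "lin_comb perms6 n (\<lambda>i. c i - c' i) \<beta>"
    have fc: "?f \<in> carrier ?M" by (rule lin_comb_ind[OF \<beta>c])
    have "triple_total B ?f = 0" by (simp add: triple_total_lin_comb[OF B] tot\<beta>)
    moreover have "to_42 B ?f T = 0" if "T \<in> ?\<Omega>" for T
      using diff[OF eq that] by (simp add: to_42_lin_comb[OF B] \<gamma>_def[abs_def])
    ultimately have "hat B ?f (h i) = 0" by (rule to_42_injective[OF B fc _ _ hX(1)[OF i]])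
    then show "c i = c' i" using hat_k[OF i] by simp
  qed (rule \<gamma>S)
  define A where "A i j = co (gact ?M \<sigma> (\<beta> j)) i" for i j
  have \<sigma>': "\<sigma> \<in> carrier (sym_group 6)" using \<sigma> by (simp add: sym_group_carrier)
  have gact_eq: "gact ?P = gact ?M" using arg_cong[OF ind_eq[where 'a = complex, of B], of gact] by simp
  have "\<sigma>' \<in> perms6 \<Longrightarrow> inv\<^bsub>sym_group 6\<^esub> \<sigma> \<otimes>\<^bsub>sym_group 6\<^esub> \<sigma>' \<in> perms6" for \<sigma>'
    using \<sigma> \<sigma>' permutes_inv[OF \<sigma>] by (simp add: sym_group_mult permutes_compose)
  then have "character complex_field (?P\<lparr>carrier := carrier ?M\<rparr>) \<sigma> = (\<Sum>i<Suc n. A i i)"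
    using rep[OF ind.gact_closed[OF \<sigma>' \<beta>c]]
    by (intro character_eq[OF submodule_ind _ basisM]) (simp_all only: gact_eq A_def)
  then have chM: "character complex_field ?M \<sigma> = (\<Sum>i<n. A i i) + A n n"
    by (subst ind_eq) simp
  \<comment> \<open>The action preserves the total, so the translate of the last vector still has
    total 2 and last coefficient 1.\<close>
  have "A n n = 1" by (simp add: A_def co_def triple_total_gact[OF B \<beta>c \<sigma>] tot\<beta>)
  have act: "tableau_act [4, 2] (inv\<^bsub>sym_group (sum_list [4, 2])\<^esub> \<sigma>) ` T \<in> ?\<Omega>" if "T \<in> ?\<Omega>" for T
  proof -
    obtain u where u: "u \<in> tableaux [4, 2]" "T = tabloid [4, 2] u" using \<open>T \<in> ?\<Omega>\<close> by (rule tabloidsE)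
    have "inv' \<sigma> permutes {1..sum_list [4, 2]}" using permutes_inv[OF \<sigma>] by simp
    then show ?thesis
      unfolding u(2) using \<sigma> u(1) by (simp add: sym_group_carrier tabloid_act tableau_act_tableau)
  qed
  \<comment> \<open>Translates of functions of sum zero have sum zero again. Hence the block of
    \<open>A\<close> below n is the matrix of the action on the Specht module in the basis
    \<open>\<gamma>\<close>.\<close>
  have gS: "gact ?T \<sigma> (\<gamma> j) = lin_comb ?\<Omega> n (\<lambda>i. A i j) \<gamma>" if "j < n" for j
  proof -
    have "gact ?M \<sigma> (\<beta> j) \<in> ?K"
      using ind.gact_closed[OF \<sigma>' \<beta>c] that by (simp add: triple_total_gact[OF B \<beta>c \<sigma>] tot\<beta>)
    from to_rep[OF this] show ?thesis
      by (simp add: \<gamma>_def to_42_gact[OF B \<beta>c \<sigma>] A_def[abs_def] cong: if_cong)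
  qed
  have "character complex_field (?T\<lparr>carrier := ?S\<rparr>) \<sigma> = (\<Sum>i<n. A i i)"
    unfolding tabloid_gmodule_def
    by (intro character_eq[OF specht_submodule[unfolded tabloid_gmodule_def] _ basisS])
      (rule act, assumption, rule gS[unfolded tabloid_gmodule_def])
  then have "ordinary_character [4, 2] \<sigma> = (\<Sum>i<n. A i i)"
    unfolding ordinary_character_def by (subst specht_eq)
  then show ?thesis using chM \<open>A n n = 1\<close> by simp
qed

end

theorem mainTheorem6:
  fixes P :: "nat set set"
  assumes "partition_on {1..6} P" and "card P = 2" and "\<forall>B\<in>P. card B = 3"
  shows
    "has_specht_filtration F2 6
       (induced_gmodule (sym_group 6) (set_partition_stabilizer 6 P) (trivial_gmodule F2)) \<and>
     (\<forall>\<sigma>\<in>carrier (sym_group 6).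
       character complex_field
         (induced_gmodule (sym_group 6) (set_partition_stabilizer 6 P) (trivial_gmodule complex_field)) \<sigma> =
       ordinary_character [6] \<sigma> + ordinary_character [4, 2] \<sigma>) \<and>
     \<not> has_specht_filtration_with_factors F2 6
       (induced_gmodule (sym_group 6) (set_partition_stabilizer 6 P) (trivial_gmodule F2))
       {#[6], [4, 2]#}"
proof -
  obtain B C where P: "P = {B, C}" "B \<noteq> C" using assms(2) by (auto simp: card_2_iff)
  have un: "B \<union> C = {1..6}" "B \<inter> C = {}"
    using assms(1) P by (auto simp: partition_on_def disjoint_def)
  then have C: "C = other_block B" by blast
  have B: "B \<in> triples" using assms(3) un P by (auto simp: triples_def)
  have stab: "set_partition_stabilizer 6 P = block_stabilizer B"
  proof (intro equalityI subsetI)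
    fix \<sigma> assume "\<sigma> \<in> set_partition_stabilizer 6 P"
    then have "\<sigma> permutes {1..6}" "{\<sigma> ` B, \<sigma> ` C} = {B, C}"
      by (simp_all add: set_partition_stabilizer_def sym_group_carrier P)
    then show "\<sigma> \<in> block_stabilizer B"
      unfolding block_stabilizer_def C by (simp add: doubleton_eq_iff) blast
  next
    fix \<sigma> assume "\<sigma> \<in> block_stabilizer B"
    then have \<sigma>: "\<sigma> permutes {1..6}" "\<sigma> ` B = B \<or> \<sigma> ` B = C"
      by (simp_all add: block_stabilizer_def C)
    have "\<sigma> ` C = other_block (\<sigma> ` B)" unfolding C by (rule permutes_triples(2)[OF \<sigma>(1)])
    then have "{\<sigma> ` B, \<sigma> ` C} = {B, C}"
      using \<sigma>(2) other_block_triples(2)[OF B] C by (metis insert_commute)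
    then show "\<sigma> \<in> set_partition_stabilizer 6 P"
      using \<sigma>(1) by (simp add: set_partition_stabilizer_def sym_group_carrier P)
  qed
  have "has_specht_filtration F2 6 (ind B :: bit ind_module)"
    unfolding has_specht_filtration_def using ind_specht_filtration[OF B] by blast
  moreover have "character complex_field (ind B) \<sigma> = ordinary_character [6] \<sigma> + ordinary_character [4, 2] \<sigma>"
    if "\<sigma> \<in> carrier (sym_group 6)" for \<sigma>
  proof -
    have "\<sigma> permutes {1..6}" using that by (simp add: sym_group_carrier)
    then show ?thesis using character_ind[OF B] character_6 by simp
  qed
  ultimately show ?thesis
    using ind_no_specht_filtration[OF B] unfolding stab ind_def[symmetric] by blast
qed

end
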